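(* Let $n\ge 1$, let $b\in B_n$ be a braid word (diagram) on $n$ strands, let $\mathrm{cl}(b)$ be its closure and let $w(\mathrm{cl}(b))$ be its writhe. Let $P^{\mathfrak p}(b)$ be the operator on the parabolic Verma module $M^{\mathfrak p}(\beta)$ of $U_q(\mathfrak{gl}_{2n})$ associated to $b$ as described in the context; it preserves the highest weight space, and so defines an element $P^{\mathfrak p}(b)\in \mathrm{End}_{U_q(\mathfrak{gl}_{2n})}(M^{\mathfrak p}(\beta))$. Then $\lambda^{w(\mathrm{cl}(b))}P^{\mathfrak p}(b)\in \mathrm{End}_{U_q(\mathfrak{gl}_{2n})}(M^{\mathfrak p}(\beta))$ is a link invariant of the closure of $b$: it is a multiple of the identity, and the coefficient equals the HOMFLY-PT polynomial $\mathrm{H}(\mathrm{cl}(b))\in\mathbb Q(q,\lambda)$.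
   Context: **Quantum group.** $\beta$ is a formal parameter and $\lambda=q^{\beta}$ is an indeterminate independent of $q$. Let $\Upsilon=\{-n+1,\dots,n\}$ and $I=\{-n+1,\dots,n-1\}$. For $i\in I$, $\gamma\in\Upsilon$ put $\alpha_i(\gamma)=1$ if $\gamma=i$, $-1$ if $\gamma=i+1$, and $0$ otherwise. $U_q(\mathfrak{gl}_{2n})$ is the algebra over $\mathbb Q(q,\lambda)$ generated by $E_i,F_i$ ($i\in I$) and $K_\gamma^{\pm1}$ ($\gamma\in\Upsilon$) with relations: the $K_\gamma$ commute and are invertible; $K_\gamma E_i=q^{\alpha_i(\gamma)}E_iK_\gamma$; $K_\gamma F_i=q^{-\alpha_i(\gamma)}F_iK_\gamma$; $E_iF_j-F_jE_i=\delta_{ij}\frac{\tilde K_i-\tilde K_i^{-1}}{q-q^{-1}}$ with $\tilde K_i=K_iK_{i+1}^{-1}$; for $X=E$ or $X=F$: $X_iX_j=X_jX_i$ if $|i-j|>1$ and $X_i^2X_{i\pm1}+X_{i\pm1}X_i^2=(q+q^{-1})X_iX_{i\pm1}X_i$. **Parabolic Verma module.** $U_q(\mathfrak p)$ is the subalgebra generated by all $E_i$ ($i\in I$), all $K_\gamma^{\pm1}$, and the $F_j$ with $j\in I\setminus\{0\}$. Let $L(\beta)$ be the one-dimensional $U_q(\mathfrak p)$-module spanned by $v$ with $E_iv=0$ for all $i\in I$, $F_jv=0$ for $j\neq0$, $K_\gamma v=\lambda v$ for $\gamma\le 0$ and $K_\gamma v=v$ for $\gamma>0$. So $v$ has weight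 $((\beta)^n,(0)^n)$. Put $M^{\mathfrak p}(\beta)=U_q(\mathfrak{gl}_{2n})\otimes_{U_q(\mathfrak p)}L(\beta)$. A weight is written $(\mu_{-n+1},\dots,\mu_0,\mu_1,\dots,\mu_n)$, meaning $K_\gamma$ acts by $q^{\mu_\gamma}$. Since the highest weight space is the line spanned by $v$, an operator mapping $v$ to $cv$, with $c$ a scalar, is regarded as the endomorphism $c\cdot\mathrm{id}$ of $M^{\mathfrak p}(\beta)$. **The element $P^{\mathfrak p}(b)$.** Products act from right to left. For $1\le j\le n$ put $C_j=(F_{j-1}F_{-(j-1)})\cdots(F_2F_{-2})(F_1F_{-1})F_0$ and $D_j=E_0(E_1E_{-1})(E_2E_{-2})\cdots(E_{j-1}E_{-(j-1)})$ (so $C_1=F_0$, $D_1=E_0$). The word $C_1C_2\cdots C_n$ ($C_n$ applied first) sends the weight $((\beta)^n,(0)^n)$ to $((\beta-1)^n,(1)^n)$, and $D_n\cdots D_2D_1$ ($D_1$ applied first) goes back; they encode the nested cups and caps closing the braid on its left. On the weight space $((\beta-1)^n,(1)^n)$ set, for $1\le i\le n-1$, $\sigma_i\mapsto -F_iE_i+q^{-1}$ and $\sigma_i^{-1}\mapsto q-E_iF_i$. Here $\sigma_i$ is the positive crossing between the $i$th and $(i+1)$th strands counted from the left: strands are oriented upwards and the overstrand goes from bottom left to top right. Writing $b=\sigma_{i_1}^{\epsilon_1}\cdots\sigma_{i_r}^{\epsilon_r}$ (read as stacking, leftmost on top) let $T(b)$ be the product of the corresponding operators. Then $P^{\mathfrak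 p}(b)=(D_n\cdots D_1)\,T(b)\,(C_1\cdots C_n)$. **HOMFLY-PT polynomial.** $\mathrm H$ is the oriented link invariant with values in $\mathbb Q(q,\lambda)$ determined by $\lambda^{-1}\mathrm H(L_+)-\lambda\,\mathrm H(L_-)=(q^{-1}-q)\mathrm H(L_0)$ and $\mathrm H(\text{unknot})=\frac{\lambda-\lambda^{-1}}{q-q^{-1}}$, where $L_+,L_-,L_0$ differ at one positive crossing, negative crossing, or oriented smoothing. The writhe is the number of positive crossings minus the number of negative crossings. *)

theory Defs
  imports
    "HOL-Algebra.QuotRing"
    "HOL-Algebra.Module"
    "HOL-Algebra.Generated_Rings"
    "HOL-Algebra.Free_Abelian_Groups"
    "HOL-Computational_Algebra.Fraction_Field"
    "HOL-Computational_Algebra.Polynomial"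
begin

section \<open>The ground field\<close>

text \<open>
  The field of rational functions in two independent variables, as the fraction field of
  the ring of polynomials in \<lambda> (outer variable) over the rational polynomials
  in q (inner variable).
\<close>

type_synonym qfield = "rat poly poly fract"

definition qq :: qfield where
  "qq = Fract [:[:0, 1:]:] 1"

definition lam :: qfield where
  "lam = Fract [:0, 1:] 1"


section \<open>Algebras by generators and relations\<close>

text \<open>
  Words form the free monoid, written additively, so that finitely supported functions on
  words with their convolution product are the free associative algebra.
\<close>

datatype 'a fword = FWord (letters: "'a list")

instantiation fword :: (type) monoid_add
begin

definition zero_fword :: "'a fword" where
  "zero_fword = FWord []"

definition plus_fword :: "'a fword \<Rightarrow> 'a fword \<Rightarrow> 'a fword" where
  "plus_fword u w = FWord (letters u @ letters w)"

instance
  by standard (simp_all add: zero_fword_def plus_fword_def)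

end

type_synonym ('a, 'k) falg = "'a fword \<Rightarrow>\<^sub>0 'k"

definition gen :: "'a \<Rightarrow> ('a, 'k::comm_ring_1) falg" where
  "gen g = Poly_Mapping.single (FWord [g]) 1"

definition scal :: "'k \<Rightarrow> ('a, 'k::comm_ring_1) falg" where
  "scal c = Poly_Mapping.single 0 c"

definition free_algebra :: "'a set \<Rightarrow> ('a, 'k::comm_ring_1) falg ring" where
  "free_algebra G =
    \<lparr>carrier = {x. \<forall>w \<in> Poly_Mapping.keys x. set (letters w) \<subseteq> G},
     monoid.mult = (*), monoid.one = 1, ring.zero = 0, ring.add = (+)\<rparr>"


section \<open>The quantum group\<close>

datatype uq_gen = GE int | GF int | GK int | GKinv int

definition idxI :: "nat \<Rightarrow> int set" where
  "idxI n = {- int n + 1 .. int n - 1}"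

definition idxY :: "nat \<Rightarrow> int set" where
  "idxY n = {- int n + 1 .. int n}"

definition alpha :: "int \<Rightarrow> int \<Rightarrow> int" where
  "alpha i \<gamma> = (if \<gamma> = i then 1 else if \<gamma> = i + 1 then -1 else 0)"

definition uq_gens :: "nat \<Rightarrow> uq_gen set" where
  "uq_gens n = GE ` idxI n \<union> GF ` idxI n \<union> GK ` idxY n \<union> GKinv ` idxY n"

type_synonym uq_free = "(uq_gen, qfield) falg"

abbreviation gE :: "int \<Rightarrow> uq_free" where "gE i \<equiv> gen (GE i)"
abbreviation gF :: "int \<Rightarrow> uq_free" where "gF i \<equiv> gen (GF i)"
abbreviation gK :: "int \<Rightarrow> uq_free" where "gK \<gamma> \<equiv> gen (GK \<gamma>)"
abbreviation gKinv :: "int \<Rightarrow> uq_free" where "gKinv \<gamma> \<equiv> gen (GKinv \<gamma>)"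

text \<open>A relation a = b is represented by the element a - b of the free algebra.\<close>

definition uq_rels :: "nat \<Rightarrow> uq_free set" where
  "uq_rels n =
     {gK \<gamma> * gK \<delta> - gK \<delta> * gK \<gamma> | \<gamma> \<delta>. \<gamma> \<in> idxY n \<and> \<delta> \<in> idxY n}
   \<union> {gK \<gamma> * gKinv \<gamma> - 1 | \<gamma>. \<gamma> \<in> idxY n}
   \<union> {gKinv \<gamma> * gK \<gamma> - 1 | \<gamma>. \<gamma> \<in> idxY n}
   \<union> {gK \<gamma> * gE i - scal (qq powi alpha i \<gamma>) * gE i * gK \<gamma> | \<gamma> i. \<gamma> \<in> idxY n \<and> i \<in> idxI n}
   \<union> {gK \<gamma> * gF i - scal (qq powi (- alpha i \<gamma>)) * gF i * gK \<gamma> | \<gamma> i. \<gamma> \<in> idxY n \<and> i \<in> idxI n}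
   \<union> {gE i * gF i - gF i * gE i
        - scal (1 / (qq - 1 / qq)) * (gK i * gKinv (i + 1) - gK (i + 1) * gKinv i) | i. i \<in> idxI n}
   \<union> {gE i * gF j - gF j * gE i | i j. i \<in> idxI n \<and> j \<in> idxI n \<and> i \<noteq> j}
   \<union> {X i * X j - X j * X i | X i j. X \<in> {gE, gF} \<and> i \<in> idxI n \<and> j \<in> idxI n \<and> \<bar>i - j\<bar> > 1}
   \<union> {X i * X i * X j + X j * X i * X i - scal (qq + 1 / qq) * X i * X j * X i | X i j.
        X \<in> {gE, gF} \<and> i \<in> idxI n \<and> j \<in> idxI n \<and> \<bar>i - j\<bar> = 1}"

type_synonym uq = "uq_free set"

definition Uq :: "nat \<Rightarrow> uq ring" where
  "Uq n = free_algebra (uq_gens n) Quot (Idl\<^bsub>free_algebra (uq_gens n)\<^esub> uq_rels n)"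

definition cls :: "nat \<Rightarrow> uq_free \<Rightarrow> uq" where
  "cls n x = (Idl\<^bsub>free_algebra (uq_gens n)\<^esub> uq_rels n) +>\<^bsub>free_algebra (uq_gens n)\<^esub> x"

definition uscal :: "nat \<Rightarrow> qfield \<Rightarrow> uq" where
  "uscal n c = cls n (scal c)"

text \<open>
  The scalars are adjoined to the generators because \<^const>\<open>generate_ring\<close> produces
  subrings, not subalgebras.
\<close>

definition Up_carrier :: "nat \<Rightarrow> uq set" where
  "Up_carrier n = generate_ring (Uq n)
     (range (uscal n) \<union> cls n ` (gE ` idxI n \<union> gK ` idxY n \<union> gKinv ` idxY n \<union> gF ` (idxI n - {0})))"

definition Up :: "nat \<Rightarrow> uq ring" where
  "Up n = Uq n \<lparr>carrier := Up_carrier n\<rparr>"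


section \<open>Left modules and induction\<close>

text \<open>The locale \<^locale>\<open>module\<close> of the library requires a commutative base ring.\<close>

locale left_module = R?: ring R + M?: abelian_group M
  for R :: "('a, 'r) ring_scheme" (structure) and M :: "('a, 'b, 'd) module_scheme" (structure) +
  assumes smult_closed:
      "\<lbrakk>a \<in> carrier R; x \<in> carrier M\<rbrakk> \<Longrightarrow> a \<odot>\<^bsub>M\<^esub> x \<in> carrier M"
    and smult_l_distr:
      "\<lbrakk>a \<in> carrier R; b \<in> carrier R; x \<in> carrier M\<rbrakk>
        \<Longrightarrow> (a \<oplus> b) \<odot>\<^bsub>M\<^esub> x = a \<odot>\<^bsub>M\<^esub> x \<oplus>\<^bsub>M\<^esub> b \<odot>\<^bsub>M\<^esub> x"
    and smult_r_distr:
      "\<lbrakk>a \<in> carrier R; x \<in> carrier M; y \<in> carrier M\<rbrakk>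
        \<Longrightarrow> a \<odot>\<^bsub>M\<^esub> (x \<oplus>\<^bsub>M\<^esub> y) = a \<odot>\<^bsub>M\<^esub> x \<oplus>\<^bsub>M\<^esub> a \<odot>\<^bsub>M\<^esub> y"
    and smult_assoc:
      "\<lbrakk>a \<in> carrier R; b \<in> carrier R; x \<in> carrier M\<rbrakk>
        \<Longrightarrow> (a \<otimes> b) \<odot>\<^bsub>M\<^esub> x = a \<odot>\<^bsub>M\<^esub> (b \<odot>\<^bsub>M\<^esub> x)"
    and smult_one: "x \<in> carrier M \<Longrightarrow> \<one> \<odot>\<^bsub>M\<^esub> x = x"

text \<open>Module endomorphisms, made extensional so that equality of functions is equality of maps.\<close>

definition module_End ::
  "('a, 'r) ring_scheme \<Rightarrow> ('a, 'b, 'd) module_scheme \<Rightarrow> ('b \<Rightarrow> 'b) set" where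
  "module_End R M =
    {\<phi> \<in> carrier M \<rightarrow>\<^sub>E carrier M.
       (\<forall>x \<in> carrier M. \<forall>y \<in> carrier M. \<phi> (x \<oplus>\<^bsub>M\<^esub> y) = \<phi> x \<oplus>\<^bsub>M\<^esub> \<phi> y) \<and>
       (\<forall>a \<in> carrier R. \<forall>x \<in> carrier M. \<phi> (a \<odot>\<^bsub>M\<^esub> x) = a \<odot>\<^bsub>M\<^esub> \<phi> x)}"

text \<open>
  The tensor product of a ring R, regarded as a right module over a subring S, with a left
  S-module L: the free abelian group on pairs modulo biadditivity and S-balancedness, with
  R acting on the left factor. The images in \<open>smult\<close> are all the same coset.
\<close>

definition tensor_gens ::
  "('a, 'r) ring_scheme \<Rightarrow> ('a, 'l, 'd) module_scheme \<Rightarrow> ('a \<times> 'l \<Rightarrow>\<^sub>0 int) monoid" where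
  "tensor_gens R L = free_Abelian_group (carrier R \<times> carrier L)"

definition tensor_rels ::
  "('a, 'r) ring_scheme \<Rightarrow> 'a set \<Rightarrow> ('a, 'l, 'd) module_scheme \<Rightarrow> ('a \<times> 'l \<Rightarrow>\<^sub>0 int) set" where
  "tensor_rels R S L = generate (tensor_gens R L)
    ( {frag_of (x \<oplus>\<^bsub>R\<^esub> y, l) - frag_of (x, l) - frag_of (y, l) | x y l.
         x \<in> carrier R \<and> y \<in> carrier R \<and> l \<in> carrier L}
    \<union> {frag_of (x, l \<oplus>\<^bsub>L\<^esub> m) - frag_of (x, l) - frag_of (x, m) | x l m.
         x \<in> carrier R \<and> l \<in> carrier L \<and> m \<in> carrier L}
    \<union> {frag_of (x \<otimes>\<^bsub>R\<^esub> s, l) - frag_of (x, s \<odot>\<^bsub>L\<^esub> l) | x s l.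
         x \<in> carrier R \<and> s \<in> S \<and> l \<in> carrier L})"

definition induced_module ::
  "('a, 'r) ring_scheme \<Rightarrow> 'a set \<Rightarrow> ('a, 'l, 'd) module_scheme
     \<Rightarrow> ('a, ('a \<times> 'l \<Rightarrow>\<^sub>0 int) set) module" where
  "induced_module R S L =
    (let G = tensor_gens R L; N = tensor_rels R S L in
     \<lparr>carrier = carrier (G Mod N),
      monoid.mult = undefined, monoid.one = undefined,
      ring.zero = \<one>\<^bsub>G Mod N\<^esub>,
      ring.add = (\<otimes>\<^bsub>G Mod N\<^esub>),
      module.smult = (\<lambda>a X. the_elem
        ((\<lambda>c. N #>\<^bsub>G\<^esub> frag_extend (\<lambda>(x, l). frag_of (a \<otimes>\<^bsub>R\<^esub> x, l)) c) ` X))\<rparr>)"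


section \<open>The parabolic Verma module\<close>

definition top_weight :: "int \<Rightarrow> qfield" where
  "top_weight \<gamma> = (if \<gamma> \<le> 0 then lam else 1)"

text \<open>
  L is a one-dimensional module over the parabolic subalgebra, spanned by v, with the
  prescribed action of the generators. The vector space structure of a module is the one
  given by the central subfield \<open>range (uscal n)\<close>.
\<close>

definition is_L_beta :: "nat \<Rightarrow> (uq, 'l) module \<Rightarrow> 'l \<Rightarrow> bool" where
  "is_L_beta n L v \<longleftrightarrow>
     left_module (Up n) L \<and>
     v \<in> carrier L \<and> v \<noteq> \<zero>\<^bsub>L\<^esub> \<and> (\<forall>l \<in> carrier L. \<exists>c. l = uscal n c \<odot>\<^bsub>L\<^esub> v) \<and>
     (\<forall>i \<in> idxI n. cls n (gE i) \<odot>\<^bsub>L\<^esub> v = \<zero>\<^bsub>L\<^esub>) \<and>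
     (\<forall>j \<in> idxI n - {0}. cls n (gF j) \<odot>\<^bsub>L\<^esub> v = \<zero>\<^bsub>L\<^esub>) \<and>
     (\<forall>\<gamma> \<in> idxY n. cls n (gK \<gamma>) \<odot>\<^bsub>L\<^esub> v = uscal n (top_weight \<gamma>) \<odot>\<^bsub>L\<^esub> v)"

definition Mp :: "nat \<Rightarrow> (uq, 'l) module \<Rightarrow> (uq, (uq \<times> 'l \<Rightarrow>\<^sub>0 int) set) module" where
  "Mp n L = induced_module (Uq n) (Up_carrier n) L"

definition highest_weight_space :: "nat \<Rightarrow> (uq, 'l) module \<Rightarrow> (uq \<times> 'l \<Rightarrow>\<^sub>0 int) set set" where
  "highest_weight_space n L =
    {m \<in> carrier (Mp n L). \<forall>\<gamma> \<in> idxY n.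
       cls n (gK \<gamma>) \<odot>\<^bsub>Mp n L\<^esub> m = uscal n (top_weight \<gamma>) \<odot>\<^bsub>Mp n L\<^esub> m}"

definition scale_End ::
  "nat \<Rightarrow> (uq, 'b) module \<Rightarrow> qfield \<Rightarrow> ('b \<Rightarrow> 'b) \<Rightarrow> 'b \<Rightarrow> 'b" where
  "scale_End n M c \<phi> = (\<lambda>m \<in> carrier M. uscal n c \<odot>\<^bsub>M\<^esub> \<phi> m)"

definition id_End :: "(uq, 'b) module \<Rightarrow> 'b \<Rightarrow> 'b" where
  "id_End M = (\<lambda>m \<in> carrier M. m)"


section \<open>Braid words and the associated operator\<close>

text \<open>
  The letter \<open>(i, True)\<close> is the positive generator with index i, \<open>(i, False)\<close> its inverse.
  The first letter of a word is on top of the diagram.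
\<close>

type_synonym braid_word = "(nat \<times> bool) list"

definition is_braid_word :: "nat \<Rightarrow> braid_word \<Rightarrow> bool" where
  "is_braid_word n b \<longleftrightarrow> (\<forall>(i, \<epsilon>) \<in> set b. 1 \<le> i \<and> i < n)"

definition opC :: "nat \<Rightarrow> uq_free" where
  "opC j = (\<Prod>k \<leftarrow> rev [1..<j]. gF (int k) * gF (- int k)) * gF 0"

definition opD :: "nat \<Rightarrow> uq_free" where
  "opD j = gE 0 * (\<Prod>k \<leftarrow> [1..<j]. gE (int k) * gE (- int k))"

definition opT :: "braid_word \<Rightarrow> uq_free" where
  "opT b = (\<Prod>(i, \<epsilon>) \<leftarrow> b.
     if \<epsilon> then scal (1 / qq) - gF (int i) * gE (int i)
     else scal qq - gE (int i) * gF (int i))"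

definition opP :: "nat \<Rightarrow> braid_word \<Rightarrow> uq_free" where
  "opP n b = (\<Prod>j \<leftarrow> rev [1..<Suc n]. opD j) * opT b * (\<Prod>j \<leftarrow> [1..<Suc n]. opC j)"

definition act_P ::
  "nat \<Rightarrow> (uq, 'l) module \<Rightarrow> braid_word \<Rightarrow> (uq \<times> 'l \<Rightarrow>\<^sub>0 int) set \<Rightarrow> (uq \<times> 'l \<Rightarrow>\<^sub>0 int) set" where
  "act_P n L b m = cls n (opP n b) \<odot>\<^bsub>Mp n L\<^esub> m"

text \<open>The endomorphism of the module determined by an operator on its highest weight space.\<close>

definition extends_hw ::
  "nat \<Rightarrow> (uq, 'l) module \<Rightarrow> ((uq \<times> 'l \<Rightarrow>\<^sub>0 int) set \<Rightarrow> (uq \<times> 'l \<Rightarrow>\<^sub>0 int) set)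
     \<Rightarrow> ((uq \<times> 'l \<Rightarrow>\<^sub>0 int) set \<Rightarrow> (uq \<times> 'l \<Rightarrow>\<^sub>0 int) set) \<Rightarrow> bool" where
  "extends_hw n L f \<phi> \<longleftrightarrow>
     \<phi> \<in> module_End (Uq n) (Mp n L) \<and> (\<forall>m \<in> highest_weight_space n L. \<phi> m = f m)"

definition End_P ::
  "nat \<Rightarrow> (uq, 'l) module \<Rightarrow> braid_word \<Rightarrow> (uq \<times> 'l \<Rightarrow>\<^sub>0 int) set \<Rightarrow> (uq \<times> 'l \<Rightarrow>\<^sub>0 int) set" where
  "End_P n L b = (THE \<phi>. extends_hw n L (act_P n L b) \<phi>)"


section \<open>Oriented link diagrams\<close>

text \<open>
  Link diagrams in general position with respect to the height function are cut into
  horizontal layers, each containing one cup, cap or crossing, and listed from bottom to top.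
  The number in a layer counts the strands to the left of the elementary piece.
  A horizontal section is the list of the orientations of its strands (\<open>True\<close>: upwards).

  \<open>Cup a\<close> is a local minimum whose left leg has orientation a. In \<open>Cross True\<close> the strand
  from bottom left to top right is the overstrand, in \<open>Cross False\<close> it is the understrand.
\<close>

datatype piece = Cup bool | Cap | Cross bool

type_synonym layer = "nat \<times> piece"
type_synonym diagram = "layer list"

fun step :: "layer \<Rightarrow> bool list \<Rightarrow> bool list option" where
  "step (k, Cup a) s =
     (if k \<le> length s then Some (take k s @ [a, \<not> a] @ drop k s) else None)"
| "step (k, Cap) s =
     (if k + 1 < length s \<and> s ! k \<noteq> s ! (k + 1) then Some (take k s @ drop (k + 2) s) else None)"
| "step (k, Cross c) s =
     (if k + 1 < length s then Some (s[k := s ! (k + 1), k + 1 := s ! k]) else None)"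

fun top_of :: "diagram \<Rightarrow> bool list \<Rightarrow> bool list option" where
  "top_of [] s = Some s"
| "top_of (l # D) s = (case step l s of None \<Rightarrow> None | Some t \<Rightarrow> top_of D t)"

definition link_diagram :: "diagram \<Rightarrow> bool" where
  "link_diagram D \<longleftrightarrow> top_of D [] = Some []"

text \<open>
  A crossing of two upward strands is positive iff the strand from bottom left to top right
  is over; reversing one of the two strands changes the sign.
\<close>

definition positive_at :: "bool list \<Rightarrow> nat \<Rightarrow> bool \<Rightarrow> bool" where
  "positive_at s k c \<longleftrightarrow> (c \<longleftrightarrow> s ! k = s ! (k + 1))"

fun layer_sign :: "bool list \<Rightarrow> layer \<Rightarrow> int" where
  "layer_sign s (k, Cross c) = (if positive_at s k c then 1 else -1)"
| "layer_sign s _ = 0"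

fun writhe_from :: "bool list \<Rightarrow> diagram \<Rightarrow> int" where
  "writhe_from s [] = 0"
| "writhe_from s (l # D) =
     layer_sign s l + (case step l s of None \<Rightarrow> 0 | Some t \<Rightarrow> writhe_from t D)"

definition writhe :: "diagram \<Rightarrow> int" where
  "writhe D = writhe_from [] D"

text \<open>
  Planar isotopies and Reidemeister moves. The side condition of \<open>R3\<close> excludes the two
  configurations in which none of the three strands is on top.
\<close>

fun width_in :: "piece \<Rightarrow> nat" where
  "width_in (Cup _) = 0"
| "width_in Cap = 2"
| "width_in (Cross _) = 2"

fun width_out :: "piece \<Rightarrow> nat" where
  "width_out (Cup _) = 2"
| "width_out Cap = 0"
| "width_out (Cross _) = 2"

inductive local_move :: "diagram \<Rightarrow> diagram \<Rightarrow> bool" where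
  exchange: "local_move [(0, e), (width_out e + m, e')] [(width_in e + m, e'), (0, e)]"
| zigzag_left: "local_move [(1, Cup a), (0, Cap)] []"
| zigzag_right: "local_move [(0, Cup a), (1, Cap)] []"
| slide_cap: "local_move [(1, Cross c), (0, Cap)] [(0, Cross (\<not> c)), (1, Cap)]"
| slide_cup: "local_move [(0, Cup a), (1, Cross c)] [(1, Cup a), (0, Cross (\<not> c))]"
| R1_cap: "local_move [(0, Cross c), (0, Cap)] [(0, Cap)]"
| R1_cup: "local_move [(0, Cup a), (0, Cross c)] [(0, Cup (\<not> a))]"
| R2: "local_move [(0, Cross c), (0, Cross (\<not> c))] []"
| R3: "c2 = c1 \<or> c2 = c3 \<Longrightarrow>
    local_move [(0, Cross c1), (1, Cross c2), (0, Cross c3)]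
               [(1, Cross c3), (0, Cross c2), (1, Cross c1)]"

definition shift :: "nat \<Rightarrow> diagram \<Rightarrow> diagram" where
  "shift k D = map (\<lambda>(i, e). (k + i, e)) D"

definition diagram_move :: "diagram \<Rightarrow> diagram \<Rightarrow> bool" where
  "diagram_move D D' \<longleftrightarrow> link_diagram D \<and> link_diagram D' \<and>
     (\<exists>A B X Y k. local_move X Y \<and> D = A @ shift k X @ B \<and> D' = A @ shift k Y @ B)"

definition isotopic :: "diagram \<Rightarrow> diagram \<Rightarrow> bool" where
  "isotopic = equivclp diagram_move"

definition link_invariant :: "(diagram \<Rightarrow> 'a) \<Rightarrow> bool" where
  "link_invariant J \<longleftrightarrow>
     (\<forall>D D'. link_diagram D \<longrightarrow> link_diagram D' \<longrightarrow> isotopic D D' \<longrightarrow> J D = J D')"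


section \<open>The HOMFLY-PT polynomial\<close>

definition unknot :: diagram where
  "unknot = [(0, Cup True), (0, Cap)]"

text \<open>
  The oriented smoothing of a crossing is a pair of vertical strands if both strands go in
  the same vertical direction, and a cap below a cup otherwise.
\<close>

definition smoothing :: "bool list \<Rightarrow> nat \<Rightarrow> diagram" where
  "smoothing s k = (if s ! k = s ! (k + 1) then [] else [(k, Cap), (k, Cup (s ! (k + 1)))])"

definition skein_triple :: "diagram \<Rightarrow> diagram \<Rightarrow> diagram \<Rightarrow> bool" where
  "skein_triple Dp Dm D0 \<longleftrightarrow> link_diagram Dp \<and>
     (\<exists>A B k c s. top_of A [] = Some s \<and> positive_at s k c \<and>
        Dp = A @ [(k, Cross c)] @ B \<and>
        Dm = A @ [(k, Cross (\<not> c))] @ B \<and>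
        D0 = A @ smoothing s k @ B)"

definition is_HOMFLY :: "(diagram \<Rightarrow> qfield) \<Rightarrow> bool" where
  "is_HOMFLY H \<longleftrightarrow>
     link_invariant H \<and>
     (\<forall>Dp Dm D0. skein_triple Dp Dm D0 \<longrightarrow>
        (1 / lam) * H Dp - lam * H Dm = (1 / qq - qq) * H D0) \<and>
     H unknot = (lam - 1 / lam) / (qq - 1 / qq)"


section \<open>The closure of a braid\<close>

text \<open>
  The braid strands occupy the positions n, ..., 2 n - 1 and are oriented upwards; they are
  closed by nested cups and caps on the left, the outermost arc closing the rightmost strand.
\<close>

definition braid_diagram :: "nat \<Rightarrow> braid_word \<Rightarrow> diagram" where
  "braid_diagram n b = map (\<lambda>(i, \<epsilon>). (n + i - 1, Cross \<epsilon>)) (rev b)"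

definition closure_diagram :: "nat \<Rightarrow> braid_word \<Rightarrow> diagram" where
  "closure_diagram n b =
     map (\<lambda>k. (k, Cup False)) [0..<n] @ braid_diagram n b @ map (\<lambda>k. (k, Cap)) (rev [0..<n])"

end

theory Submission
  imports Defs
begin

text \<open>
  The operators \<open>q\<^sup>-\<^sup>1 - F\<^sub>iE\<^sub>i\<close> satisfy the Hecke relations on weight vectors whose weights at the
  strands are 1, because weights at positive positions are never negative. Peeling off the innermost
  cup and cap turns a braid in which the first generator occurs at most once into a braid
  on one strand less, up to the factor of an unknot or of a kink. The framed HOMFLY-PT polynomial of
  a closed braid obeys the same rules by isotopy and the skein relation, and these rules determine
  the value on every braid word.
\<close>

section \<open>Reduction of words in a Hecke algebra\<close>

definition hecke_closed :: "nat set \<Rightarrow> (nat list \<Rightarrow> bool) \<Rightarrow> bool" where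
  "hecke_closed J P \<longleftrightarrow> (\<forall>a b. set a \<subseteq> J \<longrightarrow> set b \<subseteq> J \<longrightarrow>
     (\<forall>i\<in>J. P (a @ b) \<longrightarrow> P (a @ i # b) \<longrightarrow> P (a @ i # i # b)) \<and>
     (\<forall>i\<in>J. \<forall>j\<in>J. Suc i < j \<longrightarrow> P (a @ i # j # b) = P (a @ j # i # b)) \<and>
     (\<forall>i\<in>J. Suc i \<in> J \<longrightarrow> P (a @ Suc i # i # Suc i # b) \<longrightarrow> P (a @ i # Suc i # i # b)))"

lemma hecke_closed_sq:
  "\<lbrakk>hecke_closed J P; set a \<subseteq> J; set b \<subseteq> J; i \<in> J; P (a @ b); P (a @ i # b)\<rbrakk> \<Longrightarrow> P (a @ i # i # b)"
  unfolding hecke_closed_def by blast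

lemma hecke_closed_comm:
  "\<lbrakk>hecke_closed J P; set a \<subseteq> J; set b \<subseteq> J; i \<in> J; j \<in> J; Suc i < j\<rbrakk>
    \<Longrightarrow> P (a @ i # j # b) = P (a @ j # i # b)"
  unfolding hecke_closed_def by blast

lemma hecke_closed_braid:
  "\<lbrakk>hecke_closed J P; set a \<subseteq> J; set b \<subseteq> J; i \<in> J; Suc i \<in> J; P (a @ Suc i # i # Suc i # b)\<rbrakk>
    \<Longrightarrow> P (a @ i # Suc i # i # b)"
  unfolding hecke_closed_def by blast

lemma hecke_closed_context:
  assumes P: "hecke_closed J P" and cd: "set c \<subseteq> J" "set d \<subseteq> J"
  shows "hecke_closed J (\<lambda>w. P (c @ w @ d))"
  unfolding hecke_closed_def
proof (intro allI impI conjI ballI)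
  fix a b assume ab: "set a \<subseteq> J" "set b \<subseteq> J"
  have s: "set (c @ a) \<subseteq> J" "set (b @ d) \<subseteq> J"
    using ab cd by auto
  note r = hecke_closed_sq[OF P s] hecke_closed_comm[OF P s] hecke_closed_braid[OF P s]
  show "P (c @ (a @ i # i # b) @ d)"
    if "i \<in> J" "P (c @ (a @ b) @ d)" "P (c @ (a @ i # b) @ d)" for i
    using r(1)[of i] that by simp
  show "P (c @ (a @ i # j # b) @ d) = P (c @ (a @ j # i # b) @ d)"
    if "i \<in> J" "j \<in> J" "Suc i < j" for i j
    using r(2)[of i j] that by simp
  show "P (c @ (a @ i # Suc i # i # b) @ d)"
    if "i \<in> J" "Suc i \<in> J" "P (c @ (a @ Suc i # i # Suc i # b) @ d)" for i
    using r(3)[of i] that by simp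
qed

lemma hecke_closed_move:
  "\<lbrakk>hecke_closed J P; set a \<subseteq> J; set b \<subseteq> J; i \<in> J; set x \<subseteq> J; \<And>j. j \<in> set x \<Longrightarrow> Suc i < j\<rbrakk>
    \<Longrightarrow> P (a @ i # x @ b) = P (a @ x @ i # b)"
proof (induction x arbitrary: a)
  case (Cons j x)
  have "P (a @ i # j # x @ b) = P (a @ j # i # x @ b)"
    using Cons.prems by (intro hecke_closed_comm[OF Cons.prems(1)]) auto
  also have "\<dots> = P ((a @ [j]) @ x @ i # b)"
    using Cons.IH[of "a @ [j]"] Cons.prems by simp
  finally show ?case by simp
qed simp

text \<open>
  A Hecke algebra on the strands from k on is spanned by the words in which the letter k occurs
  at most once: between two neighbouring occurrences there is, inductively, at most one k + 1.
\<close>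

lemma hecke_closed_induct:
  fixes N :: nat
  assumes "hecke_closed {m..<N} P" "m \<le> k"
    and "\<And>w. \<lbrakk>set w \<subseteq> {k..<N}; count_list w k \<le> 1\<rbrakk> \<Longrightarrow> P w"
    and "set w \<subseteq> {k..<N}"
  shows "P w"
  using assms
proof (induction "N - k" arbitrary: k P w)
  case 0
  then show ?case by (cases w) auto
next
  case (Suc d)
  let ?J = "{m..<N}"
  have k: "k < N" using Suc.hyps(2) by simp
  show ?case
    using Suc.prems(4)
  proof (induction "count_list w k" arbitrary: w rule: less_induct)
    case less
    show ?case
    proof (cases "count_list w k \<le> 1")
      case True
      then show ?thesis using Suc.prems(3) less.prems by blast
    next
      case False
      then have "k \<in> set w"
        using count_notin[of k w] by fastforce
      then obtain a w' where w: "w = a @ k # w'" "k \<notin> set a"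
        by (meson split_list_first)
      have "k \<in> set w'"
        using False w count_notin[of k w'] by fastforce
      then obtain x b where w': "w' = x @ k # b" "k \<notin> set x"
        by (meson split_list_first)
      have sets: "set a \<subseteq> {k..<N}" "set b \<subseteq> {k..<N}" "set x \<subseteq> {k..<N}"
        using less.prems w w' by auto
      then have setsJ: "set a \<subseteq> ?J" "set b \<subseteq> ?J" "set x \<subseteq> ?J"
        using \<open>m \<le> k\<close> by auto
      have kJ: "k \<in> ?J" using k \<open>m \<le> k\<close> by auto
      have cnt: "count_list w k = Suc (Suc (count_list b k))"
        using w w' by simp
      define Q where "Q y = P ((a @ [k]) @ y @ k # b)" for y
      have "Q x"
      proof (rule Suc.hyps(1)[of "Suc k"])
        show "hecke_closed ?J Q"
          unfolding Q_def using setsJ kJ by (intro hecke_closed_context[OF Suc.prems(1)]) auto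
        show "set x \<subseteq> {Suc k..<N}"
        proof
          fix j assume "j \<in> set x"
          moreover from this have "j \<noteq> k" using w' by auto
          ultimately show "j \<in> {Suc k..<N}" using sets(3) by (fastforce simp: Suc_le_eq)
        qed
        fix y assume y: "set y \<subseteq> {Suc k..<N}" "count_list y (Suc k) \<le> 1"
        show "Q y"
        proof (cases "Suc k \<in> set y")
          case False
          have gt: "Suc k < j" if "j \<in> set y" for j
            using y(1) False that by (metis atLeastLessThan_iff le_neq_implies_less subsetD)
          have yJ: "set y \<subseteq> ?J" using y \<open>m \<le> k\<close> by auto
          have cy: "count_list y k = 0" using gt by (fastforce intro: count_notin)
          have "P (a @ y @ b)" "P (a @ y @ k # b)"
            using sets y cnt cy w(2) k by (intro less.hyps; force)+
          then have "P ((a @ y) @ k # k # b)"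
            using setsJ yJ kJ by (intro hecke_closed_sq[OF Suc.prems(1)]) auto
          then show ?thesis
            using hecke_closed_move[OF Suc.prems(1), of a "k # b" k y] setsJ yJ kJ gt
            by (simp add: Q_def)
        next
          case True
          then obtain y1 y2 where y12: "y = y1 @ Suc k # y2" "Suc k \<notin> set y1"
            by (meson split_list_first)
          have "Suc k \<notin> set y2"
            using y y12 count_list_0_iff[of y2 "Suc k"] by simp
          then have gt: "Suc k < j" if "j \<in> set y1 \<union> set y2" for j
          proof -
            have "j \<in> set y" "j \<noteq> Suc k"
              using that y12 \<open>Suc k \<notin> set y2\<close> by auto
            then show ?thesis
              using y(1) by (metis atLeastLessThan_iff le_neq_implies_less subsetD)
          qed
          have yJ: "set y1 \<subseteq> ?J" "set y2 \<subseteq> ?J" "Suc k \<in> ?J"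
            using y y12 \<open>m \<le> k\<close> by auto
          have cy: "count_list y1 k = 0" "count_list y2 k = 0"
            using gt by (fastforce intro: count_notin)+
          have "P (a @ y1 @ Suc k # k # Suc k # y2 @ b)"
            using sets y y12 cnt cy w(2) k by (intro less.hyps) auto
          then have "P ((a @ y1) @ k # Suc k # k # y2 @ b)"
            using setsJ yJ kJ by (intro hecke_closed_braid[OF Suc.prems(1)]) auto
          then have "P ((a @ y1 @ [k, Suc k]) @ y2 @ k # b)"
            using hecke_closed_move[OF Suc.prems(1), of "a @ y1 @ [k, Suc k]" b k y2] setsJ yJ kJ gt
            by simp
          then show ?thesis
            using hecke_closed_move[OF Suc.prems(1), of a "Suc k # y2 @ k # b" k y1] setsJ yJ kJ gt
            by (simp add: Q_def y12)
        qed
      qed (use Suc.hyps(2) \<open>m \<le> k\<close> in auto)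
      then show ?thesis
        by (simp add: Q_def w w')
    qed
  qed
qed

lemma signed_word_induct:
  assumes pos: "\<And>w. set w \<subseteq> J \<Longrightarrow> P (map (\<lambda>i. (i, True)) w)"
    and skein: "\<And>a i b. \<lbrakk>fst ` set a \<subseteq> J; i \<in> J; fst ` set b \<subseteq> J; P (a @ (i, True) # b); P (a @ b)\<rbrakk>
      \<Longrightarrow> P (a @ (i, False) # b)"
    and "fst ` set b \<subseteq> J"
  shows "P b"
  using assms(3)
proof (induction "length (filter (Not \<circ> snd) b)" arbitrary: b rule: less_induct)
  case less
  show ?case
  proof (cases "\<exists>i. (i, False) \<in> set b")
    case True
    then obtain i a c where b: "b = a @ (i, False) # c"
      by (meson split_list)
    have "P (a @ (i, True) # c)" "P (a @ c)"
      using less.prems b by (intro less.hyps; auto)+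
    then show ?thesis
      using skein[of a i c] less.prems b by auto
  next
    case False
    then have "snd s" if "s \<in> set b" for s
      using that by (metis prod.collapse)
    then have "b = map (\<lambda>i. (i, True)) (map fst b)"
      by (simp add: map_idI prod_eq_iff)
    then show ?thesis
      using pos[of "map fst b"] less.prems by (metis set_map)
  qed
qed

section \<open>Nonnegativity of weights\<close>

lemma (in vector_space) eqI_functional:
  assumes "\<And>f. \<lbrakk>\<And>a b. f (a + b) = f a + f b; \<And>a b. f (a - b) = f a - f b; \<And>a. f (- a) = - f a;
      f 0 = 0; \<And>c a. f (scale c a) = c * f a\<rbrakk> \<Longrightarrow> f x = (f y :: 'a)"
  shows "x = y"
proof (rule ccontr)
  assume "x \<noteq> y"
  interpret vp: vector_space_pair scale "(*) :: 'a \<Rightarrow> 'a \<Rightarrow> 'a"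
    by unfold_locales (auto simp: algebra_simps)
  have "independent {x - y}"
    using \<open>x \<noteq> y\<close> by simp
  then obtain f where f: "Vector_Spaces.linear scale (*) f" "f (x - y) = (1 :: 'a)"
    using vp.linear_independent_extend[of "{x - y}" "\<lambda>_. 1"] by auto
  interpret f: Vector_Spaces.linear scale "(*)" f
    by (fact f(1))
  have "f x = f y"
    by (rule assms) (simp_all add: f.add f.diff f.neg f.zero f.scale)
  then show False
    using f(2) by (simp add: f.diff)
qed

definition sub_root :: "(int \<Rightarrow> int) \<Rightarrow> int \<Rightarrow> int \<Rightarrow> int" where
  "sub_root \<mu> i \<gamma> = \<mu> \<gamma> - alpha i \<gamma>"

definition add_root :: "(int \<Rightarrow> int) \<Rightarrow> int \<Rightarrow> int \<Rightarrow> int" where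
  "add_root \<mu> i \<gamma> = \<mu> \<gamma> + alpha i \<gamma>"

locale lowering_module = vector_space scale
  for scale :: "'k::field \<Rightarrow> 'm::ab_group_add \<Rightarrow> 'm" (infixr "*s" 75) +
  fixes q :: 'k and n :: nat and F :: "int \<Rightarrow> 'm \<Rightarrow> 'm" and v :: 'm
  assumes q_nz: "q \<noteq> 0" and q2_nz: "q + 1 / q \<noteq> 0"
    and F_add: "F i (x + y) = F i x + F i y"
    and F_scale: "F i (c *s x) = c *s F i x"
    and F_comm: "\<lbrakk>\<bar>i\<bar> < int n; \<bar>j\<bar> < int n; \<bar>i - j\<bar> > 1\<rbrakk> \<Longrightarrow> F i (F j x) = F j (F i x)"
    and F_serre: "\<lbrakk>\<bar>i\<bar> < int n; \<bar>j\<bar> < int n; \<bar>i - j\<bar> = 1\<rbrakk>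
      \<Longrightarrow> F i (F i (F j x)) + F j (F i (F i x)) = (q + 1 / q) *s F i (F j (F i x))"
    and F_v: "\<lbrakk>\<bar>j\<bar> < int n; j \<noteq> 0\<rbrakk> \<Longrightarrow> F j v = 0"
begin

lemma F_zero: "F i 0 = 0"
  using F_scale[of i 0 0] by simp

lemma F_minus: "F i (- x) = - F i x"
  using F_scale[of i "-1" x] by simp

lemma F_diff: "F i (x - y) = F i x - F i y"
  by (simp only: diff_conv_add_uminus F_add F_minus)

lemmas F_lin = F_add F_zero F_minus F_diff F_scale

inductive wt :: "(int \<Rightarrow> int) \<Rightarrow> 'm \<Rightarrow> bool" where
  wt_v: "wt (\<lambda>_. 0) v"
| wt_F: "\<lbrakk>wt \<mu> x; \<bar>i\<bar> < int n\<rbrakk> \<Longrightarrow> wt (sub_root \<mu> i) (F i x)"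
| wt_add: "\<lbrakk>wt \<mu> x; wt \<mu> y\<rbrakk> \<Longrightarrow> wt \<mu> (x + y)"
| wt_scale: "wt \<mu> x \<Longrightarrow> wt \<mu> (c *s x)"
| wt_zero: "wt \<mu> 0"

primrec Z :: "nat \<Rightarrow> 'm \<Rightarrow> 'm" where
  "Z 0 x = F 0 x"
| "Z (Suc a) x = F (int (Suc a)) (Z a x) - (1 / q) *s Z a (F (int (Suc a)) x)"

lemma Z_add: "Z a (x + y) = Z a x + Z a y"
  by (induction a arbitrary: x y) (simp_all add: F_lin scale_right_distrib)

lemma Z_scale: "Z a (c *s x) = c *s Z a x"
  by (induction a arbitrary: x) (simp_all add: F_lin scale_right_diff_distrib mult.commute)

lemma Z_zero: "Z a 0 = 0"
  using Z_scale[of a 0 0] by simp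

lemma Z_minus: "Z a (- x) = - Z a x"
  using Z_scale[of a "-1" x] by simp

lemma Z_diff: "Z a (x - y) = Z a x - Z a y"
  by (simp only: diff_conv_add_uminus Z_add Z_minus)

lemmas Z_lin = Z_add Z_zero Z_minus Z_diff Z_scale

lemma F_Z_far: "\<lbrakk>int a + 1 < i; i < int n\<rbrakk> \<Longrightarrow> F i (Z a x) = Z a (F i x)"
proof (induction a arbitrary: x)
  case 0
  then show ?case by (simp add: F_comm)
next
  case (Suc a)
  have "F i (F (int (Suc a)) y) = F (int (Suc a)) (F i y)" for y
    using Suc.prems by (intro F_comm) auto
  then show ?case
    using Suc by (simp add: F_lin)
qed

lemma F_Z_serre:
  assumes "int a + 1 < int n"
  shows "F (int a + 1) (F (int a + 1) (Z a x)) + Z a (F (int a + 1) (F (int a + 1) x))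
     = (q + 1 / q) *s F (int a + 1) (Z a (F (int a + 1) x))"
proof (cases a)
  case 0
  then show ?thesis
    using assms F_serre[of 1 0 x] by simp
next
  case (Suc b)
  let ?A = "F (int a)" and ?B = "F (int a + 1)"
  have c: "?B (Z b y) = Z b (?B y)" for y
    using assms Suc by (intro F_Z_far) auto
  have s: "?B (?B (?A y)) + ?A (?B (?B y)) = (q + 1 / q) *s ?B (?A (?B y))" for y
    using assms by (intro F_serre) auto
  have Z: "Z a y = ?A (Z b y) - (1 / q) *s Z b (?A y)" for y
    using Suc by (simp add: add.commute)
  have s1: "?B (?B (?A (Z b x))) + ?A (Z b (?B (?B x))) = (q + 1 / q) *s ?B (?A (Z b (?B x)))"
    using s[of "Z b x"] by (simp add: c)
  have s2: "Z b (?B (?B (?A x))) + Z b (?A (?B (?B x))) = (q + 1 / q) *s Z b (?B (?A (?B x)))"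
    using arg_cong[OF s[of x], of "Z b"] by (simp add: Z_lin)
  show ?thesis
  proof (rule eqI_functional)
    fix f
    assume f: "\<And>a b. f (a + b) = f a + (f b :: 'k)" "\<And>a b. f (a - b) = f a - f b" "\<And>a. f (- a) = - f a"
      "f 0 = 0" "\<And>c a. f (c *s a) = c * f a"
    define p where "p = 1 / q"
    show "f (?B (?B (Z a x)) + Z a (?B (?B x))) = f ((q + 1 / q) *s ?B (Z a (?B x)))"
      using arg_cong[OF s1, of f] arg_cong[OF s2, of f]
      by (simp only: Z F_lin Z_lin c f flip: p_def) Groebner_Basis.algebra
  qed
qed

lemma F_Z_eq:
  assumes "1 \<le> a" "int a < int n"
  shows "F (int a) (Z a x) = q *s Z a (F (int a) x)"
proof -
  obtain b where a: "a = Suc b"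
    using assms by (cases a) auto
  have s: "F (int a) (F (int a) (Z b x)) + Z b (F (int a) (F (int a) x))
     = (q + 1 / q) *s F (int a) (Z b (F (int a) x))"
    using F_Z_serre[of b x] assms a by (simp add: add.commute)
  show ?thesis
  proof (rule eqI_functional)
    fix f
    assume f: "\<And>a b. f (a + b) = f a + (f b :: 'k)" "\<And>a b. f (a - b) = f a - f b" "\<And>a. f (- a) = - f a"
      "f 0 = 0" "\<And>c a. f (c *s a) = c * f a"
    show "f (F (int a) (Z a x)) = f (q *s Z a (F (int a) x))"
      using arg_cong[OF s, of f] q_nz
      by (simp add: a F_lin Z_lin f) (simp add: field_simps)
  qed
qed

lemma F_Z_inner_adj:
  assumes "1 \<le> a" "int a + 1 < int n"
  shows "F (int a) (Z (Suc a) x) = Z (Suc a) (F (int a) x)"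
proof -
  obtain b where a: "a = Suc b"
    using assms by (cases a) auto
  let ?A = "F (int a)" and ?B = "F (int a + 1)"
  have c: "?B (Z b y) = Z b (?B y)" for y
    using assms a by (intro F_Z_far) auto
  have Z: "Z a y = ?A (Z b y) - (1 / q) *s Z b (?A y)" for y
    using a by (simp add: add.commute)
  have ZS: "Z (Suc a) y = ?B (Z a y) - (1 / q) *s Z a (?B y)" for y
    by (simp add: add.commute)
  have e: "?A (?A (Z b y)) + Z b (?A (?A y)) = (q + 1 / q) *s ?A (Z b (?A y))" for y
    using F_Z_serre[of b y] assms a by (simp add: add.commute)
  have s: "?A (?A (?B y)) + ?B (?A (?A y)) = (q + 1 / q) *s ?A (?B (?A y))" for y
    using assms by (intro F_serre) auto
  have e1: "?A (?A (Z b (?B x))) + Z b (?A (?A (?B x))) = (q + 1 / q) *s ?A (Z b (?A (?B x)))"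
    by (fact e)
  have e2: "?B (?A (?A (Z b x))) + Z b (?B (?A (?A x))) = (q + 1 / q) *s ?B (?A (Z b (?A x)))"
    using arg_cong[OF e[of x], of ?B] by (simp add: F_lin c)
  have s1: "?A (?A (Z b (?B x))) + ?B (?A (?A (Z b x))) = (q + 1 / q) *s ?A (?B (?A (Z b x)))"
    using s[of "Z b x"] by (simp add: c)
  have s2: "Z b (?A (?A (?B x))) + Z b (?B (?A (?A x))) = (q + 1 / q) *s Z b (?A (?B (?A x)))"
    using arg_cong[OF s[of x], of "Z b"] by (simp add: Z_lin)
  show ?thesis
  proof (rule eqI_functional)
    fix f
    assume f: "\<And>a b. f (a + b) = f a + (f b :: 'k)" "\<And>a b. f (a - b) = f a - f b" "\<And>a. f (- a) = - f a"
      "f 0 = 0" "\<And>c a. f (c *s a) = c * f a"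
    define p where "p = 1 / q"
    have pq: "p * q = 1" using q_nz by (simp add: p_def)
    have eqs: "(q + p) * f (?A (Z (Suc a) x)) = (q + p) * f (Z (Suc a) (?A x))"
      using arg_cong[OF e1, of f] arg_cong[OF e2, of f] arg_cong[OF s1, of f] arg_cong[OF s2, of f] pq
      by (simp only: ZS Z F_lin Z_lin c f flip: p_def) Groebner_Basis.algebra
    then show "f (?A (Z (Suc a) x)) = f (Z (Suc a) (?A x))"
      using q2_nz by (simp add: p_def)
  qed
qed

lemma F_Z_inner:
  assumes "1 \<le> i" "i < int a" "int a < int n"
  shows "F i (Z a x) = Z a (F i x)"
  using assms
proof (induction a arbitrary: x)
  case 0
  then show ?case by simp
next
  case (Suc a)
  show ?case
  proof (cases "i = int a")
    case True
    then show ?thesis using F_Z_inner_adj[of a x] Suc.prems by simp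
  next
    case False
    have "F i (F (int (Suc a)) y) = F (int (Suc a)) (F i y)" for y
      using Suc.prems False by (intro F_comm) auto
    then show ?thesis
      using Suc False by (simp add: F_lin)
  qed
qed

text \<open>
  The root vectors \<open>Z a\<close> raise only the weight at \<open>a + 1\<close> among the positive positions. Words in
  them and in the \<open>F (- j)\<close> span everything, so weights at positive positions are nonnegative.
\<close>

inductive pos_wt :: "(int \<Rightarrow> int) \<Rightarrow> 'm \<Rightarrow> bool" where
  pos_v: "pos_wt (\<lambda>_. 0) v"
| pos_Z: "\<lbrakk>pos_wt \<mu> x; int a < int n; \<And>\<gamma>. 1 \<le> \<gamma> \<Longrightarrow> \<nu> \<gamma> = \<mu> \<gamma> + (if \<gamma> = int a + 1 then 1 else 0)\<rbrakk>
    \<Longrightarrow> pos_wt \<nu> (Z a x)"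
| pos_F: "\<lbrakk>pos_wt \<mu> x; - int n < i; i < 0; \<And>\<gamma>. 1 \<le> \<gamma> \<Longrightarrow> \<nu> \<gamma> = \<mu> \<gamma>\<rbrakk> \<Longrightarrow> pos_wt \<nu> (F i x)"
| pos_add: "\<lbrakk>pos_wt \<mu> x; pos_wt \<mu> y\<rbrakk> \<Longrightarrow> pos_wt \<mu> (x + y)"
| pos_scale: "pos_wt \<mu> x \<Longrightarrow> pos_wt \<mu> (c *s x)"
| pos_zero: "pos_wt \<mu> 0"

lemma pos_wt_vanishes: "\<lbrakk>pos_wt \<mu> x; 1 \<le> \<gamma>; \<mu> \<gamma> < 0\<rbrakk> \<Longrightarrow> x = 0"
proof (induction arbitrary: \<gamma> rule: pos_wt.induct)
  case (pos_Z \<mu> x a \<nu>)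
  have "\<mu> \<gamma> < 0"
    using pos_Z.hyps(3)[of \<gamma>] pos_Z.prems by (auto split: if_splits)
  then show ?case
    using pos_Z.IH[of \<gamma>] pos_Z.prems by (simp add: Z_zero)
next
  case (pos_F \<mu> x i \<nu>)
  then show ?case by (simp add: F_zero)
qed auto

lemma pos_wt_F:
  "\<lbrakk>pos_wt \<mu> x; \<bar>i\<bar> < int n; \<And>\<gamma>. 1 \<le> \<gamma> \<Longrightarrow> \<nu> \<gamma> = sub_root \<mu> i \<gamma>\<rbrakk> \<Longrightarrow> pos_wt \<nu> (F i x)"
proof (induction arbitrary: i \<nu> rule: pos_wt.induct)
  case pos_v
  show ?case
  proof (cases "i = 0")
    case True
    have "pos_wt \<nu> (Z 0 v)"
      using pos_v True by (intro pos_wt.pos_Z[OF pos_wt.pos_v]) (auto simp: sub_root_def alpha_def)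
    then show ?thesis using True by simp
  next
    case False
    then show ?thesis using pos_v by (simp add: F_v pos_zero)
  qed
next
  case (pos_Z \<mu> x a \<nu>')
  have *: "pos_wt \<nu> (Z a (F i x))" if "i \<noteq> 0"
    by (rule pos_wt.pos_Z[OF pos_Z.IH[of i "\<lambda>\<gamma>. \<nu> \<gamma> - (if \<gamma> = int a + 1 then 1 else 0)"]])
       (use pos_Z.hyps pos_Z.prems in \<open>auto simp: sub_root_def\<close>)
  consider "i < 0" | "i = 0" | "1 \<le> i" "i < int a" | "1 \<le> i" "i = int a" | "i = int a + 1" | "i > int a + 1"
    by linarith
  then show ?case
  proof cases
    case 1
    then show ?thesis
      using pos_Z by (intro pos_wt.pos_F[OF pos_wt.pos_Z[OF pos_Z.hyps(1,2)]])
        (auto simp: sub_root_def alpha_def)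
  next
    case 2
    have "pos_wt \<nu> (Z 0 (Z a x))"
      using pos_Z 2 by (intro pos_wt.pos_Z[OF pos_wt.pos_Z[OF pos_Z.hyps(1,2)]])
        (auto simp: sub_root_def alpha_def)
    then show ?thesis using 2 by simp
  next
    case 3
    then show ?thesis using * pos_Z.hyps by (simp add: F_Z_inner)
  next
    case 4
    then show ?thesis using * pos_Z.hyps by (simp add: F_Z_eq pos_scale)
  next
    case 5
    have "pos_wt \<nu> (Z (Suc a) x)"
      using pos_Z 5 by (intro pos_wt.pos_Z[OF pos_Z.hyps(1)]) (auto simp: sub_root_def alpha_def)
    then have "pos_wt \<nu> (Z (Suc a) x + (1 / q) *s Z a (F i x))"
      using * 5 by (intro pos_add pos_scale) auto
    then show ?thesis using 5 by (simp add: add.commute)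
  next
    case 6
    then show ?thesis using * pos_Z by (simp add: F_Z_far)
  qed
next
  case (pos_F \<mu> x j \<nu>')
  consider "i < 0" | "i = 0" | "i \<ge> 1"
    by linarith
  then show ?case
  proof cases
    case 1
    then show ?thesis
      using pos_F by (intro pos_wt.pos_F[OF pos_wt.pos_F[OF pos_F.hyps(1,2,3)]])
        (auto simp: sub_root_def alpha_def)
  next
    case 2
    have "pos_wt \<nu> (Z 0 (F j x))"
      using pos_F 2 by (intro pos_wt.pos_Z[OF pos_wt.pos_F[OF pos_F.hyps(1,2,3)]])
        (auto simp: sub_root_def alpha_def)
    then show ?thesis using 2 by simp
  next
    case 3
    have "pos_wt \<nu> (F j (F i x))"
      using pos_F 3 by (intro pos_wt.pos_F[OF pos_F.IH]) (auto simp: sub_root_def alpha_def)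
    then show ?thesis
      using F_comm[of i j x] 3 pos_F by simp
  qed
qed (auto simp: F_lin intro: pos_add pos_scale pos_zero)

lemma wt_pos_wt: "wt \<mu> x \<Longrightarrow> pos_wt \<mu> x"
  by (induction rule: wt.induct) (auto intro: pos_v pos_wt_F pos_add pos_scale pos_zero)

lemma wt_vanishes_pos: "\<lbrakk>wt \<mu> x; 1 \<le> \<gamma>; \<mu> \<gamma> < 0\<rbrakk> \<Longrightarrow> x = 0"
  using wt_pos_wt pos_wt_vanishes by blast

end

lemma (in lowering_module) flip: "lowering_module scale q n (\<lambda>i. F (- i)) v"
proof unfold_locales
  fix i j x assume "\<bar>i\<bar> < int n" "\<bar>j\<bar> < int n" "\<bar>i - j\<bar> = 1"
  then show "F (- i) (F (- i) (F (- j) x)) + F (- j) (F (- i) (F (- i) x))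
      = (q + 1 / q) *s F (- i) (F (- j) (F (- i) x))"
    by (intro F_serre) auto
qed (auto simp: q_nz q2_nz F_add F_scale F_v intro!: F_comm)

lemma (in lowering_module) wt_vanishes_neg:
  assumes "wt \<mu> x" "\<gamma> \<le> 0" "\<mu> \<gamma> > 0"
  shows "x = 0"
proof -
  interpret flip: lowering_module scale q n "\<lambda>i. F (- i)" v
    by (fact flip)
  have "flip.wt (\<lambda>\<gamma>. - \<mu> (1 - \<gamma>)) x"
    using assms(1)
  proof (induction rule: wt.induct)
    case (wt_F \<mu> x i)
    have "(\<lambda>\<gamma>. - sub_root \<mu> i (1 - \<gamma>)) = sub_root (\<lambda>\<gamma>. - \<mu> (1 - \<gamma>)) (- i)"
      by (auto simp: sub_root_def alpha_def)
    then show ?case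
      using flip.wt_F[OF wt_F.IH, of "- i"] wt_F.hyps by simp
  qed (use flip.wt_v in \<open>auto intro: flip.wt.intros\<close>)
  then show ?thesis
    using assms flip.wt_vanishes_pos[of _ x "1 - \<gamma>"] by simp
qed

section \<open>Weight vectors and the Hecke action\<close>

locale qgl_module = lowering_module scale q n F v
  for scale :: "'k::field \<Rightarrow> 'm::ab_group_add \<Rightarrow> 'm" (infixr "*s" 75)
    and q n F v +
  fixes l :: 'k and E K Kinv :: "int \<Rightarrow> 'm \<Rightarrow> 'm"
  assumes q_sq: "q * q \<noteq> 1" and l_nz: "l \<noteq> 0"
    and E_add: "E i (x + y) = E i x + E i y"
    and E_scale: "E i (c *s x) = c *s E i x"
    and K_add: "K \<gamma> (x + y) = K \<gamma> x + K \<gamma> y"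
    and K_scale: "K \<gamma> (c *s x) = c *s K \<gamma> x"
    and Kinv_add: "Kinv \<gamma> (x + y) = Kinv \<gamma> x + Kinv \<gamma> y"
    and Kinv_scale: "Kinv \<gamma> (c *s x) = c *s Kinv \<gamma> x"
    and K_F: "\<lbrakk>\<bar>i\<bar> < int n; - int n < \<gamma>; \<gamma> \<le> int n\<rbrakk>
      \<Longrightarrow> K \<gamma> (F i x) = q powi (- alpha i \<gamma>) *s F i (K \<gamma> x)"
    and Kinv_F: "\<lbrakk>\<bar>i\<bar> < int n; - int n < \<gamma>; \<gamma> \<le> int n\<rbrakk>
      \<Longrightarrow> Kinv \<gamma> (F i x) = q powi alpha i \<gamma> *s F i (Kinv \<gamma> x)"
    and K_v: "\<lbrakk>- int n < \<gamma>; \<gamma> \<le> int n\<rbrakk> \<Longrightarrow> K \<gamma> v = (if \<gamma> \<le> 0 then l else 1) *s v"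
    and Kinv_v: "\<lbrakk>- int n < \<gamma>; \<gamma> \<le> int n\<rbrakk> \<Longrightarrow> Kinv \<gamma> v = (1 / (if \<gamma> \<le> 0 then l else 1)) *s v"
    and EF_eq: "\<bar>i\<bar> < int n \<Longrightarrow> E i (F i x) - F i (E i x)
      = (1 / (q - 1 / q)) *s (K i (Kinv (i + 1) x) - K (i + 1) (Kinv i x))"
    and EF_neq: "\<lbrakk>\<bar>i\<bar> < int n; \<bar>j\<bar> < int n; i \<noteq> j\<rbrakk> \<Longrightarrow> E i (F j x) = F j (E i x)"
    and E_comm: "\<lbrakk>\<bar>i\<bar> < int n; \<bar>j\<bar> < int n; \<bar>i - j\<bar> > 1\<rbrakk> \<Longrightarrow> E i (E j x) = E j (E i x)"
    and E_serre: "\<lbrakk>\<bar>i\<bar> < int n; \<bar>j\<bar> < int n; \<bar>i - j\<bar> = 1\<rbrakk>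
      \<Longrightarrow> E i (E i (E j x)) + E j (E i (E i x)) = (q + 1 / q) *s E i (E j (E i x))"
    and E_v: "\<bar>j\<bar> < int n \<Longrightarrow> E j v = 0"
begin

lemma E_zero: "E i 0 = 0"
  using E_scale[of i 0 0] by simp

lemma E_minus: "E i (- x) = - E i x"
  using E_scale[of i "-1" x] by simp

lemma E_diff: "E i (x - y) = E i x - E i y"
  by (simp only: diff_conv_add_uminus E_add E_minus)

lemmas E_lin = E_add E_zero E_minus E_diff E_scale

abbreviation top :: "int \<Rightarrow> 'k" where
  "top \<gamma> \<equiv> (if \<gamma> \<le> 0 then l else 1)"

lemma K_Kinv_wt:
  assumes "wt \<mu> x" "- int n < \<gamma>" "\<gamma> \<le> int n"
  shows "K \<gamma> x = (top \<gamma> * q powi \<mu> \<gamma>) *s x \<and> Kinv \<gamma> x = (1 / (top \<gamma> * q powi \<mu> \<gamma>)) *s x"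
  using assms(1)
proof (induction rule: wt.induct)
  case wt_v
  then show ?case using assms K_v Kinv_v by simp
next
  case (wt_F \<mu> x i)
  have "q powi sub_root \<mu> i \<gamma> = q powi (- alpha i \<gamma>) * q powi \<mu> \<gamma>"
    using q_nz by (simp add: sub_root_def power_int_diff power_int_minus field_simps)
  moreover have "q powi alpha i \<gamma> = 1 / q powi (- alpha i \<gamma>)"
    by (simp add: power_int_minus inverse_eq_divide)
  ultimately show ?case
    using assms wt_F by (auto simp: K_F Kinv_F F_lin mult_ac)
next
  case (wt_add \<mu> x y)
  then show ?case by (simp add: K_add Kinv_add scale_right_distrib)
next
  case (wt_scale \<mu> x c)
  then show ?case by (simp add: K_scale Kinv_scale mult_ac)
next
  case (wt_zero \<mu>)
  then show ?case
    using K_scale[of \<gamma> 0 0] Kinv_scale[of \<gamma> 0 0] by simp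
qed

lemmas K_wt = K_Kinv_wt[THEN conjunct1]
lemmas Kinv_wt = K_Kinv_wt[THEN conjunct2]

definition qnum :: "'k \<Rightarrow> 'k" where
  "qnum t = (t - 1 / t) / (q - 1 / q)"

lemma q_diff_nz: "q - 1 / q \<noteq> 0"
  using q_sq q_nz by (simp add: field_simps)

lemma qnum_consts:
  "qnum 1 = 0" "qnum q = 1" "qnum (1 / q) = -1" "qnum (q * q) = q + 1 / q" "qnum (q powi (-3)) = 1 - (q + 1 / q) * (q + 1 / q)"
proof -
  define p where "p = 1 / q"
  have pq: "p * q = 1" and d: "q - p \<noteq> 0"
    using q_nz q_diff_nz by (simp_all add: p_def)
  have "1 / (q * q) = p * p" "q powi (-3) = p * p * p" "1 / (p * p * p) = q * q * q" "1 / p = q"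
    using q_nz by (simp_all add: p_def power_int_def power3_eq_cube field_simps)
  note * = this
  have "(q * q - p * p) = (q + p) * (q - p)"
    by (simp add: algebra_simps)
  moreover have "p * p * p - q * q * q = (1 - (q + p) * (q + p)) * (q - p)"
    using pq by Groebner_Basis.algebra
  ultimately show "qnum 1 = 0" "qnum q = 1" "qnum (1 / q) = -1" "qnum (q * q) = q + 1 / q"
    "qnum (q powi (-3)) = 1 - (q + 1 / q) * (q + 1 / q)"
    using d unfolding qnum_def p_def[symmetric] * by (simp_all add: divide_simps)
qed

lemma EF_wt:
  assumes "wt \<mu> x" "\<bar>i\<bar> < int n"
  shows "E i (F i x) = F i (E i x) + qnum ((if i = 0 then l else 1) * q powi (\<mu> i - \<mu> (i + 1))) *s x"
proof -
  have K: "K i (Kinv (i + 1) x) = ((if i = 0 then l else 1) * q powi (\<mu> i - \<mu> (i + 1))) *s x"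
    using assms q_nz l_nz
    by (auto simp: K_wt Kinv_wt K_scale power_int_diff)
  have K': "K (i + 1) (Kinv i x) = (1 / ((if i = 0 then l else 1) * q powi (\<mu> i - \<mu> (i + 1)))) *s x"
    using assms q_nz l_nz
    by (auto simp: K_wt Kinv_wt K_scale power_int_diff)
  have "E i (F i x) = F i (E i x) + (E i (F i x) - F i (E i x))"
    by simp
  also have "E i (F i x) - F i (E i x) = qnum ((if i = 0 then l else 1) * q powi (\<mu> i - \<mu> (i + 1))) *s x"
    unfolding EF_eq[OF assms(2)] K K' qnum_def scale_left_diff_distrib[symmetric] scale_scale
    by simp
  finally show ?thesis .
qed

lemma wt_cong: "\<lbrakk>wt \<mu> x; \<And>\<gamma>. \<mu> \<gamma> = \<nu> \<gamma>\<rbrakk> \<Longrightarrow> wt \<nu> x"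
  by (metis ext)

lemma wt_E: "\<lbrakk>wt \<mu> x; \<bar>i\<bar> < int n\<rbrakk> \<Longrightarrow> wt (add_root \<mu> i) (E i x)"
proof (induction rule: wt.induct)
  case wt_v
  then show ?case by (simp add: E_v wt_zero)
next
  case (wt_F \<mu> x j)
  have *: "wt (add_root (sub_root \<mu> j) i) (F j (E i x))"
    by (rule wt_cong[OF wt.wt_F[OF wt_F.IH[OF wt_F.prems]]])
       (use wt_F in \<open>auto simp: sub_root_def add_root_def\<close>)
  show ?case
  proof (cases "i = j")
    case True
    have "wt (add_root (sub_root \<mu> j) i) x"
      by (rule wt_cong[OF wt_F.hyps(1)]) (simp add: True sub_root_def add_root_def)
    then show ?thesis
      using * wt_F EF_wt[of \<mu> x i] True by (simp add: wt_add wt_scale)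
  next
    case False
    then show ?thesis using * wt_F by (simp add: EF_neq)
  qed
qed (auto simp: E_lin intro: wt_add wt_scale wt_zero)

lemma wt_minus: "wt \<mu> x \<Longrightarrow> wt \<mu> (- x)"
  using wt_scale[of \<mu> x "-1"] by simp

lemma wt_diff: "\<lbrakk>wt \<mu> x; wt \<mu> y\<rbrakk> \<Longrightarrow> wt \<mu> (x - y)"
  using wt_add[of \<mu> x "- y"] wt_minus by simp

lemma wt_FE: "\<lbrakk>wt \<mu> x; \<bar>i\<bar> < int n\<rbrakk> \<Longrightarrow> wt \<mu> (F i (E i x))"
  by (rule wt_cong[OF wt_F[OF wt_E]]) (auto simp: sub_root_def add_root_def)

lemma wt_EF: "\<lbrakk>wt \<mu> x; \<bar>i\<bar> < int n\<rbrakk> \<Longrightarrow> wt \<mu> (E i (F i x))"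
  by (rule wt_cong[OF wt_E[OF wt_F]]) (auto simp: sub_root_def add_root_def)

lemmas root_simps = add_root_def sub_root_def alpha_def

lemma EF_one:
  "\<lbrakk>wt \<mu> x; \<bar>i\<bar> < int n; i \<noteq> 0; \<mu> i = \<mu> (i + 1) + 1; E i x = 0\<rbrakk> \<Longrightarrow> E i (F i x) = x"
  by (simp add: EF_wt F_lin qnum_consts)

lemma EF_swap:
  "\<lbrakk>wt \<mu> x; \<bar>i\<bar> < int n; i \<noteq> 0; \<mu> i = \<mu> (i + 1)\<rbrakk> \<Longrightarrow> E i (F i x) = F i (E i x)"
  by (simp add: EF_wt F_lin qnum_consts)

lemma FE_one:
  assumes "wt \<mu> x" "\<bar>i\<bar> < int n" "i \<noteq> 0" "\<mu> (i + 1) = \<mu> i + 1" "F i x = 0"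
  shows "F i (E i x) = x"
proof -
  have "\<mu> i - \<mu> (i + 1) = -1"
    using assms(4) by simp
  then have "E i (F i x) = F i (E i x) + qnum (1 / q) *s x"
    using EF_wt[OF assms(1,2)] assms(3) by (simp add: power_int_minus divide_inverse)
  then show ?thesis
    using assms(5) by (simp add: E_lin qnum_consts)
qed

definition S :: "int \<Rightarrow> 'm \<Rightarrow> 'm" where
  "S i x = (1 / q) *s x - F i (E i x)"

definition S_inv :: "int \<Rightarrow> 'm \<Rightarrow> 'm" where
  "S_inv i x = q *s x - E i (F i x)"

lemma S_lin: "S i (x + y) = S i x + S i y" "S i 0 = 0" "S i (- x) = - S i x" "S i (x - y) = S i x - S i y"
    "S i (c *s x) = c *s S i x"
  by (simp_all add: S_def F_lin E_lin algebra_simps)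

lemma S_inv_lin: "S_inv i (x + y) = S_inv i x + S_inv i y" "S_inv i 0 = 0" "S_inv i (- x) = - S_inv i x"
    "S_inv i (x - y) = S_inv i x - S_inv i y" "S_inv i (c *s x) = c *s S_inv i x"
  by (simp_all add: S_inv_def F_lin E_lin algebra_simps)

lemma wt_S: "\<lbrakk>wt \<mu> x; \<bar>i\<bar> < int n\<rbrakk> \<Longrightarrow> wt \<mu> (S i x)"
  unfolding S_def by (intro wt_diff wt_scale wt_FE)

lemma wt_S_inv: "\<lbrakk>wt \<mu> x; \<bar>i\<bar> < int n\<rbrakk> \<Longrightarrow> wt \<mu> (S_inv i x)"
  unfolding S_inv_def by (intro wt_diff wt_scale wt_EF)

lemma S_inv_eq:
  assumes "wt \<mu> x" "1 \<le> i" "i < int n" "\<mu> i = \<mu> (i + 1)"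
  shows "S_inv i x = S i x - (1 / q - q) *s x"
  using assms EF_swap[of \<mu> x i] by (simp add: S_def S_inv_def scale_left_diff_distrib)

lemma S_comm:
  assumes ij: "\<bar>i\<bar> < int n" "\<bar>j\<bar> < int n" "\<bar>i - j\<bar> > 1"
  shows "S i (S j x) = S j (S i x)"
proof -
  have "F i (E i (F j (E j x))) = F i (F j (E i (E j x)))"
    using ij by (subst EF_neq) auto
  also have "\<dots> = F j (F i (E j (E i x)))"
    unfolding E_comm[OF ij] by (rule F_comm[OF ij])
  also have "\<dots> = F j (E j (F i (E i x)))"
    using ij by (subst EF_neq) auto
  finally show ?thesis
    by (simp add: S_def F_lin E_lin scale_right_diff_distrib)
qed

lemma FE_sq:
  assumes "wt \<mu> x" "1 \<le> i" "i < int n" "\<mu> i = 1" "\<mu> (i + 1) = 1"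
  shows "F i (E i (F i (E i x))) = (q + 1 / q) *s F i (E i x)"
proof -
  have "wt (add_root \<mu> i) (E i x)"
    using assms by (intro wt_E) auto
  moreover have "E i (E i x) = 0"
    using assms wt_vanishes_pos[OF wt_E[OF wt_E[OF assms(1)]], of i i "i + 1"] by (simp add: root_simps)
  ultimately have "E i (F i (E i x)) = (q + 1 / q) *s E i x"
    using assms EF_wt[of "add_root \<mu> i" "E i x" i]
    by (simp add: root_simps F_lin power2_eq_square qnum_consts)
  then show ?thesis by (simp add: F_lin)
qed

lemma S_sq:
  assumes "wt \<mu> x" "1 \<le> i" "i < int n" "\<mu> i = 1" "\<mu> (i + 1) = 1"
  shows "S i (S i x) = x + (1 / q - q) *s S i x"
proof (rule eqI_functional)
  fix f
  assume f: "\<And>a b. f (a + b) = f a + (f b :: 'k)" "\<And>a b. f (a - b) = f a - f b" "\<And>a. f (- a) = - f a"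
    "f 0 = 0" "\<And>c a. f (c *s a) = c * f a"
  define p where "p = 1 / q"
  have "p * q = 1" using q_nz by (simp add: p_def)
  then show "f (S i (S i x)) = f (x + (1 / q - q) *s S i x)"
    using arg_cong[OF FE_sq[OF assms], of f]
    by (simp only: S_def F_lin E_lin f flip: p_def) Groebner_Basis.algebra
qed

lemma FE_braid1:
  assumes x: "wt \<mu> x" and i: "1 \<le> i" "i + 1 < int n" and j: "j = i + 1"
    and \<mu>: "\<mu> i = 1" "\<mu> (i + 1) = 1" "\<mu> (i + 2) = 1"
  shows "F i (E i (F j (E j (F i (E i x)))))
    = F i (E i x) + F i (F j (F i (E i (E j (E i x)))))"
proof -
  have [simp]: "\<bar>i\<bar> < int n" "\<bar>j\<bar> < int n" using i j by auto
  have [simp]: "\<mu> (2 + i) = 1"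
    using \<mu>(3) by (simp add: add.commute)
  have w: "wt (add_root \<mu> i) (E i x)" "wt (add_root (add_root \<mu> i) j) (E j (E i x))"
    by (intro wt_E x; simp)+
  have "F j (E i x) = 0"
    using wt_vanishes_pos[OF wt_F[OF w(1)], of j j] i j \<mu> by (simp add: root_simps)
  then have a: "F j (E j (E i x)) = E i x"
    by (intro FE_one[OF w(1)]) (use i j \<mu> in \<open>auto simp: root_simps\<close>)
  have b: "E i (F i (E j (E i x))) = F i (E i (E j (E i x))) + E j (E i x)"
    using EF_wt[OF w(2), of i] i j \<mu> by (simp add: root_simps qnum_consts)
  have "F i (E i (F j (E j (F i (E i x))))) = F i (F j (E i (F i (E j (E i x)))))"
    using i j by (simp add: EF_neq)
  also have "\<dots> = F i (F j (F i (E i (E j (E i x))))) + F i (E i x)"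
    unfolding b by (simp add: F_lin a)
  finally show ?thesis by (simp add: add.commute)
qed

lemma FE_braid2:
  assumes x: "wt \<mu> x" and i: "1 \<le> i" "i + 1 < int n" and j: "j = i + 1"
    and \<mu>: "\<mu> i = 1" "\<mu> (i + 1) = 1" "\<mu> (i + 2) = 1"
  shows "F j (E j (F i (E i (F j (E j x))))) = F j (E j x) + F j (E i (F i (E j x)))"
proof -
  have [simp]: "\<bar>i\<bar> < int n" "\<bar>j\<bar> < int n" using i j by auto
  have [simp]: "\<mu> (2 + i) = 1"
    using \<mu>(3) by (simp add: add.commute)
  have w: "wt (add_root \<mu> j) (E j x)" "wt (add_root (add_root \<mu> j) i) (E i (E j x))"
    by (intro wt_E x; simp)+
  have "E j (E i (E j x)) = 0"
    using wt_vanishes_pos[OF wt_E[OF w(2)], of j "j + 1"] i j \<mu> by (simp add: root_simps)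
  then have b: "E j (F j (E i (E j x))) = E i (E j x)"
    by (intro EF_one[OF w(2)]) (use i j \<mu> in \<open>auto simp: root_simps\<close>)
  have c: "E i (F i (E j x)) = F i (E i (E j x)) - E j x"
    using EF_wt[OF w(1), of i] i j \<mu> q_nz
    by (simp add: root_simps power_int_minus flip: divide_inverse) (simp add: qnum_consts inverse_eq_divide)
  have "F j (E j (F i (E i (F j (E j x))))) = F j (F i (E j (F j (E i (E j x)))))"
    using i j by (simp add: EF_neq)
  also have "\<dots> = F j (F i (E i (E j x)))"
    by (simp add: b)
  also have "\<dots> = F j (E j x) + F j (E i (F i (E j x)))"
    by (simp add: c F_lin)
  finally show ?thesis .
qed

lemma E_serre_vanish:
  assumes "\<bar>i\<bar> < int n" "\<bar>j\<bar> < int n" "\<bar>i - j\<bar> = 1" "E j (E i (E i x)) = 0"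
  shows "(q + 1 / q) *s E i (E j (E i x)) = E i (E i (E j x))"
  using E_serre[OF assms(1-3), of x] assms(4) by simp

lemma FE_braid3:
  assumes z: "wt \<mu> z" and i: "1 \<le> i" "i < int n"
    and \<mu>: "\<mu> i = 1" "\<mu> (i + 1) = 2"
  shows "F i (F i (E i (E i z))) = (q + 1 / q) *s (q + 1 / q) *s E i (F i z)"
proof -
  let ?qq = "q + 1 / q"
  have [simp]: "\<bar>i\<bar> < int n" using i by auto
  have w: "wt (add_root \<mu> i) (E i z)" "wt (sub_root \<mu> i) (F i z)"
    "wt (add_root (sub_root \<mu> i) i) (E i (F i z))"
    by (intro wt_E wt_F z; simp)+
  have FF: "F i (F i z) = 0"
    using wt_vanishes_pos[OF wt_F[OF w(2)], of i i] i \<mu> by (simp add: root_simps)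
  have a: "E i (F i z) = F i (E i z) - z"
    using EF_wt[OF z, of i] i \<mu>
    by (simp add: power_int_minus inverse_eq_divide qnum_consts)
  have b: "E i (F i (E i z)) = F i (E i (E i z)) + E i z"
    using EF_wt[OF w(1), of i] i \<mu> by (simp add: root_simps qnum_consts)
  have c: "F i (E i (F i z)) = (?qq * ?qq - 1) *s F i z"
    using EF_wt[OF w(2), of i] i \<mu> FF
    by (simp add: root_simps qnum_consts E_lin algebra_simps)
  have d: "E i (F i (E i (F i z))) = F i (E i (E i (F i z))) - E i (F i z)"
    using EF_wt[OF w(3), of i] i \<mu>
    by (simp add: root_simps power_int_minus inverse_eq_divide qnum_consts)
  have e: "F i (E i (E i z)) = E i (E i (F i z))"
  proof -
    have "E i (E i (F i z)) = E i (F i (E i z)) - E i z"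
      by (simp add: a E_lin)
    then show ?thesis by (simp add: b)
  qed
  have "F i (F i (E i (E i z))) = F i (E i (E i (F i z)))"
    by (simp add: e)
  also have "\<dots> = E i (F i (E i (F i z))) + E i (F i z)"
    by (simp add: d)
  also have "\<dots> = (?qq * ?qq) *s E i (F i z)"
    unfolding c E_scale by (simp add: scale_left_diff_distrib)
  finally show ?thesis by simp
qed

lemma FE_braid:
  assumes x: "wt \<mu> x" and i: "1 \<le> i" "i + 1 < int n" and j: "j = i + 1"
    and \<mu>: "\<mu> i = 1" "\<mu> (i + 1) = 1" "\<mu> (i + 2) = 1"
  shows "F i (E i (F j (E j (F i (E i x))))) - F i (E i x)
    = F j (E j (F i (E i (F j (E j x))))) - F j (E j x)"
proof -
  let ?qq = "q + 1 / q"
  have [simp]: "\<bar>i\<bar> < int n" "\<bar>j\<bar> < int n" using i j by auto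
  have [simp]: "\<mu> (2 + i) = 1"
    using \<mu>(3) by (simp add: add.commute)
  have Eii: "E i (E i x) = 0"
    using wt_vanishes_pos[OF wt_E[OF wt_E[OF x]], of i i j] i j \<mu> by (simp add: root_simps)
  have w: "wt (add_root \<mu> j) (E j x)"
    "wt (add_root (add_root (add_root \<mu> j) i) i) (E i (E i (E j x)))"
    by (intro wt_E x; simp)+
  have Fj: "F j (E i (E i (E j x))) = 0"
    using wt_vanishes_pos[OF wt_F[OF w(2)], of j j] i j \<mu> by (simp add: root_simps)
  have "?qq *s E i (E j (E i x)) = E i (E i (E j x))"
    using Eii i j by (intro E_serre_vanish) (auto simp: E_lin)
  then have "?qq *s F i (F j (F i (?qq *s E i (E j (E i x)))))
     = ?qq *s F i (F j (F i (E i (E i (E j x)))))"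
    by simp
  also have "\<dots> = F j (F i (F i (E i (E i (E j x)))))"
    using F_serre[of i j "E i (E i (E j x))"] i j Fj by (simp add: F_lin)
  also have "\<dots> = ?qq *s ?qq *s F j (E i (F i (E j x)))"
    using FE_braid3[OF w(1), of i] i j \<mu> by (simp add: root_simps F_lin)
  finally have "F i (F j (F i (E i (E j (E i x))))) = F j (E i (F i (E j x)))"
    using q2_nz by (simp add: F_lin del: scale_scale)
  then show ?thesis
    using FE_braid1[OF assms] FE_braid2[OF assms] by simp
qed

lemma S_braid:
  assumes x: "wt \<mu> x" and i: "1 \<le> i" "i + 1 < int n" and j: "j = i + 1"
    and \<mu>: "\<mu> i = 1" "\<mu> (i + 1) = 1" "\<mu> (i + 2) = 1"
  shows "S i (S j (S i x)) = S j (S i (S j x))"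
proof (rule eqI_functional)
  fix f
  assume f: "\<And>a b. f (a + b) = f a + (f b :: 'k)" "\<And>a b. f (a - b) = f a - f b" "\<And>a. f (- a) = - f a"
    "f 0 = 0" "\<And>c a. f (c *s a) = c * f a"
  have 1: "F i (E i (F i (E i x))) = (q + 1 / q) *s F i (E i x)"
    using i j \<mu> by (intro FE_sq[OF x]) auto
  have 2: "F j (E j (F j (E j x))) = (q + 1 / q) *s F j (E j x)"
    using i j \<mu> by (intro FE_sq[OF x]) (auto simp: add.commute)
  define p where "p = 1 / q"
  have "p * q = 1" using q_nz by (simp add: p_def)
  then show "f (S i (S j (S i x))) = f (S j (S i (S j x)))"
    using arg_cong[OF 1, of f] arg_cong[OF 2, of f] arg_cong[OF FE_braid[OF assms], of f]
    by (simp only: S_def F_lin E_lin f flip: p_def) Groebner_Basis.algebra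
qed

primrec cup_op :: "nat \<Rightarrow> 'm \<Rightarrow> 'm" where
  "cup_op 0 x = F 0 x"
| "cup_op (Suc j) x = F (int j + 1) (F (- int j - 1) (cup_op j x))"

primrec cap_op :: "nat \<Rightarrow> 'm \<Rightarrow> 'm" where
  "cap_op 0 x = E 0 x"
| "cap_op (Suc j) x = cap_op j (E (int j + 1) (E (- int j - 1) x))"

definition letter_op :: "nat \<times> bool \<Rightarrow> 'm \<Rightarrow> 'm" where
  "letter_op s = (if snd s then S (int (fst s)) else S_inv (int (fst s)))"

definition word_op :: "braid_word \<Rightarrow> 'm \<Rightarrow> 'm" where
  "word_op b = foldr letter_op b"

lemma word_op_Nil [simp]: "word_op [] x = x"
  and word_op_Cons [simp]: "word_op (s # b) x = letter_op s (word_op b x)"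
  and word_op_append [simp]: "word_op (a @ b) x = word_op a (word_op b x)"
  by (simp_all add: word_op_def)

lemma cup_op_lin: "cup_op j (x + y) = cup_op j x + cup_op j y" "cup_op j 0 = 0"
    "cup_op j (- x) = - cup_op j x" "cup_op j (x - y) = cup_op j x - cup_op j y"
    "cup_op j (c *s x) = c *s cup_op j x"
  by (induction j) (simp_all add: F_lin)

lemma cap_op_lin: "cap_op j (x + y) = cap_op j x + cap_op j y" "cap_op j 0 = 0"
    "cap_op j (- x) = - cap_op j x" "cap_op j (x - y) = cap_op j x - cap_op j y"
    "cap_op j (c *s x) = c *s cap_op j x"
  by (induction j arbitrary: x y) (simp_all add: E_lin)

lemma letter_op_lin: "letter_op s (x + y) = letter_op s x + letter_op s y" "letter_op s 0 = 0"
    "letter_op s (- x) = - letter_op s x" "letter_op s (x - y) = letter_op s x - letter_op s y"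
    "letter_op s (c *s x) = c *s letter_op s x"
  by (auto simp: letter_op_def S_lin S_inv_lin)

lemma word_op_lin: "word_op b (x + y) = word_op b x + word_op b y" "word_op b 0 = 0"
    "word_op b (- x) = - word_op b x" "word_op b (x - y) = word_op b x - word_op b y"
    "word_op b (c *s x) = c *s word_op b x"
  by (induction b) (simp_all add: letter_op_lin)

lemma wt_word_op:
  "\<lbrakk>wt \<mu> x; \<And>i e. (i, e) \<in> set b \<Longrightarrow> i < n\<rbrakk> \<Longrightarrow> wt \<mu> (word_op b x)"
proof (induction b)
  case (Cons s b)
  then have "wt \<mu> (word_op b x)" "int (fst s) < int n"
    by (cases s; fastforce)+
  then show ?case
    by (auto simp: letter_op_def intro: wt_S wt_S_inv)
qed simp

lemma E_cup_op: "\<lbrakk>j < n; \<bar>i\<bar> < int n; \<bar>i\<bar> > int j\<rbrakk> \<Longrightarrow> E i (cup_op j x) = cup_op j (E i x)"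
  by (induction j) (simp_all add: EF_neq)

lemma F_cap_op: "\<lbrakk>j < n; \<bar>i\<bar> < int n; \<bar>i\<bar> > int j\<rbrakk> \<Longrightarrow> F i (cap_op j x) = cap_op j (F i x)"
  by (induction j arbitrary: x) (simp_all add: EF_neq)

lemma F_cup_op: "\<lbrakk>j < n; \<bar>i\<bar> < int n; \<bar>i\<bar> > int j + 1\<rbrakk> \<Longrightarrow> F i (cup_op j x) = cup_op j (F i x)"
proof (induction j)
  case 0
  then show ?case using F_comm[of i 0] by simp
next
  case (Suc j)
  then show ?case using F_comm[of i "int j + 1"] F_comm[of i "- int j - 1"] by simp
qed

lemma E_cap_op: "\<lbrakk>j < n; \<bar>i\<bar> < int n; \<bar>i\<bar> > int j + 1\<rbrakk> \<Longrightarrow> E i (cap_op j x) = cap_op j (E i x)"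
proof (induction j arbitrary: x)
  case 0
  then show ?case using E_comm[of i 0] by simp
next
  case (Suc j)
  then show ?case using E_comm[of i "int j + 1"] E_comm[of i "- int j - 1"] by simp
qed

lemma letter_op_cup_op:
  "\<lbrakk>i < n; j + 1 < i\<rbrakk> \<Longrightarrow> letter_op (i, e) (cup_op j x) = cup_op j (letter_op (i, e) x)"
  by (simp add: letter_op_def S_def S_inv_def E_cup_op F_cup_op cup_op_lin)

lemma letter_op_cap_op:
  "\<lbrakk>i < n; j + 1 < i\<rbrakk> \<Longrightarrow> letter_op (i, e) (cap_op j x) = cap_op j (letter_op (i, e) x)"
  by (simp add: letter_op_def S_def S_inv_def E_cap_op F_cap_op cap_op_lin)

lemma word_op_cup_op:
  "(\<And>i e. (i, e) \<in> set b \<Longrightarrow> i < n \<and> j + 1 < i) \<Longrightarrow> word_op b (cup_op j x) = cup_op j (word_op b x)"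
proof (induction b)
  case (Cons s b)
  have "word_op b (cup_op j x) = cup_op j (word_op b x)"
    by (rule Cons.IH) (use Cons.prems in auto)
  then show ?case
    using Cons.prems[of "fst s" "snd s"] letter_op_cup_op[of "fst s" j "snd s"] by simp
qed simp

lemma word_op_cap_op:
  "(\<And>i e. (i, e) \<in> set b \<Longrightarrow> i < n \<and> j + 1 < i) \<Longrightarrow> word_op b (cap_op j x) = cap_op j (word_op b x)"
proof (induction b)
  case (Cons s b)
  have "word_op b (cap_op j x) = cap_op j (word_op b x)"
    by (rule Cons.IH) (use Cons.prems in auto)
  then show ?case
    using Cons.prems[of "fst s" "snd s"] letter_op_cap_op[of "fst s" j "snd s"] by simp
qed simp

definition cup_wt :: "(int \<Rightarrow> int) \<Rightarrow> nat \<Rightarrow> int \<Rightarrow> int" where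
  "cup_wt \<mu> j \<gamma> = \<mu> \<gamma> + (if \<gamma> = int j + 1 then 1 else if \<gamma> = - int j then -1 else 0)"

lemma wt_cup_op: "\<lbrakk>wt \<mu> x; j < n\<rbrakk> \<Longrightarrow> wt (cup_wt \<mu> j) (cup_op j x)"
proof (induction j)
  case 0
  show ?case
    by (simp, rule wt_cong[OF wt_F[OF 0(1), of 0]]) (use 0 in \<open>auto simp: cup_wt_def root_simps\<close>)
next
  case (Suc j)
  show ?case
    by (simp, rule wt_cong[OF wt_F[OF wt_F[OF Suc.IH[OF Suc.prems(1)]]]])
      (use Suc in \<open>auto simp: cup_wt_def root_simps\<close>)
qed

lemma cancel_neg:
  assumes y: "wt \<mu> y" and j: "Suc j < n" and \<mu>: "\<mu> (- int j) = 0" "\<mu> (- int j - 1) = 0"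
  shows "E (- int j - 1) (F (- int j - 1) (cup_op j y)) = cup_op j y"
proof -
  have w: "wt (cup_wt \<mu> j) (cup_op j y)"
    using y j by (intro wt_cup_op) auto
  have i: "\<bar>- int j - 1\<bar> < int n"
    using j by auto
  have "E (- int j - 1) (cup_op j y) = 0"
    using wt_vanishes_neg[OF wt_E[OF w i], of "- int j - 1"] \<mu> by (simp add: root_simps cup_wt_def)
  then show ?thesis
    by (intro EF_one[OF w i]) (use \<mu> in \<open>auto simp: cup_wt_def\<close>)
qed

lemma cap_cup:
  assumes y: "wt \<mu> y" and j: "j < n" and \<mu>: "\<And>\<gamma>. \<lbrakk>- int j \<le> \<gamma>; \<gamma> \<le> int j + 1\<rbrakk> \<Longrightarrow> \<mu> \<gamma> = 0"
  shows "cap_op j (cup_op j y) = qnum l *s y"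
  using j \<mu>
proof (induction j)
  case 0
  have "E 0 y = 0"
    using wt_vanishes_pos[OF wt_E[OF y, of 0], of 1] 0 by (simp add: root_simps)
  then show ?case
    using EF_wt[OF y, of 0] 0 by (simp add: F_lin)
next
  case (Suc j)
  have w: "wt (cup_wt \<mu> j) (cup_op j y)"
    using y Suc.prems by (intro wt_cup_op) auto
  have i: "\<bar>int j + 1\<bar> < int n"
    using Suc.prems by auto
  have "E (int j + 1) (cup_op j y) = 0"
    using wt_vanishes_pos[OF wt_E[OF w i], of "int j + 2"] Suc.prems by (simp add: root_simps cup_wt_def)
  then have a: "E (int j + 1) (F (int j + 1) (cup_op j y)) = cup_op j y"
    by (intro EF_one[OF w i]) (use Suc.prems in \<open>auto simp: cup_wt_def\<close>)
  have b: "E (- int j - 1) (F (- int j - 1) (cup_op j y)) = cup_op j y"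
    using Suc.prems by (intro cancel_neg[OF y]) auto
  have "cap_op (Suc j) (cup_op (Suc j) y)
      = cap_op j (E (int j + 1) (F (int j + 1) (E (- int j - 1) (F (- int j - 1) (cup_op j y)))))"
    using Suc.prems EF_neq[of "- int j - 1" "int j + 1"] by (simp add: add.commute)
  then show ?case
    using a b Suc by simp
qed

lemma cap_cup_lowered:
  assumes "wt \<mu> y" "j < n" "\<And>\<gamma>. \<lbrakk>- int j \<le> \<gamma>; \<gamma> \<le> int j\<rbrakk> \<Longrightarrow> \<mu> \<gamma> = 0" "\<mu> (int j + 1) = 1"
  shows "cap_op j (cup_op j y) = qnum (l / q) *s y"
  using assms
proof (induction j arbitrary: \<mu> y)
  case 0
  have "E 0 y = 0"
    using wt_vanishes_neg[OF wt_E[OF 0(1), of 0], of 0] 0 by (simp add: root_simps)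
  then show ?case
    using EF_wt[OF 0(1), of 0] 0 by (simp add: F_lin power_int_minus divide_inverse)
next
  case (Suc j)
  let ?i = "int j + 1"
  have w: "wt (cup_wt \<mu> j) (cup_op j y)"
    using Suc.prems by (intro wt_cup_op) auto
  have i: "\<bar>?i\<bar> < int n"
    using Suc.prems by auto
  have \<mu>2: "\<mu> (int j + 2) = 1" "\<mu> (?i + 1) = 1"
    using Suc.prems(4) by (simp_all add: algebra_simps)
  have a: "E ?i (F ?i (cup_op j y)) = F ?i (cup_op j (E ?i y))"
    using Suc.prems \<mu>2 i by (subst EF_swap[OF w i]) (auto simp: cup_wt_def E_cup_op)
  have b: "E (- int j - 1) (F (- int j - 1) (cup_op j y)) = cup_op j y"
    using Suc.prems by (intro cancel_neg[OF Suc.prems(1)]) auto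
  have c: "cap_op j (cup_op j (E ?i y)) = qnum (l / q) *s E ?i y"
    by (rule Suc.IH[OF wt_E[OF Suc.prems(1) i]]) (use Suc.prems in \<open>auto simp: root_simps\<close>)
  have "F ?i y = 0"
    using wt_vanishes_pos[OF wt_F[OF Suc.prems(1) i], of ?i] Suc.prems by (simp add: root_simps)
  then have d: "F ?i (E ?i y) = y"
    by (intro FE_one[OF Suc.prems(1) i]) (use Suc.prems \<mu>2 in auto)
  have "cap_op (Suc j) (cup_op (Suc j) y)
      = cap_op j (E ?i (F ?i (E (- int j - 1) (F (- int j - 1) (cup_op j y)))))"
    using Suc.prems EF_neq[of "- int j - 1" ?i] by (simp add: add.commute)
  also have "\<dots> = F ?i (cap_op j (cup_op j (E ?i y)))"
    using Suc.prems i by (simp add: b a F_cap_op)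
  also have "\<dots> = qnum (l / q) *s y"
    by (simp add: c d F_lin)
  finally show ?case .
qed

definition strand_wt :: "nat \<Rightarrow> int \<Rightarrow> int" where
  "strand_wt k \<gamma> = (if int k < \<gamma> \<and> \<gamma> \<le> int n then 1 else if - int n < \<gamma> \<and> \<gamma> \<le> - int k then -1 else 0)"

lemma qnum_kink: "(1 / q) * qnum l - qnum (l / q) = 1 / l"
proof -
  have "(1 / q) * (l - 1 / l) - (l / q - q / l) = (1 / l) * (q - 1 / q)"
    by (simp add: algebra_simps)
  then have "((1 / q) * (l - 1 / l) - (l / q - q / l)) / (q - 1 / q) = 1 / l"
    using q_diff_nz by simp
  then show ?thesis
    unfolding qnum_def by (simp only: diff_divide_distrib[symmetric] times_divide_eq_right) simp
qed

lemma cap_S_cup: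
  assumes y: "wt (strand_wt (Suc k)) y" and k: "Suc k < n"
  shows "cap_op k (S (int k + 1) (cup_op k y)) = (1 / l) *s y"
proof -
  let ?i = "int k + 1"
  have i: "\<bar>?i\<bar> < int n"
    using k by auto
  have a: "cap_op k (cup_op k y) = qnum l *s y"
    using k by (intro cap_cup[OF y]) (auto simp: strand_wt_def)
  have b: "cap_op k (cup_op k (E ?i y)) = qnum (l / q) *s E ?i y"
    using k by (intro cap_cup_lowered[OF wt_E[OF y i]]) (auto simp: strand_wt_def root_simps)
  have "F ?i y = 0"
    using wt_vanishes_pos[OF wt_F[OF y i], of ?i] k by (simp add: root_simps strand_wt_def)
  then have d: "F ?i (E ?i y) = y"
    using k by (intro FE_one[OF y i]) (auto simp: strand_wt_def)
  have "cap_op k (S ?i (cup_op k y)) = (1 / q) *s cap_op k (cup_op k y) - F ?i (cap_op k (cup_op k (E ?i y)))"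
    using k i by (simp add: S_def cap_op_lin E_cup_op F_cap_op)
  also have "\<dots> = ((1 / q) * qnum l - qnum (l / q)) *s y"
    by (simp add: a b d F_lin scale_left_diff_distrib)
  finally show ?thesis
    unfolding qnum_kink .
qed

definition cups :: "nat \<Rightarrow> 'm" where
  "cups k = foldr cup_op [k..<n] v"

definition caps :: "nat \<Rightarrow> 'm \<Rightarrow> 'm" where
  "caps k x = fold cap_op [k..<n] x"

lemma cups_Suc: "k < n \<Longrightarrow> cups k = cup_op k (cups (Suc k))"
  by (simp add: cups_def upt_conv_Cons)

lemma caps_Suc: "k < n \<Longrightarrow> caps k x = caps (Suc k) (cap_op k x)"
  by (simp add: caps_def upt_conv_Cons)

lemma fold_cap_op_lin: "fold cap_op ks (x + y) = fold cap_op ks x + fold cap_op ks y" "fold cap_op ks 0 = 0"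
    "fold cap_op ks (- x) = - fold cap_op ks x" "fold cap_op ks (x - y) = fold cap_op ks x - fold cap_op ks y"
    "fold cap_op ks (c *s x) = c *s fold cap_op ks x"
  by (induction ks arbitrary: x y) (simp_all add: cap_op_lin)

lemmas caps_lin = fold_cap_op_lin[of "[k..<n]" for k, folded caps_def]

lemma wt_cups: "k \<le> n \<Longrightarrow> wt (strand_wt k) (cups k)"
proof (induction k rule: inc_induct)
  case base
  show ?case
    by (rule wt_cong[of "\<lambda>_. 0"]) (auto simp: cups_def strand_wt_def wt_v)
next
  case (step k)
  show ?case
    unfolding cups_Suc[OF step.hyps(2)]
    by (rule wt_cong[OF wt_cup_op[OF step.IH]]) (use step.hyps in \<open>auto simp: strand_wt_def cup_wt_def\<close>)
qed

definition closure_op :: "nat \<Rightarrow> braid_word \<Rightarrow> 'm" where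
  "closure_op k b = caps k (word_op b (cups k))"

lemma closure_op_base: "Suc k = n \<Longrightarrow> closure_op k [] = qnum l *s v"
  by (auto simp: closure_op_def cups_def caps_def intro!: cap_cup[OF wt_v])

lemma closure_op_unknot:
  assumes "Suc k < n" "\<And>i e. (i, e) \<in> set b \<Longrightarrow> i < n \<and> Suc k < i"
  shows "closure_op k b = qnum l *s closure_op (Suc k) b"
proof -
  have "wt (strand_wt (Suc k)) (word_op b (cups (Suc k)))"
    using assms by (intro wt_word_op wt_cups) auto
  then have "cap_op k (cup_op k (word_op b (cups (Suc k)))) = qnum l *s word_op b (cups (Suc k))"
    by (rule cap_cup) (use assms(1) in \<open>auto simp: strand_wt_def\<close>)
  then show ?thesis
    using assms by (simp add: closure_op_def cups_Suc caps_Suc word_op_cup_op caps_lin)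
qed

lemma closure_op_kink:
  assumes k: "Suc k < n" and a: "\<And>i e. (i, e) \<in> set a \<Longrightarrow> i < n \<and> Suc k < i"
    and b: "\<And>i e. (i, e) \<in> set b \<Longrightarrow> i < n \<and> Suc k < i"
  shows "closure_op k (a @ (Suc k, True) # b) = (1 / l) *s closure_op (Suc k) (a @ b)"
proof -
  let ?y = "word_op b (cups (Suc k))"
  have w: "wt (strand_wt (Suc k)) ?y"
    using k b by (intro wt_word_op wt_cups) auto
  have "closure_op k (a @ (Suc k, True) # b)
      = caps (Suc k) (cap_op k (word_op a (letter_op (Suc k, True) (word_op b (cup_op k (cups (Suc k)))))))"
    using k by (simp add: closure_op_def cups_Suc caps_Suc)
  also have "\<dots> = caps (Suc k) (word_op a (cap_op k (S (int k + 1) (cup_op k ?y))))"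
    using a b by (simp add: word_op_cup_op word_op_cap_op letter_op_def add.commute)
  also have "\<dots> = (1 / l) *s closure_op (Suc k) (a @ b)"
    by (simp add: cap_S_cup[OF w k] word_op_lin caps_lin closure_op_def)
  finally show ?thesis .
qed

lemma wt_closure:
  "\<lbrakk>k < n; \<And>i e. (i, e) \<in> set b \<Longrightarrow> i < n\<rbrakk> \<Longrightarrow> wt (strand_wt k) (word_op b (cups k))"
  by (intro wt_word_op wt_cups) auto

lemma closure_op_skein:
  assumes "k < i" "i < n" "\<And>i e. (i, e) \<in> set b \<Longrightarrow> i < n"
  shows "closure_op k (a @ (i, False) # b)
    = closure_op k (a @ (i, True) # b) - (1 / q - q) *s closure_op k (a @ b)"
proof -
  have "wt (strand_wt k) (word_op b (cups k))"
    using assms by (intro wt_closure) auto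
  then have "S_inv i (word_op b (cups k)) = S i (word_op b (cups k)) - (1 / q - q) *s word_op b (cups k)"
    by (rule S_inv_eq) (use assms in \<open>auto simp: strand_wt_def\<close>)
  then show ?thesis
    by (simp add: closure_op_def letter_op_def word_op_lin caps_lin)
qed

lemma closure_op_sq:
  assumes "k < i" "i < n" "\<And>i e. (i, e) \<in> set b \<Longrightarrow> i < n"
  shows "closure_op k (a @ (i, True) # (i, True) # b)
    = closure_op k (a @ b) + (1 / q - q) *s closure_op k (a @ (i, True) # b)"
proof -
  have "wt (strand_wt k) (word_op b (cups k))"
    using assms by (intro wt_closure) auto
  then have "S i (S i (word_op b (cups k))) = word_op b (cups k) + (1 / q - q) *s S i (word_op b (cups k))"
    by (rule S_sq) (use assms in \<open>auto simp: strand_wt_def\<close>)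
  then show ?thesis
    by (simp add: closure_op_def letter_op_def word_op_lin caps_lin)
qed

lemma closure_op_comm:
  assumes "i < n" "j < n" "\<bar>int i - int j\<bar> > 1"
  shows "closure_op k (a @ (i, True) # (j, True) # b) = closure_op k (a @ (j, True) # (i, True) # b)"
  using assms by (simp add: closure_op_def letter_op_def S_comm[of "int i" "int j"])

lemma closure_op_braid:
  assumes "k < i" "Suc i < n" "\<And>i e. (i, e) \<in> set b \<Longrightarrow> i < n"
  shows "closure_op k (a @ (i, True) # (Suc i, True) # (i, True) # b)
    = closure_op k (a @ (Suc i, True) # (i, True) # (Suc i, True) # b)"
proof -
  have "wt (strand_wt k) (word_op b (cups k))"
    using assms by (intro wt_closure) auto
  then have "S i (S (Suc i) (S i (word_op b (cups k)))) = S (Suc i) (S i (S (Suc i) (word_op b (cups k))))"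
    by (rule S_braid) (use assms in \<open>auto simp: strand_wt_def\<close>)
  then show ?thesis
    by (simp add: closure_op_def letter_op_def)
qed

end

section \<open>Closed braid diagrams\<close>

lemma Fract_power: "Fract p 1 ^ m = Fract (p ^ m) (1 :: 'a::idom)"
  by (induction m) (simp_all add: One_fract_def)

lemma qq_nz: "qq \<noteq> 0"
  by (simp add: qq_def Zero_fract_def eq_fract)

lemma lam_nz: "lam \<noteq> 0"
  by (simp add: lam_def Zero_fract_def eq_fract)

lemma qq_power_ne_1: "m > 0 \<Longrightarrow> qq ^ m \<noteq> 1"
proof
  assume m: "m > 0" and "qq ^ m = 1"
  then have "[:[:0, 1:]:] ^ m = (1 :: rat poly poly)"
    by (simp add: qq_def Fract_power One_fract_def eq_fract)
  then have "[:0, 1:] ^ m = (1 :: rat poly)"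
    by (simp add: poly_const_pow one_pCons)
  then have "degree ([:0, 1 :: rat:] ^ m) = degree (1 :: rat poly)"
    by simp
  then show False
    using m by (simp add: degree_power_eq)
qed

lemma qq_powi_ne_1: "k \<noteq> 0 \<Longrightarrow> qq powi k \<noteq> 1"
  using qq_power_ne_1[of "nat k"] qq_power_ne_1[of "nat (- k)"]
  by (cases "k \<ge> 0") (auto simp: power_int_def power_inverse)

lemma qq_sq: "qq * qq \<noteq> 1"
  using qq_power_ne_1[of 2] by (simp add: power2_eq_square)

lemma qq_sum_nz: "qq + 1 / qq \<noteq> 0"
proof
  assume "qq + 1 / qq = 0"
  then have "(qq + 1 / qq) * qq = 0"
    by simp
  then have "qq * qq = -1"
    using qq_nz by (simp add: ring_distribs eq_neg_iff_add_eq_0)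
  then have "qq ^ 4 = 1"
    by (metis mult_minus1 minus_minus mult_minus_left mult_1 power4_eq_xxxx mult.assoc)
  then show False
    using qq_power_ne_1[of 4] by simp
qed

definition section_of :: "nat \<Rightarrow> bool list" where
  "section_of n = replicate n False @ replicate n True"

definition cup_layers :: "nat \<Rightarrow> diagram" where
  "cup_layers n = map (\<lambda>k. (k, Cup False)) [0..<n]"

definition cap_layers :: "nat \<Rightarrow> diagram" where
  "cap_layers n = map (\<lambda>k. (k, Cap)) (rev [0..<n])"

definition close_up :: "nat \<Rightarrow> diagram \<Rightarrow> diagram" where
  "close_up n X = cup_layers n @ X @ cap_layers n"

lemma closure_diagram_eq: "closure_diagram n b = close_up n (braid_diagram n b)"
  by (simp add: closure_diagram_def close_up_def cup_layers_def cap_layers_def)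

lemma top_of_append: "top_of (A @ B) s = (case top_of A s of None \<Rightarrow> None | Some t \<Rightarrow> top_of B t)"
  by (induction A arbitrary: s) (auto split: option.splits)

lemma length_section_of [simp]: "length (section_of n) = 2 * n"
  by (simp add: section_of_def)

lemma nth_section_of: "k < 2 * n \<Longrightarrow> section_of n ! k = (n \<le> k)"
  by (auto simp: section_of_def nth_append)

lemma section_of_Suc: "section_of (Suc n) = replicate n False @ [False, True] @ replicate n True"
  by (simp add: section_of_def replicate_append_same[symmetric])

lemma step_Cup_section: "step (n, Cup False) (section_of n) = Some (section_of (Suc n))"
  unfolding section_of_Suc by (simp add: section_of_def)

lemma step_Cap_section: "step (n, Cap) (section_of (Suc n)) = Some (section_of n)"
  unfolding section_of_Suc by (simp add: nth_append section_of_def)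

lemma top_of_cup_layers: "top_of (cup_layers n) [] = Some (section_of n)"
  by (induction n)
    (simp_all add: cup_layers_def top_of_append step_Cup_section del: step.simps, simp add: section_of_def)

lemma top_of_cap_layers: "top_of (cap_layers n) (section_of n) = Some []"
  by (induction n) (simp_all add: cap_layers_def step_Cap_section del: step.simps, simp add: section_of_def)

definition tangle :: "nat \<Rightarrow> diagram \<Rightarrow> bool" where
  "tangle n X \<longleftrightarrow> top_of X (section_of n) = Some (section_of n)"

lemma link_diagram_close_up: "tangle n X \<Longrightarrow> link_diagram (close_up n X)"
  by (simp add: tangle_def link_diagram_def close_up_def top_of_append top_of_cup_layers top_of_cap_layers)

definition crossings :: "nat \<Rightarrow> diagram \<Rightarrow> bool" where
  "crossings n X \<longleftrightarrow> (\<forall>(k, e) \<in> set X. n \<le> k \<and> k + 1 < 2 * n \<and> (\<exists>c. e = Cross c))"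

lemma crossings_simps [simp]:
  "crossings n []"
  "crossings n ((k, e) # X) \<longleftrightarrow> n \<le> k \<and> k + 1 < 2 * n \<and> (\<exists>c. e = Cross c) \<and> crossings n X"
  "crossings n (X @ Y) \<longleftrightarrow> crossings n X \<and> crossings n Y"
  by (simp_all add: crossings_def ball_Un)

lemma step_Cross_section:
  "\<lbrakk>n \<le> k; k + 1 < 2 * n\<rbrakk> \<Longrightarrow> step (k, Cross c) (section_of n) = Some (section_of n)"
  by (simp add: nth_section_of) (metis (full_types) length_section_of list_update_id nth_section_of
      Suc_lessD le_SucI)

lemma top_of_crossings: "crossings n X \<Longrightarrow> top_of X (section_of n) = Some (section_of n)"
  by (induction X) (auto simp: step_Cross_section simp del: step.simps)

lemma tangle_crossings: "crossings n X \<Longrightarrow> tangle n X"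
  by (simp add: tangle_def top_of_crossings)

lemma crossings_braid_diagram: "is_braid_word n b \<Longrightarrow> crossings n (braid_diagram n b)"
  by (fastforce simp: crossings_def braid_diagram_def is_braid_word_def)

lemma braid_diagram_simps [simp]:
  "braid_diagram n [] = []"
  "braid_diagram n ((i, c) # b) = braid_diagram n b @ [(n + i - 1, Cross c)]"
  "braid_diagram n (a @ b) = braid_diagram n b @ braid_diagram n a"
  by (auto simp: braid_diagram_def)

lemma is_braid_word_simps [simp]:
  "is_braid_word n []"
  "is_braid_word n ((i, c) # b) \<longleftrightarrow> 1 \<le> i \<and> i < n \<and> is_braid_word n b"
  "is_braid_word n (a @ b) \<longleftrightarrow> is_braid_word n a \<and> is_braid_word n b"
  by (auto simp: is_braid_word_def)

lemma writhe_from_append: "writhe_from s (A @ B)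
    = writhe_from s A + (case top_of A s of None \<Rightarrow> 0 | Some t \<Rightarrow> writhe_from t B)"
  by (induction A arbitrary: s) (auto split: option.splits)

lemma writhe_from_no_crossing:
  "(\<And>k c. (k, Cross c) \<notin> set D) \<Longrightarrow> writhe_from s D = 0"
proof (induction D arbitrary: s)
  case (Cons l D)
  obtain k e where l: "l = (k, e)" by force
  have "layer_sign s l = 0"
    using Cons.prems l by (cases e) auto
  then show ?case
    using Cons by (auto split: option.splits)
qed simp

definition exponent_sum :: "braid_word \<Rightarrow> int" where
  "exponent_sum b = (\<Sum>(i, c)\<leftarrow>b. if c then 1 else -1)"

lemma exponent_sum_simps [simp]:
  "exponent_sum [] = 0"
  "exponent_sum ((i, c) # b) = (if c then 1 else -1) + exponent_sum b"
  "exponent_sum (a @ b) = exponent_sum a + exponent_sum b"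
  by (simp_all add: exponent_sum_def)

lemma writhe_from_braid_diagram:
  "is_braid_word n b \<Longrightarrow> writhe_from (section_of n) (braid_diagram n b) = exponent_sum b"
proof (induction b)
  case (Cons s b)
  obtain i c where s: "s = (i, c)" by force
  have "n + i - 1 + 1 < 2 * n" "n \<le> n + i - 1"
    using Cons.prems s by auto
  then have "positive_at (section_of n) (n + i - 1) c = c"
    by (simp add: positive_at_def nth_section_of)
  moreover have "top_of (braid_diagram n b) (section_of n) = Some (section_of n)"
    using Cons.prems s by (intro top_of_crossings crossings_braid_diagram) simp
  ultimately show ?case
    using Cons s by (auto simp: writhe_from_append split: option.splits)
qed simp

lemma writhe_closure_diagram:
  assumes "is_braid_word n b"
  shows "writhe (closure_diagram n b) = exponent_sum b"
proof -
  have 1: "top_of (braid_diagram n b) (section_of n) = Some (section_of n)"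
    using assms by (intro top_of_crossings crossings_braid_diagram)
  have 2: "writhe_from [] (cup_layers n) = 0" "writhe_from (section_of n) (cap_layers n) = 0"
    by (auto intro!: writhe_from_no_crossing simp: cup_layers_def cap_layers_def)
  show ?thesis
    by (simp add: writhe_def closure_diagram_eq close_up_def writhe_from_append top_of_cup_layers
        1 2 writhe_from_braid_diagram[OF assms])
qed

locale homfly =
  fixes H :: "diagram \<Rightarrow> qfield"
  assumes is_HOMFLY: "is_HOMFLY H"
begin

lemma H_move: "\<lbrakk>diagram_move D D'; link_diagram D; link_diagram D'\<rbrakk> \<Longrightarrow> H D = H D'"
  using is_HOMFLY unfolding is_HOMFLY_def link_invariant_def isotopic_def
  by (meson r_into_equivclp)

lemma H_local_move:
  assumes "local_move U V" "tangle n (A @ shift k U @ B)" "tangle n (A @ shift k V @ B)"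
  shows "H (close_up n (A @ shift k U @ B)) = H (close_up n (A @ shift k V @ B))"
proof (rule H_move)
  show "diagram_move (close_up n (A @ shift k U @ B)) (close_up n (A @ shift k V @ B))"
    unfolding diagram_move_def
  proof (intro conjI exI)
    show "close_up n (A @ shift k U @ B) = (cup_layers n @ A) @ shift k U @ (B @ cap_layers n)"
      "close_up n (A @ shift k V @ B) = (cup_layers n @ A) @ shift k V @ (B @ cap_layers n)"
      by (simp_all add: close_up_def)
  qed (use assms in \<open>auto intro: link_diagram_close_up\<close>)
qed (use assms in \<open>auto intro: link_diagram_close_up\<close>)

lemma H_skein:
  assumes "is_braid_word n (a @ (i, True) # b)"
  shows "(1 / lam) * H (closure_diagram n (a @ (i, True) # b)) - lam * H (closure_diagram n (a @ (i, False) # b))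
    = (1 / qq - qq) * H (closure_diagram n (a @ b))"
proof -
  let ?A = "cup_layers n @ braid_diagram n b" and ?B = "braid_diagram n a @ cap_layers n"
  let ?k = "n + i - 1"
  have top: "top_of ?A [] = Some (section_of n)"
    using assms by (simp add: top_of_append top_of_cup_layers top_of_crossings crossings_braid_diagram)
  have "?k + 1 < 2 * n" "n \<le> ?k"
    using assms by auto
  then have eq: "section_of n ! ?k = section_of n ! (?k + 1)"
    by (simp add: nth_section_of)
  have "skein_triple (closure_diagram n (a @ (i, True) # b)) (closure_diagram n (a @ (i, False) # b))
      (closure_diagram n (a @ b))"
    unfolding skein_triple_def
  proof (intro conjI exI)
    show "link_diagram (closure_diagram n (a @ (i, True) # b))"
      unfolding closure_diagram_eq
      by (intro link_diagram_close_up tangle_crossings crossings_braid_diagram assms)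
    show "top_of ?A [] = Some (section_of n)" by (fact top)
    show "positive_at (section_of n) ?k True"
      using eq by (simp add: positive_at_def)
    show "closure_diagram n (a @ (i, True) # b) = ?A @ [(?k, Cross True)] @ ?B"
      "closure_diagram n (a @ (i, False) # b) = ?A @ [(?k, Cross (\<not> True))] @ ?B"
      "closure_diagram n (a @ b) = ?A @ smoothing (section_of n) ?k @ ?B"
      using eq by (simp_all add: closure_diagram_eq close_up_def smoothing_def)
  qed
  then show ?thesis
    using is_HOMFLY unfolding is_HOMFLY_def by blast
qed

lemma H_braid_move:
  assumes "local_move U V" "shift k U = braid_diagram n u" "shift k V = braid_diagram n v"
    and "is_braid_word n (a @ u @ b)" "is_braid_word n (a @ v @ b)"
  shows "H (closure_diagram n (a @ u @ b)) = H (closure_diagram n (a @ v @ b))"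
  using H_local_move[OF assms(1), of n "braid_diagram n b" k "braid_diagram n a"]
    tangle_crossings[OF crossings_braid_diagram[OF assms(4)]]
    tangle_crossings[OF crossings_braid_diagram[OF assms(5)]]
  by (simp add: closure_diagram_eq assms(2,3))

lemma H_R2:
  assumes "is_braid_word n (a @ (i, True) # b)"
  shows "H (closure_diagram n (a @ (i, True) # (i, False) # b)) = H (closure_diagram n (a @ b))"
  using H_braid_move[OF local_move.R2[of False], of "n + i - 1" n "[(i, True), (i, False)]" "[]" a b] assms
  by (simp add: shift_def)

lemma H_far:
  assumes "is_braid_word n (a @ (i, c) # (j, d) # b)" "Suc i < j"
  shows "H (closure_diagram n (a @ (i, c) # (j, d) # b)) = H (closure_diagram n (a @ (j, d) # (i, c) # b))"
proof -
  obtain m where j: "j = i + 2 + m"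
    using assms(2) by (metis add_2_eq_Suc' le_Suc_ex Suc_leI)
  obtain i' where i: "i = Suc i'"
    using assms(1) by (cases i) auto
  show ?thesis
    using H_braid_move[OF local_move.exchange[of "Cross c" m "Cross d"], of "n + i'" n
        "[(j, d), (i, c)]" "[(i, c), (j, d)]" a b] assms
    by (simp add: shift_def i j add.assoc)
qed

lemma H_R3:
  assumes "is_braid_word n (a @ (i, True) # (Suc i, True) # b)"
  shows "H (closure_diagram n (a @ (i, True) # (Suc i, True) # (i, True) # b))
    = H (closure_diagram n (a @ (Suc i, True) # (i, True) # (Suc i, True) # b))"
  using H_braid_move[OF local_move.R3[of True True True], of "n + i - 1" n
      "[(i, True), (Suc i, True), (i, True)]" "[(Suc i, True), (i, True), (Suc i, True)]" a b] assms
  by (simp add: shift_def)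

lemma top_of_tooth:
  assumes "crossings n P" "crossings (Suc n) B" "crossings n R"
  shows "tangle n (P @ (n, Cup False) # B @ (n, Cap) # R)"
  using assms
  by (simp add: tangle_def top_of_append top_of_crossings step_Cup_section step_Cap_section del: step.simps)

definition pull :: "diagram \<Rightarrow> diagram" where
  "pull = map (\<lambda>(k, e). (k - 2, e))"

lemma crossings_pull: "crossings (Suc n) B \<Longrightarrow> (\<forall>(k, e) \<in> set B. n + 2 \<le> k) \<Longrightarrow> crossings n (pull B)"
  by (fastforce simp: crossings_def pull_def)

lemma H_pull_cup:
  assumes "crossings n P" "crossings (Suc n) B" "\<forall>(k, e) \<in> set B. n + 2 \<le> k" "crossings (Suc n) C" "crossings n R"
  shows "H (close_up n (P @ (n, Cup False) # B @ C @ (n, Cap) # R))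
    = H (close_up n (P @ pull B @ (n, Cup False) # C @ (n, Cap) # R))"
  using assms
proof (induction B arbitrary: P)
  case (Cons l B)
  obtain k c where l: "l = (k, Cross c)" "n + 2 \<le> k" "k + 1 < 2 * n + 2"
    using Cons.prems by (cases l) auto
  obtain m where k: "k = n + 2 + m"
    using le_Suc_ex[OF l(2)] by blast
  have "tangle n (P @ (n, Cup False) # ((k, Cross c) # B @ C) @ (n, Cap) # R)"
    using Cons.prems l by (intro top_of_tooth) auto
  moreover have "tangle n ((P @ [(k - 2, Cross c)]) @ (n, Cup False) # (B @ C) @ (n, Cap) # R)"
    using Cons.prems l by (intro top_of_tooth) auto
  ultimately have "H (close_up n (P @ (n, Cup False) # (k, Cross c) # B @ C @ (n, Cap) # R))
      = H (close_up n ((P @ [(k - 2, Cross c)]) @ (n, Cup False) # B @ C @ (n, Cap) # R))"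
    using H_local_move[OF local_move.exchange[of "Cup False" m "Cross c"], of n P n "B @ C @ (n, Cap) # R"]
    by (simp add: shift_def k)
  also have "\<dots> = H (close_up n ((P @ [(k - 2, Cross c)]) @ pull B @ (n, Cup False) # C @ (n, Cap) # R))"
    using Cons.prems l by (intro Cons.IH) auto
  finally show ?case
    using l by (simp add: pull_def)
qed (simp add: pull_def)

lemma H_pull_cap:
  assumes "crossings n P" "crossings (Suc n) A" "\<forall>(k, e) \<in> set A. n + 2 \<le> k" "crossings (Suc n) C" "crossings n R"
  shows "H (close_up n (P @ (n, Cup False) # C @ A @ (n, Cap) # R))
    = H (close_up n (P @ (n, Cup False) # C @ (n, Cap) # pull A @ R))"
  using assms
proof (induction A arbitrary: R rule: rev_induct)
  case (snoc l A)
  obtain k c where l: "l = (k, Cross c)" "n + 2 \<le> k" "k + 1 < 2 * n + 2"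
    using snoc.prems by (cases l) auto
  obtain m where k: "k = n + 2 + m"
    using le_Suc_ex[OF l(2)] by blast
  have "tangle n (P @ (n, Cup False) # (C @ A @ [(k, Cross c)]) @ (n, Cap) # R)"
    using snoc.prems l by (intro top_of_tooth) auto
  moreover have "tangle n (P @ (n, Cup False) # (C @ A) @ (n, Cap) # (k - 2, Cross c) # R)"
    using snoc.prems l by (intro top_of_tooth) auto
  ultimately have "H (close_up n (P @ (n, Cup False) # C @ A @ (k, Cross c) # (n, Cap) # R))
      = H (close_up n (P @ (n, Cup False) # C @ A @ (n, Cap) # (k - 2, Cross c) # R))"
    using H_local_move[OF local_move.exchange[of Cap m "Cross c"], of n "P @ (n, Cup False) # C @ A" n "R"]
    by (simp add: shift_def k)
  also have "\<dots> = H (close_up n (P @ (n, Cup False) # C @ (n, Cap) # pull A @ (k - 2, Cross c) # R))"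
    using snoc.prems l by (intro snoc.IH) auto
  finally show ?case
    using l by (simp add: pull_def)
qed (simp add: pull_def)

lemma H_kink_tangle:
  assumes "n \<ge> 1" "crossings n P" "crossings n R"
  shows "H (close_up n (P @ (n, Cup False) # (n + 1, Cross c) # (n, Cap) # R)) = H (close_up n (P @ R))"
proof -
  let ?s = "replicate n False @ True # False # replicate n True"
  have s: "step (Suc n, Cup False) (section_of n) = Some ?s"
    using assms(1) by (cases n) (simp_all add: section_of_def)
  have 1: "step (n, Cross (\<not> c)) ?s = Some (section_of (Suc n))"
    by (simp add: section_of_def nth_append list_update_append replicate_append_same[symmetric])
  have 2: "step (n, Cap) ?s = Some (section_of n)"
    by (simp add: section_of_def nth_append)
  note top = tangle_def top_of_append top_of_crossings s 1 2 step_Cap_section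
  have t1: "tangle n (P @ (n, Cup False) # [(n + 1, Cross c)] @ (n, Cap) # R)"
    using assms by (intro top_of_tooth) auto
  have t2: "tangle n (P @ (n + 1, Cup False) # (n, Cross (\<not> c)) # (n, Cap) # R)"
    using assms by (simp add: top del: step.simps)
  have t3: "tangle n (P @ (n + 1, Cup False) # (n, Cap) # R)"
    using assms by (simp add: top del: step.simps)
  have t4: "tangle n (P @ R)"
    using assms by (intro tangle_crossings) auto
  have "H (close_up n (P @ (n, Cup False) # (n + 1, Cross c) # (n, Cap) # R))
      = H (close_up n (P @ (n + 1, Cup False) # (n, Cross (\<not> c)) # (n, Cap) # R))"
    using H_local_move[OF local_move.slide_cup[of False c], of n P n "(n, Cap) # R"] t1 t2
    by (simp add: shift_def)
  also have "\<dots> = H (close_up n (P @ (n + 1, Cup False) # (n, Cap) # R))"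
    using H_local_move[OF local_move.R1_cap[of "\<not> c"], of n "P @ [(n + 1, Cup False)]" n "R"] t2 t3
    by (simp add: shift_def)
  also have "\<dots> = H (close_up n (P @ R))"
    using H_local_move[OF local_move.zigzag_left[of False], of n P n "R"] t3 t4
    by (simp add: shift_def)
  finally show ?thesis .
qed

definition drop_strand :: "braid_word \<Rightarrow> braid_word" where
  "drop_strand = map (\<lambda>(i, c). (i - 1, c))"

lemma pull_braid_diagram:
  "\<lbrakk>is_braid_word (Suc n) b; \<forall>(i, c) \<in> set b. 2 \<le> i\<rbrakk>
    \<Longrightarrow> pull (braid_diagram (Suc n) b) = braid_diagram n (drop_strand b)"
  by (auto simp: pull_def braid_diagram_def drop_strand_def rev_map is_braid_word_def)

lemma H_markov:
  assumes "n \<ge> 1" "is_braid_word (Suc n) (a @ b)" "\<forall>(i, c) \<in> set (a @ b). 2 \<le> i"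
  shows "H (closure_diagram (Suc n) (a @ (1, c) # b)) = H (closure_diagram n (drop_strand (a @ b)))"
proof -
  let ?A = "braid_diagram (Suc n) a" and ?B = "braid_diagram (Suc n) b"
  have cr: "crossings (Suc n) ?A" "crossings (Suc n) ?B"
    using assms by (auto intro: crossings_braid_diagram)
  have far: "\<forall>(k, e) \<in> set ?A. n + 2 \<le> k" "\<forall>(k, e) \<in> set ?B. n + 2 \<le> k"
    using assms by (fastforce simp: braid_diagram_def)+
  have pull: "pull ?A = braid_diagram n (drop_strand a)" "pull ?B = braid_diagram n (drop_strand b)"
    using assms by (auto intro!: pull_braid_diagram)
  have cr': "crossings n (pull ?A)" "crossings n (pull ?B)"
    by (rule crossings_pull[OF cr(1) far(1)], rule crossings_pull[OF cr(2) far(2)])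
  have "close_up (Suc n) X = close_up n ((n, Cup False) # X @ [(n, Cap)])" for X
    by (simp add: close_up_def cup_layers_def cap_layers_def)
  then have "H (closure_diagram (Suc n) (a @ (1, c) # b))
      = H (close_up n ([] @ (n, Cup False) # ?B @ ([(n + 1, Cross c)] @ ?A) @ (n, Cap) # []))"
    by (simp add: closure_diagram_eq)
  also have "\<dots> = H (close_up n ([] @ pull ?B @ (n, Cup False) # ([(n + 1, Cross c)] @ ?A) @ (n, Cap) # []))"
    using assms cr far by (intro H_pull_cup) auto
  also have "\<dots> = H (close_up n (pull ?B @ (n, Cup False) # [(n + 1, Cross c)] @ ?A @ (n, Cap) # []))"
    by simp
  also have "\<dots> = H (close_up n (pull ?B @ (n, Cup False) # [(n + 1, Cross c)] @ (n, Cap) # pull ?A @ []))"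
    using assms cr far cr' by (intro H_pull_cap) auto
  also have "\<dots> = H (close_up n (pull ?B @ pull ?A))"
    using H_kink_tangle[of n "pull ?B" "pull ?A" c] assms cr' by simp
  also have "\<dots> = H (closure_diagram n (drop_strand (a @ b)))"
    by (simp add: closure_diagram_eq pull drop_strand_def)
  finally show ?thesis .
qed

definition unknot_value :: qfield where
  "unknot_value = (lam - 1 / lam) / (qq - 1 / qq)"

lemma H_split_unknot:
  assumes "n \<ge> 1" "is_braid_word (Suc n) b" "\<forall>(i, c) \<in> set b. 2 \<le> i"
  shows "H (closure_diagram (Suc n) b) = unknot_value * H (closure_diagram n (drop_strand b))"
proof -
  let ?h = "H (closure_diagram n (drop_strand b))"
  have "qq - 1 / qq \<noteq> 0"
    using qq_sq qq_nz by (simp add: field_simps)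
  moreover have "(1 / lam) * ?h - lam * ?h = (1 / qq - qq) * H (closure_diagram (Suc n) b)"
    using H_skein[of "Suc n" b 1 "[]"] H_markov[of n b "[]"] assms by simp
  then have "(lam - 1 / lam) * ?h = (qq - 1 / qq) * H (closure_diagram (Suc n) b)"
    by (simp add: algebra_simps)
  ultimately show ?thesis
    by (simp add: unknot_value_def field_simps)
qed

lemma H_closure_one: "H (closure_diagram 1 []) = unknot_value"
proof -
  have 1: "link_diagram [(0, Cup True), (0, Cap)]" "link_diagram [(0, Cup False), (0, Cap)]"
    "link_diagram [(0, Cup True), (0, Cross True), (0, Cap)]"
    by (simp_all add: link_diagram_def)
  have "diagram_move [(0, Cup True), (0, Cross True), (0, Cap)] [(0, Cup True), (0, Cap)]"
    unfolding diagram_move_def using 1 local_move.R1_cap[of True]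
    by (intro conjI exI[of _ "[(0, Cup True)]"] exI[of _ "[]"] exI[of _ "0 :: nat"]
        exI[of _ "[(0, Cross True), (0, Cap)]"] exI[of _ "[(0, Cap)]"]) (simp_all add: shift_def)
  moreover have "diagram_move [(0, Cup True), (0, Cross True), (0, Cap)] [(0, Cup False), (0, Cap)]"
    unfolding diagram_move_def using 1 local_move.R1_cup[of True True]
    by (intro conjI exI[of _ "[]"] exI[of _ "[(0, Cap)]"] exI[of _ "0 :: nat"]
        exI[of _ "[(0, Cup True), (0, Cross True)]"] exI[of _ "[(0, Cup False)]"]) (simp_all add: shift_def)
  ultimately have "H [(0, Cup False), (0, Cap)] = H unknot"
    using 1 H_move unfolding unknot_def by metis
  then show ?thesis
    using is_HOMFLY by (simp add: is_HOMFLY_def unknot_value_def closure_diagram_def)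
qed

lemma lam_powi_shift: "lam powi (w - 1) = (1 / lam) * lam powi w" "lam powi (w + 1) = lam * lam powi w"
  using lam_nz by (simp_all add: power_int_diff power_int_add)

definition framed :: "nat \<Rightarrow> braid_word \<Rightarrow> qfield" where
  "framed n b = lam powi (- exponent_sum b) * H (closure_diagram n b)"

lemma framed_skein:
  assumes "is_braid_word n (a @ (i, True) # b)"
  shows "framed n (a @ (i, False) # b)
    = framed n (a @ (i, True) # b) - (1 / qq - qq) * framed n (a @ b)"
proof -
  let ?w = "exponent_sum (a @ b)"
  have "exponent_sum (a @ (i, True) # b) = ?w + 1" "exponent_sum (a @ (i, False) # b) = ?w - 1"
    by simp_all
  then have w: "- exponent_sum (a @ (i, True) # b) = - ?w - 1" "- exponent_sum (a @ (i, False) # b) = - ?w + 1"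
    by simp_all
  show ?thesis
    unfolding framed_def w lam_powi_shift
    using arg_cong[OF H_skein[OF assms], of "\<lambda>x. lam powi (- ?w) * x"]
    by (simp add: algebra_simps del: exponent_sum_simps)
qed

lemma framed_sq:
  assumes "is_braid_word n (a @ (i, True) # b)"
  shows "framed n (a @ (i, True) # (i, True) # b)
    = framed n (a @ b) + (1 / qq - qq) * framed n (a @ (i, True) # b)"
  using framed_skein[of n "a @ [(i, True)]" i b] H_R2[OF assms] assms by (simp add: framed_def)

lemma framed_far:
  "\<lbrakk>is_braid_word n (a @ (i, True) # (j, True) # b); Suc i < j\<rbrakk>
    \<Longrightarrow> framed n (a @ (i, True) # (j, True) # b) = framed n (a @ (j, True) # (i, True) # b)"
  using H_far[of n a i True j True b] by (simp add: framed_def)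

lemma framed_braid:
  "is_braid_word n (a @ (i, True) # (Suc i, True) # b)
    \<Longrightarrow> framed n (a @ (i, True) # (Suc i, True) # (i, True) # b)
      = framed n (a @ (Suc i, True) # (i, True) # (Suc i, True) # b)"
  using H_R3[of n a i b] by (simp add: framed_def)

lemma exponent_sum_drop_strand [simp]: "exponent_sum (drop_strand b) = exponent_sum b"
  by (induction b) (auto simp: drop_strand_def)

lemma framed_split_unknot:
  "\<lbrakk>n \<ge> 1; is_braid_word (Suc n) b; \<forall>(i, c) \<in> set b. 2 \<le> i\<rbrakk>
    \<Longrightarrow> framed (Suc n) b = unknot_value * framed n (drop_strand b)"
  by (simp add: framed_def H_split_unknot)

lemma framed_markov:
  assumes "n \<ge> 1" "is_braid_word (Suc n) (a @ b)" "\<forall>(i, c) \<in> set (a @ b). 2 \<le> i"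
  shows "framed (Suc n) (a @ (1, True) # b) = (1 / lam) * framed n (drop_strand (a @ b))"
proof -
  have w: "- exponent_sum (a @ (1, True) # b) = - exponent_sum (a @ b) - 1"
    by simp
  show ?thesis
    unfolding framed_def w lam_powi_shift H_markov[OF assms] by simp
qed

lemma framed_one: "framed 1 [] = unknot_value"
  by (simp add: framed_def H_closure_one[unfolded One_nat_def])

end

section \<open>Induced modules\<close>

lemma (in group) rcos_eq_iff:
  assumes "subgroup N G" "x \<in> carrier G" "y \<in> carrier G"
  shows "N #> x = N #> y \<longleftrightarrow> x \<otimes> inv y \<in> N"
proof -
  note N = subgroup.subset[OF assms(1)]
  have "N #> x = N #> y" if "N #> (x \<otimes> inv y) = N"
    using coset_mult_inv1[OF that assms(2,3) N] .
  moreover have "N #> (x \<otimes> inv y) = N" if "N #> x = N #> y"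
    using coset_mult_inv2[OF that assms(2,3) N] .
  moreover have "N #> (x \<otimes> inv y) = N \<longleftrightarrow> x \<otimes> inv y \<in> N"
    using coset_join1[OF _ _ assms(1), of "x \<otimes> inv y"] coset_join2[OF _ assms(1), of "x \<otimes> inv y"]
      assms(2,3) by blast
  ultimately show ?thesis by blast
qed

locale tensor =
  R?: ring R + L?: abelian_group L
  for R :: "('a, 'r) ring_scheme" and S :: "'a set" and L :: "('a, 'l, 'd) module_scheme" +
  assumes S_sub: "S \<subseteq> carrier R"
    and S_act: "\<lbrakk>s \<in> S; l \<in> carrier L\<rbrakk> \<Longrightarrow> s \<odot>\<^bsub>L\<^esub> l \<in> carrier L"
begin

abbreviation "G \<equiv> tensor_gens R L"
abbreviation "N \<equiv> tensor_rels R S L"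
abbreviation "M \<equiv> induced_module R S L"

lemma G_simps [simp]:
  "carrier G = {c. Poly_Mapping.keys c \<subseteq> carrier R \<times> carrier L}"
  "\<one>\<^bsub>G\<^esub> = 0" "x \<otimes>\<^bsub>G\<^esub> y = x + y"
  by (auto simp: tensor_gens_def)

lemma G_inv [simp]: "Poly_Mapping.keys x \<subseteq> carrier R \<times> carrier L \<Longrightarrow> inv\<^bsub>G\<^esub> x = - x"
  by (simp add: tensor_gens_def)

lemma G_comm: "comm_group G"
  by (simp add: tensor_gens_def abelian_free_Abelian_group)

sublocale G: comm_group G
  by (fact G_comm)

definition basic_rels :: "('a \<times> 'l \<Rightarrow>\<^sub>0 int) set" where
  "basic_rels = {frag_of (x \<oplus>\<^bsub>R\<^esub> y, l) - frag_of (x, l) - frag_of (y, l) | x y l.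
         x \<in> carrier R \<and> y \<in> carrier R \<and> l \<in> carrier L}
    \<union> {frag_of (x, l \<oplus>\<^bsub>L\<^esub> m) - frag_of (x, l) - frag_of (x, m) | x l m.
         x \<in> carrier R \<and> l \<in> carrier L \<and> m \<in> carrier L}
    \<union> {frag_of (x \<otimes>\<^bsub>R\<^esub> s, l) - frag_of (x, s \<odot>\<^bsub>L\<^esub> l) | x s l.
         x \<in> carrier R \<and> s \<in> S \<and> l \<in> carrier L}"

lemma N_eq: "N = generate G basic_rels"
  by (simp add: tensor_rels_def basic_rels_def)

lemma frag_of_G: "\<lbrakk>x \<in> carrier R; l \<in> carrier L\<rbrakk> \<Longrightarrow> frag_of (x, l) \<in> carrier G"
  by simp

lemma G_diff: "\<lbrakk>x \<in> carrier G; y \<in> carrier G\<rbrakk> \<Longrightarrow> x - y \<in> carrier G"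
  using keys_diff[of x y] by auto

lemma G_add: "\<lbrakk>x \<in> carrier G; y \<in> carrier G\<rbrakk> \<Longrightarrow> x + y \<in> carrier G"
  using G.m_closed[of x y] by simp

lemma basic_rels_G: "basic_rels \<subseteq> carrier G"
proof -
  have 1: "frag_of (x \<oplus>\<^bsub>R\<^esub> y, l) - frag_of (x, l) - frag_of (y, l) \<in> carrier G"
    if "x \<in> carrier R" "y \<in> carrier R" "l \<in> carrier L" for x y l
    by (rule G_diff[OF G_diff[OF frag_of_G frag_of_G] frag_of_G]) (use that in simp_all)
  have 2: "frag_of (x, l \<oplus>\<^bsub>L\<^esub> m) - frag_of (x, l) - frag_of (x, m) \<in> carrier G"
    if "x \<in> carrier R" "l \<in> carrier L" "m \<in> carrier L" for x l m
    by (rule G_diff[OF G_diff[OF frag_of_G frag_of_G] frag_of_G]) (use that in simp_all)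
  have 3: "frag_of (x \<otimes>\<^bsub>R\<^esub> s, l) - frag_of (x, s \<odot>\<^bsub>L\<^esub> l) \<in> carrier G"
    if "x \<in> carrier R" "s \<in> S" "l \<in> carrier L" for x s l
    by (rule G_diff[OF frag_of_G frag_of_G]) (use that S_sub S_act in auto)
  show ?thesis
    unfolding basic_rels_def
    by (intro Un_least subsetI; elim CollectE exE conjE; hypsubst; intro 1 2 3; assumption)
qed

lemma N_subgroup: "subgroup N G"
  unfolding N_eq by (rule G.generate_is_subgroup[OF basic_rels_G])

lemma N_normal: "N \<lhd> G"
  by (rule G.subgroup_imp_normal[OF N_subgroup])

lemma N_zero: "0 \<in> N"
  using subgroup.one_closed[OF N_subgroup] by simp

lemma N_G: "x \<in> N \<Longrightarrow> x \<in> carrier G"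
  using subgroup.subset[OF N_subgroup] by blast

lemma N_add: "\<lbrakk>x \<in> N; y \<in> N\<rbrakk> \<Longrightarrow> x + y \<in> N"
  using subgroup.m_closed[OF N_subgroup] by simp

lemma N_minus: "x \<in> N \<Longrightarrow> - x \<in> N"
  using subgroup.m_inv_closed[OF N_subgroup, of x] N_G[of x] by simp

lemma N_diff: "\<lbrakk>x \<in> N; y \<in> N\<rbrakk> \<Longrightarrow> x - y \<in> N"
  using N_add[of x "- y"] N_minus by simp

lemma N_basic: "x \<in> basic_rels \<Longrightarrow> x \<in> N"
  unfolding N_eq by (rule generate.incl)

lemma N_rel_l: "\<lbrakk>x \<in> carrier R; y \<in> carrier R; l \<in> carrier L\<rbrakk>
    \<Longrightarrow> frag_of (x \<oplus>\<^bsub>R\<^esub> y, l) - frag_of (x, l) - frag_of (y, l) \<in> N"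
  by (rule N_basic) (auto simp: basic_rels_def)

lemma N_rel_r: "\<lbrakk>x \<in> carrier R; l \<in> carrier L; m \<in> carrier L\<rbrakk>
    \<Longrightarrow> frag_of (x, l \<oplus>\<^bsub>L\<^esub> m) - frag_of (x, l) - frag_of (x, m) \<in> N"
  by (rule N_basic) (auto simp: basic_rels_def)

lemma N_rel_s: "\<lbrakk>x \<in> carrier R; s \<in> S; l \<in> carrier L\<rbrakk>
    \<Longrightarrow> frag_of (x \<otimes>\<^bsub>R\<^esub> s, l) - frag_of (x, s \<odot>\<^bsub>L\<^esub> l) \<in> N"
  by (rule N_basic) (auto simp: basic_rels_def)

lemma N_zero_l: "l \<in> carrier L \<Longrightarrow> frag_of (\<zero>\<^bsub>R\<^esub>, l) \<in> N"
  using N_minus[OF N_rel_l[of "\<zero>\<^bsub>R\<^esub>" "\<zero>\<^bsub>R\<^esub>" l]] by simp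

lemma N_zero_r: "x \<in> carrier R \<Longrightarrow> frag_of (x, \<zero>\<^bsub>L\<^esub>) \<in> N"
  using N_minus[OF N_rel_r[of x "\<zero>\<^bsub>L\<^esub>" "\<zero>\<^bsub>L\<^esub>"]] by simp

definition q :: "('a \<times> 'l \<Rightarrow>\<^sub>0 int) \<Rightarrow> ('a \<times> 'l \<Rightarrow>\<^sub>0 int) set" where
  "q c = N #>\<^bsub>G\<^esub> c"

lemma q_eq: "\<lbrakk>c \<in> carrier G; d \<in> carrier G\<rbrakk> \<Longrightarrow> q c = q d \<longleftrightarrow> c - d \<in> N"
  unfolding q_def by (subst G.rcos_eq_iff[OF N_subgroup]) simp_all

lemma carrier_M: "carrier M = q ` carrier G"
  by (simp add: induced_module_def Let_def carrier_FactGroup q_def del: G_simps)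

lemma add_M: "\<lbrakk>c \<in> carrier G; d \<in> carrier G\<rbrakk> \<Longrightarrow> q c \<oplus>\<^bsub>M\<^esub> q d = q (c + d)"
  using normal.rcos_sum[OF N_normal, of c d] by (simp add: induced_module_def Let_def q_def)

definition act :: "'a \<Rightarrow> ('a \<times> 'l \<Rightarrow>\<^sub>0 int) \<Rightarrow> ('a \<times> 'l \<Rightarrow>\<^sub>0 int)" where
  "act a = frag_extend (\<lambda>(x, l). frag_of (a \<otimes>\<^bsub>R\<^esub> x, l))"

lemma act_simps [simp]:
  "act a 0 = 0" "act a (c + d) = act a c + act a d" "act a (- c) = - act a c"
  "act a (c - d) = act a c - act a d" "act a (frag_of (x, l)) = frag_of (a \<otimes>\<^bsub>R\<^esub> x, l)"
  by (simp_all add: act_def frag_extend_add frag_extend_diff frag_extend_minus)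

lemma act_G: "\<lbrakk>a \<in> carrier R; c \<in> carrier G\<rbrakk> \<Longrightarrow> act a c \<in> carrier G"
proof -
  assume a: "a \<in> carrier R" and "c \<in> carrier G"
  then have "Poly_Mapping.keys c \<subseteq> carrier R \<times> carrier L"
    by simp
  then show ?thesis
  proof (induction c rule: frag_induction)
    case (one x)
    then show ?case using a by (cases x) auto
  next
    case (diff c d)
    then show ?case unfolding act_simps by (rule G_diff)
  qed simp
qed

lemma act_N: "\<lbrakk>a \<in> carrier R; c \<in> N\<rbrakk> \<Longrightarrow> act a c \<in> N"
  unfolding N_eq
proof -
  assume a: "a \<in> carrier R" and c: "c \<in> generate G basic_rels"
  have b: "act a r \<in> N" if "r \<in> basic_rels" for r
    using that a S_sub unfolding basic_rels_def
    by (auto simp: R.r_distr R.m_assoc[symmetric] subset_iff intro!: N_rel_l N_rel_r N_rel_s)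
  have "act a c \<in> N"
    using c
  proof (induction rule: generate.induct)
    case (inv h)
    then show ?case
      using b[of h] basic_rels_G N_minus by (auto simp: subset_iff)
  qed (use b N_zero N_add in auto)
  then show "act a c \<in> generate G basic_rels"
    by (simp add: N_eq)
qed

lemma smult_M:
  assumes a: "a \<in> carrier R" and c: "c \<in> carrier G"
  shows "a \<odot>\<^bsub>M\<^esub> q c = q (act a c)"
proof -
  have "q (act a (h + c)) = q (act a c)" if "h \<in> N" for h
    using act_G[OF a c] act_G[OF a G_add[OF N_G[OF that] c]] act_N[OF a that]
    by (subst q_eq) simp_all
  moreover have "q c = (\<lambda>h. h + c) ` N"
    by (auto simp: q_def r_coset_def)
  ultimately have "(\<lambda>d. q (act a d)) ` q c = {q (act a c)}"
    using N_zero by auto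
  then show ?thesis
    by (simp add: induced_module_def Let_def q_def act_def)
qed

end

lemma free_algebra_simps [simp]:
  "x \<otimes>\<^bsub>free_algebra G\<^esub> y = x * y" "\<one>\<^bsub>free_algebra G\<^esub> = 1"
  "\<zero>\<^bsub>free_algebra G\<^esub> = 0" "x \<oplus>\<^bsub>free_algebra G\<^esub> y = x + y"
  by (simp_all add: free_algebra_def)

lemma free_algebra_iff:
  "x \<in> carrier (free_algebra G) \<longleftrightarrow> (\<forall>w \<in> Poly_Mapping.keys x. set (letters w) \<subseteq> G)"
  by (simp add: free_algebra_def)

lemma free_algebra_zero: "0 \<in> carrier (free_algebra G)"
  by (simp add: free_algebra_iff)

lemma free_algebra_scal: "scal c \<in> carrier (free_algebra G)"
  by (simp add: free_algebra_iff scal_def zero_fword_def)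

lemma free_algebra_one: "1 \<in> carrier (free_algebra G)"
  using free_algebra_scal[of 1 G] by (simp add: scal_def)

lemma free_algebra_gen: "g \<in> G \<Longrightarrow> gen g \<in> carrier (free_algebra G)"
  by (simp add: free_algebra_iff gen_def)

lemma free_algebra_add:
  "\<lbrakk>x \<in> carrier (free_algebra G); y \<in> carrier (free_algebra G)\<rbrakk> \<Longrightarrow> x + y \<in> carrier (free_algebra G)"
  using keys_add[of x y] by (auto simp: free_algebra_iff)

lemma free_algebra_minus:
  "x \<in> carrier (free_algebra G) \<Longrightarrow> - x \<in> carrier (free_algebra G)"
  by (simp add: free_algebra_iff)

lemma free_algebra_diff:
  "\<lbrakk>x \<in> carrier (free_algebra G); y \<in> carrier (free_algebra G)\<rbrakk> \<Longrightarrow> x - y \<in> carrier (free_algebra G)"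
  using free_algebra_add[of x G "- y"] free_algebra_minus[of y G] by simp

lemma free_algebra_mult:
  assumes "x \<in> carrier (free_algebra G)" "y \<in> carrier (free_algebra G)"
  shows "x * y \<in> carrier (free_algebra G)"
  unfolding free_algebra_iff
proof
  fix w assume "w \<in> Poly_Mapping.keys (x * y)"
  then obtain a b where "w = a + b" "a \<in> Poly_Mapping.keys x" "b \<in> Poly_Mapping.keys y"
    using keys_mult[of x y] by blast
  then show "set (letters w) \<subseteq> G"
    using assms by (auto simp: free_algebra_iff plus_fword_def)
qed

lemmas free_algebra_closed = free_algebra_zero free_algebra_scal free_algebra_one free_algebra_gen
  free_algebra_add free_algebra_minus free_algebra_diff free_algebra_mult

lemma free_algebra_ring: "ring (free_algebra G :: ('a, 'k::comm_ring_1) falg ring)" (is "ring ?R")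
proof (rule ringI)
  show "abelian_group ?R"
  proof (rule abelian_groupI)
    fix x assume "x \<in> carrier ?R"
    then show "\<exists>y\<in>carrier ?R. y \<oplus>\<^bsub>?R\<^esub> x = \<zero>\<^bsub>?R\<^esub>"
      by (intro bexI[of _ "- x"]) (simp_all add: free_algebra_minus)
  qed (simp_all add: free_algebra_closed add_ac)
  show "Group.monoid ?R"
    by (rule monoidI) (simp_all add: free_algebra_closed mult.assoc)
qed (simp_all add: ring_distribs)

lemma scal_add: "scal (c + d) = scal c + scal d"
  by (simp add: scal_def single_add)

lemma scal_mult: "scal (c * d) = scal c * scal d"
  by (simp add: scal_def mult_single)

lemma scal_one: "scal 1 = 1"
  by (simp add: scal_def)

lemma scal_zero: "scal 0 = 0"
  by (simp add: scal_def)

lemma scal_minus: "scal (- c) = - scal c"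
  by (simp add: scal_def single_uminus)

lemma scal_central: "x * scal c = scal c * x"
proof (induction x rule: update_induct)
  case (update f a b)
  have "Poly_Mapping.update a b f = f + Poly_Mapping.single a b"
    using update.hyps
    by (intro poly_mapping_eqI) (auto simp: lookup_update lookup_add lookup_single in_keys_iff when_def)
  then show ?case
    using update.IH by (simp add: ring_distribs) (simp add: scal_def mult_single mult.commute)
qed simp

interpretation falg: vector_space "\<lambda>c x. scal c * x :: ('a, 'k::field) falg"
  by unfold_locales (simp_all add: scal_add scal_mult scal_one ring_distribs mult.assoc)

lemma uq_rels_carrier: "uq_rels n \<subseteq> carrier (free_algebra (uq_gens n))"
  unfolding uq_rels_def
  by (intro Un_least subsetI; elim CollectE exE conjE; hypsubst)
    (auto intro!: free_algebra_closed simp: uq_gens_def idxI_def idxY_def)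

locale verma =
  fixes n :: nat and L :: "(uq, 'l) module" and v :: 'l
  assumes is_L: "is_L_beta n L v"
begin

abbreviation "A \<equiv> carrier (free_algebra (uq_gens n) :: uq_free ring)"
abbreviation "I \<equiv> Idl\<^bsub>free_algebra (uq_gens n)\<^esub> uq_rels n"

lemma I_ideal: "ideal I (free_algebra (uq_gens n))"
  by (rule ring.genideal_ideal[OF free_algebra_ring uq_rels_carrier])

lemma Uq_ring: "ring (Uq n)"
  unfolding Uq_def by (rule ideal.quotient_is_ring[OF I_ideal])

lemma cls_hom: "cls n \<in> ring_hom (free_algebra (uq_gens n)) (Uq n)"
proof -
  have "cls n = (+>\<^bsub>free_algebra (uq_gens n)\<^esub>) I"
    by (auto simp: cls_def)
  then show ?thesis
    unfolding Uq_def using ideal.rcos_ring_hom[OF I_ideal] by simp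
qed

lemma cls_carrier: "x \<in> A \<Longrightarrow> cls n x \<in> carrier (Uq n)"
  by (rule ring_hom_closed[OF cls_hom])

lemma cls_add: "\<lbrakk>x \<in> A; y \<in> A\<rbrakk> \<Longrightarrow> cls n (x + y) = cls n x \<oplus>\<^bsub>Uq n\<^esub> cls n y"
  using ring_hom_add[OF cls_hom, of x y] by simp

lemma cls_mult: "\<lbrakk>x \<in> A; y \<in> A\<rbrakk> \<Longrightarrow> cls n (x * y) = cls n x \<otimes>\<^bsub>Uq n\<^esub> cls n y"
  using ring_hom_mult[OF cls_hom, of x y] by simp

lemma carrier_Uq: "carrier (Uq n) = cls n ` A"
  by (auto simp: Uq_def FactRing_def A_RCOSETS_def' cls_def)

lemma cls_rel: "r \<in> uq_rels n \<Longrightarrow> cls n r = \<zero>\<^bsub>Uq n\<^esub>"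
proof -
  assume r: "r \<in> uq_rels n"
  interpret ideal I "free_algebra (uq_gens n)"
    by (fact I_ideal)
  have "r \<in> I"
    using r ring.genideal_self[OF free_algebra_ring uq_rels_carrier] by blast
  then show ?thesis
    unfolding cls_def Uq_def FactRing_def by (simp add: a_rcos_const)
qed

lemma L_module: "left_module (Up n) L"
  using is_L by (simp add: is_L_beta_def)

lemma Up_simps [simp]: "carrier (Up n) = Up_carrier n" "\<one>\<^bsub>Up n\<^esub> = \<one>\<^bsub>Uq n\<^esub>"
  by (simp_all add: Up_def)

lemma Up_carrier_gens:
  "uscal n c \<in> Up_carrier n"
  "i \<in> idxI n \<Longrightarrow> cls n (gE i) \<in> Up_carrier n"
  "\<lbrakk>i \<in> idxI n; i \<noteq> 0\<rbrakk> \<Longrightarrow> cls n (gF i) \<in> Up_carrier n"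
  "\<gamma> \<in> idxY n \<Longrightarrow> cls n (gK \<gamma>) \<in> Up_carrier n"
  unfolding Up_carrier_def by (rule generate_ring.incl; simp)+

lemma gens_A:
  "scal c \<in> A"
  "i \<in> idxI n \<Longrightarrow> gE i \<in> A" "i \<in> idxI n \<Longrightarrow> gF i \<in> A"
  "\<gamma> \<in> idxY n \<Longrightarrow> gK \<gamma> \<in> A" "\<gamma> \<in> idxY n \<Longrightarrow> gKinv \<gamma> \<in> A"
  by (auto intro!: free_algebra_closed simp: uq_gens_def)

lemmas A_closed = free_algebra_closed(1-3,5-8)[where G = "uq_gens n"] gens_A

lemma Up_sub: "Up_carrier n \<subseteq> carrier (Uq n)"
  unfolding Up_carrier_def
  by (rule ring.generate_ring_incl[OF Uq_ring])
    (auto simp: uscal_def intro!: cls_carrier A_closed)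

sublocale T: tensor "Uq n" "Up_carrier n" L
proof -
  interpret L: left_module "Up n" L
    by (fact L_module)
  show "tensor (Uq n) (Up_carrier n) L"
    unfolding tensor_def tensor_axioms_def
    using Uq_ring L.M.abelian_group_axioms Up_sub L.smult_closed by auto
qed

lemma v_L: "v \<in> carrier L"
  using is_L by (simp add: is_L_beta_def)

definition pre :: "uq_free \<Rightarrow> (uq \<times> 'l \<Rightarrow>\<^sub>0 int)" where
  "pre x = frag_of (cls n x, v)"

definition null :: "uq_free set" where
  "null = {x \<in> A. pre x \<in> T.N}"

lemma pre_G: "x \<in> A \<Longrightarrow> pre x \<in> carrier T.G"
  unfolding pre_def by (intro T.frag_of_G cls_carrier v_L)

lemma pre_add: "\<lbrakk>x \<in> A; y \<in> A\<rbrakk> \<Longrightarrow> pre (x + y) - pre x - pre y \<in> T.N"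
  unfolding pre_def cls_add by (intro T.N_rel_l cls_carrier v_L)

lemma act_pre: "\<lbrakk>a \<in> A; x \<in> A\<rbrakk> \<Longrightarrow> T.act (cls n a) (pre x) = pre (a * x)"
  by (simp add: pre_def cls_mult)

lemma null_A: "x \<in> null \<Longrightarrow> x \<in> A"
  by (simp add: null_def)

lemma null_zero: "0 \<in> null"
  using T.N_minus[OF pre_add[of 0 0]] by (simp add: null_def free_algebra_zero)

lemma null_add: "\<lbrakk>x \<in> null; y \<in> null\<rbrakk> \<Longrightarrow> x + y \<in> null"
  using T.N_add[OF pre_add[of x y] T.N_add[of "pre x" "pre y"]]
  by (simp add: null_def free_algebra_add)

lemma null_mult: "\<lbrakk>a \<in> A; x \<in> null\<rbrakk> \<Longrightarrow> a * x \<in> null"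
  using T.act_N[OF cls_carrier[of a], of "pre x"] by (simp add: null_def act_pre free_algebra_mult)

lemma null_minus: "x \<in> null \<Longrightarrow> - x \<in> null"
  using null_mult[of "scal (- 1)" x] by (simp add: A_closed scal_minus scal_one)

lemma null_diff: "\<lbrakk>x \<in> null; y \<in> null\<rbrakk> \<Longrightarrow> x - y \<in> null"
  using null_add[of x "- y"] null_minus by simp

lemma null_iff: "\<lbrakk>x \<in> A; y \<in> A\<rbrakk> \<Longrightarrow> pre x - pre y \<in> T.N \<longleftrightarrow> x - y \<in> null"
proof -
  assume xy: "x \<in> A" "y \<in> A"
  have *: "pre x - pre (x - y) - pre y \<in> T.N"
    using pre_add[of "x - y" y] xy by (simp add: A_closed)
  show ?thesis
    using T.N_diff[OF _ *, of "pre x - pre y"] T.N_add[OF *, of "pre (x - y)"] xy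
    by (auto simp: null_def A_closed algebra_simps)
qed

lemma null_rel: "\<lbrakk>r \<in> uq_rels n; x \<in> A\<rbrakk> \<Longrightarrow> r * x \<in> null"
proof -
  assume r: "r \<in> uq_rels n" and x: "x \<in> A"
  interpret U: ring "Uq n"
    by (fact Uq_ring)
  have "r \<in> A"
    using r uq_rels_carrier by blast
  then show ?thesis
    using x T.N_zero_l[OF v_L]
    by (simp add: null_def pre_def A_closed cls_mult cls_rel[OF r] cls_carrier)
qed

lemma null_act:
  assumes "s \<in> A" "cls n s \<in> Up_carrier n" "t \<in> A" "cls n t \<in> Up_carrier n"
    and "cls n s \<odot>\<^bsub>L\<^esub> v = cls n t \<odot>\<^bsub>L\<^esub> v"
  shows "s - t \<in> null"
proof -
  interpret U: ring "Uq n"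
    by (fact Uq_ring)
  have "pre s - frag_of (\<one>\<^bsub>Uq n\<^esub>, cls n s \<odot>\<^bsub>L\<^esub> v) \<in> T.N" "pre t - frag_of (\<one>\<^bsub>Uq n\<^esub>, cls n t \<odot>\<^bsub>L\<^esub> v) \<in> T.N"
    using T.N_rel_s[of "\<one>\<^bsub>Uq n\<^esub>" "cls n s" v] T.N_rel_s[of "\<one>\<^bsub>Uq n\<^esub>" "cls n t" v] assms v_L
    by (simp_all add: pre_def cls_carrier)
  from T.N_diff[OF this] show ?thesis
    using assms by (simp add: null_iff[symmetric])
qed

lemma null_act_zero:
  assumes "s \<in> A" "cls n s \<in> Up_carrier n" "cls n s \<odot>\<^bsub>L\<^esub> v = \<zero>\<^bsub>L\<^esub>"
  shows "s \<in> null"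
proof -
  interpret U: ring "Uq n"
    by (fact Uq_ring)
  have "pre s - frag_of (\<one>\<^bsub>Uq n\<^esub>, \<zero>\<^bsub>L\<^esub>) \<in> T.N"
    using T.N_rel_s[of "\<one>\<^bsub>Uq n\<^esub>" "cls n s" v] assms v_L by (simp add: pre_def cls_carrier)
  then show ?thesis
    using T.N_add[OF _ T.N_zero_r[of "\<one>\<^bsub>Uq n\<^esub>"], of "pre s - frag_of (\<one>\<^bsub>Uq n\<^esub>, \<zero>\<^bsub>L\<^esub>)"] assms
    by (simp add: null_def)
qed

lemma null_E: "i \<in> idxI n \<Longrightarrow> gE i \<in> null"
  using is_L by (intro null_act_zero) (auto simp: is_L_beta_def Up_carrier_gens gens_A)

lemma null_F: "\<lbrakk>i \<in> idxI n; i \<noteq> 0\<rbrakk> \<Longrightarrow> gF i \<in> null"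
  using is_L by (intro null_act_zero) (auto simp: is_L_beta_def Up_carrier_gens gens_A)

lemma null_K: "\<gamma> \<in> idxY n \<Longrightarrow> gK \<gamma> - scal (top_weight \<gamma>) \<in> null"
  using is_L by (intro null_act) (auto simp: is_L_beta_def Up_carrier_gens(4) gens_A
      Up_carrier_gens(1)[unfolded uscal_def] uscal_def)

text \<open>The cyclic vector map: Mp is A modulo the left ideal \<open>null\<close>.\<close>

definition cyc :: "uq_free \<Rightarrow> (uq \<times> 'l \<Rightarrow>\<^sub>0 int) set" where
  "cyc x = T.q (pre x)"

lemma cyc_eq: "\<lbrakk>x \<in> A; y \<in> A\<rbrakk> \<Longrightarrow> cyc x = cyc y \<longleftrightarrow> x - y \<in> null"
  unfolding cyc_def by (simp only: T.q_eq pre_G null_iff)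

lemma cyc_add: "\<lbrakk>x \<in> A; y \<in> A\<rbrakk> \<Longrightarrow> cyc x \<oplus>\<^bsub>Mp n L\<^esub> cyc y = cyc (x + y)"
proof -
  assume xy: "x \<in> A" "y \<in> A"
  have "cyc x \<oplus>\<^bsub>Mp n L\<^esub> cyc y = T.q (pre x + pre y)"
    unfolding cyc_def Mp_def by (rule T.add_M) (use xy in \<open>auto intro: pre_G simp del: T.G_simps\<close>)
  also have "\<dots> = cyc (x + y)"
    unfolding cyc_def using T.N_minus[OF pre_add[OF xy]] xy
    by (subst T.q_eq) (auto intro: T.G_add pre_G A_closed simp del: T.G_simps simp: algebra_simps)
  finally show ?thesis .
qed

lemma cyc_act: "\<lbrakk>a \<in> A; x \<in> A\<rbrakk> \<Longrightarrow> cls n a \<odot>\<^bsub>Mp n L\<^esub> cyc x = cyc (a * x)"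
  unfolding cyc_def Mp_def by (simp only: T.smult_M cls_carrier pre_G act_pre)

lemma carrier_Mp: "carrier (Mp n L) = cyc ` A"
proof -
  interpret U: ring "Uq n"
    by (fact Uq_ring)
  have cyc_diff: "T.q (c - d) \<in> cyc ` A" if cd: "c \<in> carrier T.G" "d \<in> carrier T.G" "T.q c \<in> cyc ` A" "T.q d \<in> cyc ` A" for c d
  proof -
    obtain x y where xy: "x \<in> A" "y \<in> A" "T.q c = T.q (pre x)" "T.q d = T.q (pre y)"
      using cd(3,4) unfolding cyc_def by blast
    then have "c - pre x \<in> T.N" "d - pre y \<in> T.N"
      using that pre_G by (auto simp: T.q_eq simp del: T.G_simps)
    moreover have "pre x - pre (x - y) - pre y \<in> T.N"
      using pre_add[of "x - y" y] xy by (simp add: A_closed)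
    ultimately have "c - pre x - (d - pre y) + (pre x - pre (x - y) - pre y) \<in> T.N"
      by (rule T.N_add[OF T.N_diff])
    then have "T.q (c - d) = cyc (x - y)"
      unfolding cyc_def using that xy
      by (subst T.q_eq) (auto intro: T.G_diff pre_G A_closed simp del: T.G_simps simp: algebra_simps)
    then show ?thesis using xy A_closed by blast
  qed
  have "T.q c \<in> cyc ` A" if "c \<in> carrier T.G" for c
  proof -
    have "Poly_Mapping.keys c \<subseteq> carrier (Uq n) \<times> carrier L"
      using that by simp
    then have "c \<in> carrier T.G \<and> T.q c \<in> cyc ` A"
    proof (induction c rule: frag_induction)
      case zero
      have "T.q 0 = cyc 0"
        unfolding cyc_def using null_zero T.N_minus[of "pre 0"]
        by (subst T.q_eq) (auto simp: null_def pre_G simp del: T.G_simps intro: subgroup.one_closed[OF T.N_subgroup] T.N_G T.N_zero)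
      then show ?case using A_closed(1) by auto
    next
      case (one z)
      then obtain x l where z: "z = (cls n x, l)" "x \<in> A" "l \<in> carrier L"
        by (cases z) (auto simp: carrier_Uq)
      then obtain c where l: "l = uscal n c \<odot>\<^bsub>L\<^esub> v"
        using is_L by (auto simp: is_L_beta_def)
      have "pre (x * scal c) - frag_of z \<in> T.N"
        using T.N_rel_s[of "cls n x" "uscal n c" v] z l v_L Up_carrier_gens(1)
        by (simp add: pre_def cls_mult A_closed cls_carrier uscal_def)
      then have "T.q (frag_of z) = cyc (x * scal c)"
        unfolding cyc_def using z T.N_minus[of "pre (x * scal c) - frag_of z"]
        by (subst T.q_eq) (auto simp: cls_carrier simp del: T.G_simps intro!: T.frag_of_G pre_G A_closed)
      moreover have "x * scal c \<in> A"
        using z by (intro A_closed)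
      moreover have "frag_of z \<in> carrier T.G"
        unfolding z(1) using z by (intro T.frag_of_G cls_carrier)
      ultimately show ?case by blast
    next
      case (diff c d)
      then show ?case using cyc_diff[of c d] T.G_diff[of c d] by blast
    qed
    then show ?thesis ..
  qed
  moreover have "cyc x \<in> T.q ` carrier T.G" if "x \<in> A" for x
    using pre_G[OF that] by (auto simp: cyc_def simp del: T.G_simps)
  ultimately show ?thesis
    unfolding Mp_def T.carrier_M by blast
qed

end

section \<open>Evaluation of closed braids\<close>

context qgl_module
begin

lemma wt_zero_is_top:
  assumes "wt \<mu> x" "\<And>\<gamma>. \<mu> \<gamma> = 0"
  shows "\<exists>c. x = c *s v"
proof -
  define d where "d \<mu> = (\<Sum>\<gamma>\<in>{- int n<..int n}. \<gamma> * \<mu> \<gamma>)" for \<mu> :: "int \<Rightarrow> int"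
  have d: "d (sub_root \<mu> i) = d \<mu> + 1" if i: "\<bar>i\<bar> < int n" for \<mu> i
  proof -
    have "d \<mu> - d (sub_root \<mu> i) = (\<Sum>\<gamma>\<in>{- int n<..int n}. \<gamma> * alpha i \<gamma>)"
      by (simp add: d_def sub_root_def sum_subtractf[symmetric] algebra_simps)
    also have "\<dots> = (\<Sum>\<gamma>\<in>{i, i + 1}. \<gamma> * alpha i \<gamma>)"
      using i by (intro sum.mono_neutral_right) (auto simp: alpha_def)
    also have "\<dots> = -1"
      by (simp add: alpha_def)
    finally show ?thesis by simp
  qed
  have "(d \<mu> < 0 \<longrightarrow> x = 0) \<and> (d \<mu> = 0 \<longrightarrow> (\<exists>c. x = c *s v))"
    using assms(1)
  proof (induction rule: wt.induct)
    case wt_v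
    then show ?case by (auto simp: d_def intro: exI[of _ 1])
  next
    case (wt_F \<mu> x i)
    then show ?case by (auto simp: d F_lin intro: exI[of _ 0])
  next
    case (wt_add \<mu> x y)
    then show ?case by (metis add_0 scale_left_distrib)
  next
    case (wt_scale \<mu> x c)
    then show ?case by (metis scale_scale scale_zero_right)
  next
    case (wt_zero \<mu>)
    then show ?case by (auto intro: exI[of _ 0])
  qed
  moreover have "d \<mu> = 0"
    using assms(2) by (simp add: d_def)
  ultimately show ?thesis by blast
qed

lemma wt_supp: "wt \<mu> x \<Longrightarrow> x = 0 \<or> (\<forall>\<gamma>. \<mu> \<gamma> \<noteq> 0 \<longrightarrow> - int n < \<gamma> \<and> \<gamma> \<le> int n)"
proof (induction rule: wt.induct)
  case (wt_F \<mu> x i)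
  show ?case
  proof (cases "x = 0")
    case False
    then have "\<mu> \<gamma> = 0" if "\<not> (- int n < \<gamma> \<and> \<gamma> \<le> int n)" for \<gamma>
      using wt_F.IH that by blast
    moreover have "alpha i \<gamma> = 0" if "\<not> (- int n < \<gamma> \<and> \<gamma> \<le> int n)" for \<gamma>
      using wt_F.hyps that by (auto simp: alpha_def)
    ultimately show ?thesis
      by (metis sub_root_def diff_zero)
  qed (simp add: F_zero)
qed auto

lemma K_zero: "K \<gamma> 0 = 0"
  using K_scale[of \<gamma> 0 x] by simp

lemma K_sum: "finite W \<Longrightarrow> K \<gamma> (\<Sum>\<mu>\<in>W. f \<mu>) = (\<Sum>\<mu>\<in>W. K \<gamma> (f \<mu>))"
  by (induction W rule: finite_induct) (simp_all add: K_zero K_add)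

lemma highest_weight_unique_aux:
  assumes "finite W" and q_free: "\<And>k :: int. k \<noteq> 0 \<Longrightarrow> q powi k \<noteq> 1"
    and "x = c *s v + (\<Sum>\<mu>\<in>W. f \<mu>)"
    and "\<And>\<mu>. \<mu> \<in> W \<Longrightarrow> wt \<mu> (f \<mu>)" "\<And>\<mu>. \<mu> \<in> W \<Longrightarrow> \<exists>\<gamma>. - int n < \<gamma> \<and> \<gamma> \<le> int n \<and> \<mu> \<gamma> \<noteq> 0"
    and "\<And>\<gamma>. \<lbrakk>- int n < \<gamma>; \<gamma> \<le> int n\<rbrakk> \<Longrightarrow> K \<gamma> x = top \<gamma> *s x"
  shows "\<exists>c. x = c *s v"
  using assms(1,3-6)
proof (induction W arbitrary: c f rule: finite_induct)
  case empty
  then show ?case by auto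
next
  case (insert \<mu> W)
  obtain \<gamma> where \<gamma>: "- int n < \<gamma>" "\<gamma> \<le> int n" "\<mu> \<gamma> \<noteq> 0"
    using insert.prems(3) by blast
  define a where "a = top \<gamma> * q powi \<mu> \<gamma>"
  define b where "b = top \<gamma> - a"
  have "b \<noteq> 0"
    using q_free[OF \<gamma>(3)] l_nz by (auto simp: a_def b_def)
  define f' where "f' \<nu> = ((1 / b) * (top \<gamma> * q powi \<nu> \<gamma> - a)) *s f \<nu>" for \<nu>
  have Kf: "K \<gamma> (f \<nu>) = (top \<gamma> * q powi \<nu> \<gamma>) *s f \<nu>" if "\<nu> \<in> insert \<mu> W" for \<nu>
    using insert.prems(2)[OF that] \<gamma> by (intro K_wt)
  have x: "x = c *s v + f \<mu> + (\<Sum>\<nu>\<in>W. f \<nu>)"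
    using insert by (simp add: add.assoc)
  have "K \<gamma> x = (c * top \<gamma>) *s v + a *s f \<mu> + (\<Sum>\<nu>\<in>W. (top \<gamma> * q powi \<nu> \<gamma>) *s f \<nu>)"
    using \<gamma> insert.hyps Kf by (simp only: x K_add K_scale K_v K_sum scale_scale a_def insertI1 insertI2 cong: sum.cong)
  moreover have "a *s x = (c * a) *s v + a *s f \<mu> + (\<Sum>\<nu>\<in>W. a *s f \<nu>)"
    by (simp add: x scale_right_distrib scale_sum_right mult.commute)
  moreover have "K \<gamma> x = top \<gamma> *s x"
    using insert.prems(4) \<gamma> by blast
  ultimately have "b *s x = (c * b) *s v + (\<Sum>\<nu>\<in>W. (top \<gamma> * q powi \<nu> \<gamma> - a) *s f \<nu>)"
    by (simp add: b_def scale_left_diff_distrib right_diff_distrib sum_subtractf)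
  then have "(1 / b) *s b *s x = (1 / b) *s ((c * b) *s v + (\<Sum>\<nu>\<in>W. (top \<gamma> * q powi \<nu> \<gamma> - a) *s f \<nu>))"
    by simp
  then have "x = c *s v + (\<Sum>\<nu>\<in>W. f' \<nu>)"
    using \<open>b \<noteq> 0\<close> by (simp add: scale_right_distrib scale_sum_right f'_def)
  then show ?case
    by (rule insert.IH) (use insert.prems f'_def in \<open>auto intro: wt_scale\<close>)
qed

lemma wt_sum: "\<lbrakk>finite B; \<And>a. a \<in> B \<Longrightarrow> wt \<mu> (g a)\<rbrakk> \<Longrightarrow> wt \<mu> (sum g B)"
  by (induction B rule: finite_induct) (auto intro: wt_zero wt_add)

lemma highest_weight_unique:
  assumes x: "x \<in> span {y. \<exists>\<mu>. wt \<mu> y}"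
    and q_free: "\<And>k :: int. k \<noteq> 0 \<Longrightarrow> q powi k \<noteq> 1"
    and K: "\<And>\<gamma>. \<lbrakk>- int n < \<gamma>; \<gamma> \<le> int n\<rbrakk> \<Longrightarrow> K \<gamma> x = top \<gamma> *s x"
  shows "\<exists>c. x = c *s v"
proof -
  obtain t r where t: "finite t" "t \<subseteq> {y. \<exists>\<mu>. wt \<mu> y}" "x = (\<Sum>a\<in>t. r a *s a)"
    using x unfolding span_explicit by blast
  define m where "m y = (if y = 0 then (\<lambda>_. 0) else (SOME \<mu>. wt \<mu> y))" for y
  have m: "wt (m y) y" if "y \<in> t" for y
  proof (cases "y = 0")
    case False
    have "\<exists>\<mu>. wt \<mu> y" using that t(2) by blast
    then have "wt (SOME \<mu>. wt \<mu> y) y" by (rule someI_ex)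
    then show ?thesis using False by (simp add: m_def)
  qed (simp add: m_def wt_zero)
  have m_supp: "- int n < \<gamma> \<and> \<gamma> \<le> int n" if "y \<in> t" "m y \<gamma> \<noteq> 0" for y \<gamma>
    using wt_supp[OF m[OF that(1)]] that(2) by (auto simp: m_def split: if_splits)
  define f where "f \<mu> = (\<Sum>a\<in>{a \<in> t. m a = \<mu>}. r a *s a)" for \<mu>
  have f: "wt \<mu> (f \<mu>)" for \<mu>
    unfolding f_def using t(1) m by (intro wt_sum wt_scale) auto
  obtain c where c: "f (\<lambda>_. 0) = c *s v"
    using wt_zero_is_top[OF f, of "\<lambda>_. 0"] by auto
  let ?W = "m ` t - {\<lambda>_. 0}"
  have "x = (\<Sum>\<mu>\<in>m ` t. f \<mu>)"
    unfolding t(3) f_def by (rule sum.image_gen[OF t(1)])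
  also have "\<dots> = (\<Sum>\<mu>\<in>insert (\<lambda>_. 0) (m ` t). f \<mu>)"
    by (rule sum.mono_neutral_left) (use t(1) in \<open>auto simp: f_def intro!: sum.neutral\<close>)
  also have "\<dots> = c *s v + (\<Sum>\<mu>\<in>?W. f \<mu>)"
    using t(1) by (simp add: sum.insert_remove c)
  finally have x_eq: "x = c *s v + (\<Sum>\<mu>\<in>?W. f \<mu>)" .
  show ?thesis
  proof (rule highest_weight_unique_aux[OF _ _ x_eq])
    fix \<mu> assume "\<mu> \<in> ?W"
    then obtain y \<gamma> where "y \<in> t" "\<mu> = m y" "\<mu> \<gamma> \<noteq> 0"
      by (auto simp: fun_eq_iff)
    then show "\<exists>\<gamma>. - int n < \<gamma> \<and> \<gamma> \<le> int n \<and> \<mu> \<gamma> \<noteq> 0"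
      using m_supp by blast
  qed (use f K t(1) q_free in auto)
qed

end

lemma closure_op_framed:
  fixes scale :: "qfield \<Rightarrow> 'm::ab_group_add \<Rightarrow> 'm" and H :: "diagram \<Rightarrow> qfield"
  assumes "qgl_module scale qq n F v lam E K Kinv" and "homfly H"
    and "k < n" and "fst ` set b \<subseteq> {Suc k..<n}"
  shows "qgl_module.closure_op scale qq n F v E k b
    = scale (homfly.framed H (n - k) (map (\<lambda>(i, c). (i - k, c)) b)) v"
proof -
  interpret qgl_module scale qq n F v lam E K Kinv
    by (fact assms(1))
  interpret homfly H
    by (fact assms(2))
  define sh where "sh k = map (\<lambda>(i, c :: bool). (i - k :: nat, c))" for k
  have sh_simps [simp]: "sh k [] = []" "sh k ((i, c) # b) = (i - k, c) # sh k b" "sh k (a @ b) = sh k a @ sh k b" for k i c a b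
    by (simp_all add: sh_def)
  have sh_Suc: "sh (Suc k) b = drop_strand (sh k b)" for k b
    by (auto simp: sh_def drop_strand_def)
  have sh_word: "is_braid_word (n - k) (sh k b)" if "fst ` set b \<subseteq> {Suc k..<n}" for k b
    using that by (fastforce simp: is_braid_word_def sh_def)
  define pos where "pos = map (\<lambda>i :: nat. (i, True))"
  have pos_simps [simp]: "pos [] = []" "pos (i # w) = (i, True) # pos w" "pos (w @ w') = pos w @ pos w'" for i w w'
    by (simp_all add: pos_def)
  have pos_set: "fst ` set (pos w) = set w" for w
    by (simp add: pos_def image_image)
  have "closure_op k b = scale (framed (n - k) (sh k b)) v"
    if "k < n" "fst ` set b \<subseteq> {Suc k..<n}"
    using that
  proof (induction "n - Suc k" arbitrary: k b)
    case 0
    then have k: "Suc k = n" "n - k = 1" and "b = []"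
      by auto
    then show ?case
      using closure_op_base[OF k(1)] framed_one by (simp add: qnum_def unknot_value_def)
  next
    case (Suc m)
    let ?J = "{Suc k..<n}"
    have k: "Suc k < n" and nk: "n - k = Suc (n - Suc k)" "n - Suc k \<ge> 1"
      using Suc.hyps(2) by auto
    define P where "P b \<longleftrightarrow> closure_op k b = scale (framed (n - k) (sh k b)) v" for b
    have letter: "i < n" if "fst ` set b \<subseteq> ?J" "(i, e) \<in> set b" for b i e
      using that by force
    have closed: "hecke_closed ?J (\<lambda>w. P (pos w))"
      unfolding hecke_closed_def
    proof (intro allI impI conjI ballI)
      fix a b assume ab: "set a \<subseteq> ?J" "set b \<subseteq> ?J"
      have b: "(i, e) \<in> set (pos b) \<Longrightarrow> i < n" for i e
        using letter[of "pos b"] ab by (simp add: pos_set)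
      have w: "is_braid_word (n - k) (sh k (pos w))" if "set w \<subseteq> ?J" for w
        by (rule sh_word) (use that in \<open>simp add: pos_set\<close>)
      fix i assume i: "i \<in> ?J"
      have i': "k < i" "i < n" "i - k = i - k"
        using i by auto
      show "P (pos (a @ i # i # b))" if "P (pos (a @ b))" "P (pos (a @ i # b))"
      proof -
        have "framed (n - k) (sh k (pos (a @ i # i # b)))
            = framed (n - k) (sh k (pos (a @ b))) + (1 / qq - qq) * framed (n - k) (sh k (pos (a @ i # b)))"
          using framed_sq[of "n - k" "sh k (pos a)" "i - k" "sh k (pos b)"] w[of "a @ i # b"] ab i by simp
        moreover have "closure_op k (pos (a @ i # i # b))
            = closure_op k (pos (a @ b)) + scale (1 / qq - qq) (closure_op k (pos (a @ i # b)))"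
          using closure_op_sq[of k i "pos b" "pos a", OF i'(1,2) b] by simp
        ultimately show ?thesis
          using that unfolding P_def by (simp only: scale_left_distrib scale_scale)
      qed
      show "P (pos (a @ i # j # b)) = P (pos (a @ j # i # b))" if j: "j \<in> ?J" "Suc i < j" for j
      proof -
        have "framed (n - k) (sh k (pos (a @ i # j # b))) = framed (n - k) (sh k (pos (a @ j # i # b)))"
          using framed_far[of "n - k" "sh k (pos a)" "i - k" "j - k" "sh k (pos b)"] w[of "a @ i # j # b"] ab i j
          by (simp add: Suc_diff_le[symmetric] diff_less_mono)
        moreover have "closure_op k (pos (a @ i # j # b)) = closure_op k (pos (a @ j # i # b))"
          using closure_op_comm[of i j k "pos a" "pos b"] i j by simp
        ultimately show ?thesis
          by (simp only: P_def)
      qed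
      show "P (pos (a @ i # Suc i # i # b))" if j: "Suc i \<in> ?J" "P (pos (a @ Suc i # i # Suc i # b))"
      proof -
        have "framed (n - k) (sh k (pos (a @ i # Suc i # i # b))) = framed (n - k) (sh k (pos (a @ Suc i # i # Suc i # b)))"
          using framed_braid[of "n - k" "sh k (pos a)" "i - k" "sh k (pos b)"] w[of "a @ i # Suc i # b"] ab i j
          by (simp add: Suc_diff_le)
        moreover have "closure_op k (pos (a @ i # Suc i # i # b)) = closure_op k (pos (a @ Suc i # i # Suc i # b))"
          using closure_op_braid[of k i "pos b" "pos a", OF i'(1) _ b] j by simp
        ultimately show ?thesis
          using j(2) by (simp only: P_def)
      qed
    qed
    have far: "(i, e) \<in> set (pos w) \<Longrightarrow> i < n \<and> Suc k < i" if "set w \<subseteq> ?J" "Suc k \<notin> set w" for w i e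
    proof -
      assume "(i, e) \<in> set (pos w)"
      then have "i \<in> set w" by (auto simp: pos_def)
      then show ?thesis
        using that by (metis atLeastLessThan_iff le_neq_implies_less subsetD)
    qed
    have far': "\<forall>(i, c) \<in> set (sh k (pos w)). 2 \<le> i" if "set w \<subseteq> ?J" "Suc k \<notin> set w" for w
      using far[OF that] by (fastforce simp: sh_def)
    have IH: "closure_op (Suc k) (pos w) = scale (framed (n - Suc k) (drop_strand (sh k (pos w)))) v"
      if "set w \<subseteq> ?J" "Suc k \<notin> set w" for w
      unfolding sh_Suc[symmetric]
      by (rule Suc.hyps(1)) (use Suc.hyps(2) far[OF that] in \<open>fastforce simp: Suc_le_eq\<close>)+
    have base: "P (pos w)" if w: "set w \<subseteq> ?J" "count_list w (Suc k) \<le> 1" for w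
    proof (cases "Suc k \<in> set w")
      case False
      have "framed (n - k) (sh k (pos w)) = unknot_value * framed (n - Suc k) (drop_strand (sh k (pos w)))"
        unfolding nk(1) by (rule framed_split_unknot[OF nk(2)])
          (use sh_word[of "pos w" k] far' w False nk(1) in \<open>auto simp: pos_set\<close>)
      then show ?thesis
        using closure_op_unknot[OF k far[OF w(1) False]] IH[OF w(1) False]
        by (simp add: P_def qnum_def unknot_value_def)
    next
      case True
      then obtain a b where ab: "w = a @ Suc k # b" "Suc k \<notin> set a"
        by (meson split_list_first)
      then have "Suc k \<notin> set b"
        using w count_list_0_iff[of b "Suc k"] by simp
      then have s: "set a \<subseteq> ?J" "set b \<subseteq> ?J" "set (a @ b) \<subseteq> ?J" "Suc k \<notin> set (a @ b)"
        using w ab by auto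
      have "is_braid_word (n - k) (sh k (pos (a @ b)))"
        by (rule sh_word) (use s(3) in \<open>simp only: pos_set\<close>)
      then have "framed (n - k) (sh k (pos w)) = (1 / lam) * framed (n - Suc k) (drop_strand (sh k (pos (a @ b))))"
        using framed_markov[OF nk(2), of "sh k (pos a)" "sh k (pos b)"] far'[OF s(3,4)] nk(1)
        by (simp add: ab del: set_append)
      moreover have "closure_op k (pos w) = scale (1 / lam) (closure_op (Suc k) (pos (a @ b)))"
        using closure_op_kink[OF k far[OF s(1) ab(2)] far[OF s(2) \<open>Suc k \<notin> set b\<close>]] by (simp add: ab)
      ultimately show ?thesis
        using IH[OF s(3,4)] by (simp add: P_def)
    qed
    have "P (pos w)" if "set w \<subseteq> ?J" for w
      using hecke_closed_induct[OF closed order_refl base that] .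
    then have "P b"
    proof (rule signed_word_induct[where J = ?J, folded pos_def])
      fix a i b
      assume *: "fst ` set a \<subseteq> ?J" "i \<in> ?J" "fst ` set b \<subseteq> ?J" "P (a @ (i, True) # b)" "P (a @ b)"
      have word: "is_braid_word (n - k) (sh k (a @ (i, True) # b))"
        by (rule sh_word) (use * in auto)
      have "framed (n - k) (sh k (a @ (i, False) # b))
          = framed (n - k) (sh k (a @ (i, True) # b)) - (1 / qq - qq) * framed (n - k) (sh k (a @ b))"
        using framed_skein[of "n - k" "sh k a" "i - k" "sh k b"] word by simp
      moreover have "closure_op k (a @ (i, False) # b)
          = closure_op k (a @ (i, True) # b) - scale (1 / qq - qq) (closure_op k (a @ b))"
        using * letter[OF *(3)] by (intro closure_op_skein) auto
      ultimately show "P (a @ (i, False) # b)"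
        using *(4,5) unfolding P_def by (simp only: scale_left_diff_distrib scale_scale)
    qed (use Suc.prems in auto)
    then show ?case by (simp add: P_def)
  qed
  then show ?thesis
    using assms(3,4) unfolding sh_def by blast
qed

section \<open>The parabolic Verma module\<close>

interpretation falg_pair: vector_space_pair "\<lambda>c x. scal c * x :: ('a, 'k::field) falg"
    "\<lambda>c x. scal c * x :: ('a, 'k::field) falg"
  by unfold_locales

lemma falg_projection:
  fixes V :: "('a, 'k::field) falg set"
  assumes "falg.subspace V"
  obtains g where "\<And>x y. g (x + y) = g x + g y" "\<And>c x. g (scal c * x) = scal c * g x"
    "\<And>x. g x \<in> V" "\<And>x. x \<in> V \<Longrightarrow> g x = x"
proof -
  have "Vector_Spaces.linear (\<lambda>c x. scal c * x) (\<lambda>c x. scal c * x) (\<lambda>x :: ('a, 'k) falg. x)"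
    by (rule falg.linear_ident)
  then obtain g where g: "g ` UNIV \<subseteq> V" "Vector_Spaces.linear (\<lambda>c x. scal c * x) (\<lambda>c x. scal c * x) g"
      "\<forall>x\<in>V. g x = x"
    using falg_pair.linear_exists_left_inverse_on[of "\<lambda>x. x" V] assms by auto
  interpret g: Vector_Spaces.linear "\<lambda>c x. scal c * x" "\<lambda>c x. scal c * x" g
    by (fact g(2))
  show thesis
    by (rule that[of g]) (use g g.add g.scale in auto)
qed

context verma
begin

lemma subspace_A: "falg.subspace A"
  by (rule falg.subspaceI) (auto intro: A_closed)

lemma subspace_null: "falg.subspace null"
  by (rule falg.subspaceI) (auto intro: null_zero null_add null_mult A_closed)

text \<open>
  A linear projection with kernel \<open>null\<close> on A realises the quotient module Mp inside the
  type of the free algebra.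
\<close>

definition is_proj :: "(uq_free \<Rightarrow> uq_free) \<Rightarrow> bool" where
  "is_proj p \<longleftrightarrow> (\<forall>x y. p (x + y) = p x + p y) \<and> (\<forall>c x. p (scal c * x) = scal c * p x) \<and>
     (\<forall>x. p x \<in> A) \<and> (\<forall>x\<in>A. p x - x \<in> null) \<and> (\<forall>x\<in>null. p x = 0) \<and> (\<forall>x. p (p x) = p x)"

definition proj :: "uq_free \<Rightarrow> uq_free" where
  "proj = (SOME p. is_proj p)"

lemma is_proj: "is_proj proj"
proof -
  obtain g where g: "\<And>x y. g (x + y) = g x + g y" "\<And>c x. g (scal c * x) = scal c * g x"
    "\<And>x. g x \<in> A" "\<And>x. x \<in> A \<Longrightarrow> g x = x"
    by (rule falg_projection[OF subspace_A]) blast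
  obtain h where h: "\<And>x y. h (x + y) = h x + h y" "\<And>c x. h (scal c * x) = scal c * h x"
    "\<And>x. h x \<in> null" "\<And>x. x \<in> null \<Longrightarrow> h x = x"
    by (rule falg_projection[OF subspace_null]) blast
  have "is_proj (\<lambda>x. g x - h (g x))"
    unfolding is_proj_def
  proof (intro conjI allI ballI)
    fix x assume x: "x \<in> A"
    have "- h x \<in> null" by (rule null_minus[OF h(3)])
    then show "g x - h (g x) - x \<in> null" using g(4)[OF x] by simp
  next
    fix x assume "x \<in> null"
    then show "g x - h (g x) = 0" using g(4)[OF null_A] h(4) by simp
  next
    fix x
    have a: "g x - h (g x) \<in> A"
      by (intro free_algebra_diff g(3) null_A h(3))
    have "h (g x - h (g x)) + h (g x) = h (g x)"
      using h(1)[of "g x - h (g x)" "h (g x)"] h(4)[OF h(3)] by simp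
    then show "g (g x - h (g x)) - h (g (g x - h (g x))) = g x - h (g x)"
      using g(4)[OF a] by simp
  qed (simp_all add: g h algebra_simps free_algebra_diff null_A)
  then show ?thesis
    unfolding proj_def by (rule someI[of is_proj])
qed

lemma proj_add: "proj (x + y) = proj x + proj y"
  and proj_scal: "proj (scal c * x) = scal c * proj x"
  and proj_A: "proj x \<in> A"
  and proj_diff_null: "x \<in> A \<Longrightarrow> proj x - x \<in> null"
  and proj_null: "x \<in> null \<Longrightarrow> proj x = 0"
  and proj_proj: "proj (proj x) = proj x"
  using is_proj by (auto simp: is_proj_def)

lemma proj_minus: "proj (- x) = - proj x"
  using proj_scal[of "-1" x] by (simp add: scal_minus scal_one)

lemma proj_diff: "proj (x - y) = proj x - proj y"
  by (simp only: diff_conv_add_uminus proj_add proj_minus)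

lemma proj_zero: "proj 0 = 0"
  using proj_scal[of 0 0] by (simp add: scal_zero)

lemma proj_eq_iff: "\<lbrakk>x \<in> A; y \<in> A\<rbrakk> \<Longrightarrow> proj x = proj y \<longleftrightarrow> x - y \<in> null"
proof
  assume xy: "x \<in> A" "y \<in> A"
  assume "proj x = proj y"
  then have "(proj y - y) - (proj x - x) = x - y" by simp
  then show "x - y \<in> null"
    using null_diff[OF proj_diff_null[OF xy(2)] proj_diff_null[OF xy(1)]] by simp
next
  assume "x - y \<in> null"
  then show "proj x = proj y" using proj_null[of "x - y"] by (simp add: proj_diff)
qed

lemma proj_mult_proj: "\<lbrakk>a \<in> A; x \<in> A\<rbrakk> \<Longrightarrow> proj (a * proj x) = proj (a * x)"
  using null_mult[OF _ proj_diff_null[of x], of a]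
  by (subst proj_eq_iff) (simp_all add: right_diff_distrib free_algebra_mult proj_A)

definition op :: "uq_free \<Rightarrow> uq_free \<Rightarrow> uq_free" where
  "op a x = proj (a * proj x)"

lemma op_add: "op a (x + y) = op a x + op a y"
  by (simp add: op_def proj_add ring_distribs)

lemma op_scal: "op a (scal c * x) = scal c * op a x"
proof -
  have "a * (scal c * proj x) = scal c * (a * proj x)"
    by (metis scal_central mult.assoc)
  then show ?thesis by (simp add: op_def proj_scal)
qed

lemma op_proj: "\<lbrakk>a \<in> A; x \<in> A\<rbrakk> \<Longrightarrow> op a (proj x) = proj (a * x)"
  by (simp add: op_def proj_proj proj_mult_proj)

lemma op_op: "\<lbrakk>a \<in> A; b \<in> A\<rbrakk> \<Longrightarrow> op a (op b x) = proj (a * b * proj x)"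
  by (simp add: op_def proj_proj proj_mult_proj proj_A A_closed mult.assoc)

lemma op_op_op: "\<lbrakk>a \<in> A; b \<in> A; c \<in> A\<rbrakk> \<Longrightarrow> op a (op b (op c x)) = proj (a * b * c * proj x)"
  by (simp add: op_op A_closed) (simp add: op_def proj_proj proj_mult_proj proj_A A_closed mult.assoc)

lemma proj_rel: "r \<in> uq_rels n \<Longrightarrow> proj (r * proj x) = 0"
  by (intro proj_null null_rel proj_A)

abbreviation "opE i \<equiv> op (gE i)"
abbreviation "opF i \<equiv> op (gF i)"
abbreviation "opK \<gamma> \<equiv> op (gK \<gamma>)"
abbreviation "opKinv \<gamma> \<equiv> op (gKinv \<gamma>)"

lemma idxI_iff: "\<bar>i\<bar> < int n \<longleftrightarrow> i \<in> idxI n"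
  by (auto simp: idxI_def)

lemma idxY_iff: "- int n < \<gamma> \<and> \<gamma> \<le> int n \<longleftrightarrow> \<gamma> \<in> idxY n"
  by (auto simp: idxY_def)

lemma op_comm:
  assumes "X \<in> {gE, gF}" "i \<in> idxI n" "j \<in> idxI n" "\<bar>i - j\<bar> > 1"
  shows "op (X i) (op (X j) x) = op (X j) (op (X i) x)"
proof -
  have "X i \<in> A" "X j \<in> A" using assms A_closed by auto
  moreover have "X i * X j - X j * X i \<in> uq_rels n"
    unfolding uq_rels_def
    by (rule UnI1, rule UnI2, rule CollectI) (intro exI[of _ X] exI[of _ i] exI[of _ j] conjI refl assms)
  from proj_rel[OF this, of x] have "proj (X i * X j * proj x) = proj (X j * X i * proj x)"
    by (simp add: proj_diff ring_distribs)
  ultimately show ?thesis by (simp add: op_op)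
qed

lemma op_serre:
  assumes "X \<in> {gE, gF}" "i \<in> idxI n" "j \<in> idxI n" "\<bar>i - j\<bar> = 1"
  shows "op (X i) (op (X i) (op (X j) x)) + op (X j) (op (X i) (op (X i) x))
    = scal (qq + 1 / qq) * op (X i) (op (X j) (op (X i) x))"
proof -
  have "X i \<in> A" "X j \<in> A" using assms A_closed by auto
  moreover have "X i * X i * X j + X j * X i * X i - scal (qq + 1 / qq) * X i * X j * X i \<in> uq_rels n"
    unfolding uq_rels_def
    by (rule UnI2, rule CollectI) (intro exI[of _ X] exI[of _ i] exI[of _ j] conjI refl assms)
  from proj_rel[OF this, of x] have "proj (X i * X i * X j * proj x) + proj (X j * X i * X i * proj x)
      = scal (qq + 1 / qq) * proj (X i * X j * X i * proj x)"
    by (simp add: proj_diff proj_add ring_distribs mult.assoc flip: proj_scal)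
  ultimately show ?thesis by (simp add: op_op_op)
qed

lemma op_EF_neq:
  assumes "i \<in> idxI n" "j \<in> idxI n" "i \<noteq> j"
  shows "opE i (opF j x) = opF j (opE i x)"
proof -
  have "gE i * gF j - gF j * gE i \<in> uq_rels n"
    unfolding uq_rels_def
    by (rule UnI1, rule UnI1, rule UnI2, rule CollectI)
      (intro exI[of _ i] exI[of _ j] conjI refl assms)
  from proj_rel[OF this, of x] have "proj (gE i * gF j * proj x) = proj (gF j * gE i * proj x)"
    by (simp add: proj_diff ring_distribs)
  then show ?thesis using assms by (simp add: op_op A_closed)
qed

lemma op_EF_eq:
  assumes "i \<in> idxI n"
  shows "opE i (opF i x) - opF i (opE i x)
    = scal (1 / (qq - 1 / qq)) * (opK i (opKinv (i + 1) x) - opK (i + 1) (opKinv i x))"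
proof -
  have Y: "i \<in> idxY n" "i + 1 \<in> idxY n"
    using assms by (auto simp: idxI_def idxY_def)
  have "gE i * gF i - gF i * gE i
        - scal (1 / (qq - 1 / qq)) * (gK i * gKinv (i + 1) - gK (i + 1) * gKinv i) \<in> uq_rels n"
    unfolding uq_rels_def
    by (rule UnI1, rule UnI1, rule UnI1, rule UnI2, rule CollectI)
      (intro exI[of _ i] conjI refl assms)
  from proj_rel[OF this, of x] have "proj (gE i * gF i * proj x) - proj (gF i * gE i * proj x)
      = scal (1 / (qq - 1 / qq)) * (proj (gK i * gKinv (i + 1) * proj x) - proj (gK (i + 1) * gKinv i * proj x))"
    by (simp add: proj_diff ring_distribs mult.assoc flip: proj_scal)
  then show ?thesis using assms Y by (simp add: op_op A_closed)
qed

lemma op_KF: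
  assumes "i \<in> idxI n" "\<gamma> \<in> idxY n"
  shows "opK \<gamma> (opF i x) = scal (qq powi (- alpha i \<gamma>)) * opF i (opK \<gamma> x)"
proof -
  have "gK \<gamma> * gF i - scal (qq powi (- alpha i \<gamma>)) * gF i * gK \<gamma> \<in> uq_rels n"
    unfolding uq_rels_def
    by (rule UnI1, rule UnI1, rule UnI1, rule UnI1, rule UnI2, rule CollectI)
      (intro exI[of _ \<gamma>] exI[of _ i] conjI refl assms)
  from proj_rel[OF this, of x] have "proj (gK \<gamma> * gF i * proj x)
      = scal (qq powi (- alpha i \<gamma>)) * proj (gF i * gK \<gamma> * proj x)"
    by (simp add: proj_diff ring_distribs mult.assoc flip: proj_scal)
  then show ?thesis using assms by (simp add: op_op A_closed)
qed

lemma op_K_Kinv: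
  assumes "\<gamma> \<in> idxY n"
  shows "opK \<gamma> (opKinv \<gamma> x) = proj x" "opKinv \<gamma> (opK \<gamma> x) = proj x"
proof -
  have "gK \<gamma> * gKinv \<gamma> - 1 \<in> uq_rels n"
    unfolding uq_rels_def
    by (rule UnI1, rule UnI1, rule UnI1, rule UnI1, rule UnI1, rule UnI1, rule UnI1, rule UnI2, rule CollectI)
      (intro exI[of _ \<gamma>] conjI refl assms)
  moreover have "gKinv \<gamma> * gK \<gamma> - 1 \<in> uq_rels n"
    unfolding uq_rels_def
    by (rule UnI1, rule UnI1, rule UnI1, rule UnI1, rule UnI1, rule UnI1, rule UnI2, rule CollectI)
      (intro exI[of _ \<gamma>] conjI refl assms)
  ultimately have "proj ((gK \<gamma> * gKinv \<gamma> - 1) * proj x) = 0" "proj ((gKinv \<gamma> * gK \<gamma> - 1) * proj x) = 0"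
    by (simp_all add: proj_rel)
  then
  have "proj (gK \<gamma> * gKinv \<gamma> * proj x) = proj x" "proj (gKinv \<gamma> * gK \<gamma> * proj x) = proj x"
    by (simp_all add: proj_diff ring_distribs proj_proj)
  then show "opK \<gamma> (opKinv \<gamma> x) = proj x" "opKinv \<gamma> (opK \<gamma> x) = proj x"
    using assms by (simp_all add: op_op A_closed)
qed

lemma proj_op [simp]: "proj (op a x) = op a x"
  and op_proj_same: "op a (proj x) = op a x"
  by (simp_all add: op_def proj_proj)

lemma scal_cancel: "(c :: 'k::field) \<noteq> 0 \<Longrightarrow> scal c * x = y \<Longrightarrow> x = scal (1 / c) * y"
proof -
  assume "c \<noteq> 0" "scal c * x = y"
  moreover have "scal (1 / c) * (scal c * x) = scal (1 / c * c) * x"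
    by (simp only: scal_mult mult.assoc)
  ultimately show ?thesis by (simp add: scal_one)
qed

lemma op_KinvF:
  assumes "i \<in> idxI n" "\<gamma> \<in> idxY n"
  shows "opKinv \<gamma> (opF i x) = scal (qq powi alpha i \<gamma>) * opF i (opKinv \<gamma> x)"
proof -
  have "opF i (opKinv \<gamma> x) = opKinv \<gamma> (opK \<gamma> (opF i (opKinv \<gamma> x)))"
    by (simp add: op_K_Kinv assms)
  also have "\<dots> = scal (qq powi (- alpha i \<gamma>)) * opKinv \<gamma> (opF i x)"
    by (simp add: op_KF assms op_K_Kinv op_scal op_proj_same)
  finally show ?thesis
    using scal_cancel[of "qq powi (- alpha i \<gamma>)" "opKinv \<gamma> (opF i x)"] qq_nz
    by (simp add: power_int_minus divide_inverse)
qed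

definition vac :: uq_free where
  "vac = proj 1"

lemma op_vac: "a \<in> A \<Longrightarrow> op a vac = proj a"
  by (simp add: vac_def op_proj A_closed)

lemma proj_of_scal: "proj (scal c) = scal c * vac"
  using proj_scal[of c 1] by (simp add: vac_def)

lemma opK_vac: "\<gamma> \<in> idxY n \<Longrightarrow> opK \<gamma> vac = scal (top_weight \<gamma>) * vac"
  using proj_null[OF null_K, of \<gamma>] by (simp add: op_vac A_closed proj_diff proj_of_scal)

lemma opKinv_vac: "\<gamma> \<in> idxY n \<Longrightarrow> opKinv \<gamma> vac = scal (1 / top_weight \<gamma>) * vac"
proof -
  assume \<gamma>: "\<gamma> \<in> idxY n"
  have "scal (top_weight \<gamma>) * opKinv \<gamma> vac = opKinv \<gamma> (opK \<gamma> vac)"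
    using \<gamma> by (simp add: opK_vac op_scal)
  also have "\<dots> = vac"
    using \<gamma> by (simp add: op_K_Kinv vac_def proj_proj)
  finally show ?thesis
    using scal_cancel[of "top_weight \<gamma>" "opKinv \<gamma> vac"] lam_nz by (simp add: top_weight_def split: if_splits)
qed

sublocale Q: qgl_module "\<lambda>c x. scal c * x" qq n opF vac lam opE opK opKinv
proof unfold_locales
  show "qq \<noteq> 0" "qq + 1 / qq \<noteq> 0" "qq * qq \<noteq> 1" "lam \<noteq> 0"
    by (fact qq_nz qq_sum_nz qq_sq lam_nz)+
  show "\<lbrakk>\<bar>j\<bar> < int n; j \<noteq> 0\<rbrakk> \<Longrightarrow> opF j vac = 0" for j
    by (simp add: idxI_iff op_vac A_closed proj_null null_F)
  show "\<bar>j\<bar> < int n \<Longrightarrow> opE j vac = 0" for j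
    by (simp add: idxI_iff op_vac A_closed proj_null null_E)
  show "\<lbrakk>- int n < \<gamma>; \<gamma> \<le> int n\<rbrakk> \<Longrightarrow> opK \<gamma> vac = scal (if \<gamma> \<le> 0 then lam else 1) * vac" for \<gamma>
    using opK_vac[of \<gamma>] by (simp add: idxY_def top_weight_def)
  show "\<lbrakk>- int n < \<gamma>; \<gamma> \<le> int n\<rbrakk> \<Longrightarrow> opKinv \<gamma> vac = scal (1 / (if \<gamma> \<le> 0 then lam else 1)) * vac" for \<gamma>
    using opKinv_vac[of \<gamma>] by (simp add: idxY_def top_weight_def)
  show "\<lbrakk>\<bar>i\<bar> < int n; - int n < \<gamma>; \<gamma> \<le> int n\<rbrakk>
      \<Longrightarrow> opK \<gamma> (opF i x) = scal (qq powi (- alpha i \<gamma>)) * opF i (opK \<gamma> x)" for i \<gamma> x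
    by (intro op_KF) (auto simp: idxI_def idxY_def)
  show "\<lbrakk>\<bar>i\<bar> < int n; - int n < \<gamma>; \<gamma> \<le> int n\<rbrakk>
      \<Longrightarrow> opKinv \<gamma> (opF i x) = scal (qq powi alpha i \<gamma>) * opF i (opKinv \<gamma> x)" for i \<gamma> x
    by (intro op_KinvF) (auto simp: idxI_def idxY_def)
qed (auto simp: idxI_iff op_add op_scal op_EF_eq intro!: op_comm op_serre op_EF_neq)

lemma op_preserves_weights:
  assumes "g \<in> uq_gens n" "y \<in> falg.span {y. \<exists>\<mu>. Q.wt \<mu> y}"
  shows "op (gen g) y \<in> falg.span {y. \<exists>\<mu>. Q.wt \<mu> y}"
  using assms(2)
proof (induction rule: falg.span_induct_alt)
  case base
  then show ?case
    using op_scal[of "gen g" 0 0] by (simp add: scal_zero falg.span_zero)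
next
  case (step c x y)
  then obtain \<mu> where \<mu>: "Q.wt \<mu> x" by blast
  have "\<exists>\<mu>. Q.wt \<mu> (op (gen g) x)"
    using assms(1) unfolding uq_gens_def
  proof (elim UnE imageE)
    fix i assume "g = GE i" "i \<in> idxI n"
    then show ?thesis using Q.wt_E[OF \<mu>, of i] by (auto simp: idxI_iff)
  next
    fix i assume "g = GF i" "i \<in> idxI n"
    then show ?thesis using Q.wt_F[OF \<mu>, of i] by (auto simp: idxI_iff)
  next
    fix \<gamma> assume "g = GK \<gamma>" "\<gamma> \<in> idxY n"
    then show ?thesis using Q.K_wt[OF \<mu>, of \<gamma>] Q.wt_scale[OF \<mu>] by (metis idxY_iff)
  next
    fix \<gamma> assume "g = GKinv \<gamma>" "\<gamma> \<in> idxY n"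
    then show ?thesis using Q.Kinv_wt[OF \<mu>, of \<gamma>] Q.wt_scale[OF \<mu>] by (metis idxY_iff)
  qed
  then show ?case
    unfolding op_add op_scal
    by (intro falg.span_add falg.span_scale step.IH) (blast intro: falg.span_base)
qed

lemma single_FWord_Cons:
  "Poly_Mapping.single (FWord (g # ls)) c = gen g * Poly_Mapping.single (FWord ls) c"
  by (simp add: gen_def mult_single plus_fword_def)

lemma proj_weights: "x \<in> A \<Longrightarrow> proj x \<in> falg.span {y. \<exists>\<mu>. Q.wt \<mu> y}"
proof (induction x rule: update_induct)
  case const
  then show ?case by (simp add: proj_zero falg.span_zero)
next
  case (update f a b)
  have eq: "Poly_Mapping.update a b f = f + Poly_Mapping.single a b"
    using update.hyps
    by (intro poly_mapping_eqI) (auto simp: lookup_update lookup_add lookup_single in_keys_iff when_def)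
  have keys: "Poly_Mapping.keys (Poly_Mapping.update a b f) = insert a (Poly_Mapping.keys f)"
    using update.hyps by (simp add: keys_update)
  have f: "f \<in> A" and a: "set (letters a) \<subseteq> uq_gens n"
    using update.prems keys by (auto simp: free_algebra_iff)
  have "Poly_Mapping.single (FWord ls) b \<in> A \<and>
      proj (Poly_Mapping.single (FWord ls) b) \<in> falg.span {y. \<exists>\<mu>. Q.wt \<mu> y}"
    if "set ls \<subseteq> uq_gens n" for ls
    using that
  proof (induction ls)
    case Nil
    have "scal b * vac \<in> falg.span {y. \<exists>\<mu>. Q.wt \<mu> y}"
      using Q.wt_v by (intro falg.span_scale falg.span_base) blast
    moreover have "Poly_Mapping.single (FWord []) b = (scal b :: uq_free)"
      by (simp add: scal_def zero_fword_def)
    ultimately show ?case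
      using A_closed(2)[of b] by (simp add: proj_of_scal)
  next
    case (Cons g ls)
    then show ?case
      using op_preserves_weights[of g "proj (Poly_Mapping.single (FWord ls) b)"]
        op_proj[of "gen g" "Poly_Mapping.single (FWord ls) b"]
      by (auto simp: single_FWord_Cons free_algebra_gen free_algebra_mult)
  qed
  from this[OF a] have "proj (Poly_Mapping.single a b) \<in> falg.span {y. \<exists>\<mu>. Q.wt \<mu> y}"
    by simp
  then show ?case
    using update.IH[OF f] by (simp add: eq proj_add falg.span_add)
qed

lemma cyc_proj: "\<lbrakk>x \<in> A; y \<in> A\<rbrakk> \<Longrightarrow> cyc x = cyc y \<longleftrightarrow> proj x = proj y"
  by (simp add: cyc_eq proj_eq_iff)

lemma uscal_act: "x \<in> A \<Longrightarrow> uscal n c \<odot>\<^bsub>Mp n L\<^esub> cyc x = cyc (scal c * x)"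
  by (simp add: uscal_def cyc_act A_closed)

lemma highest_weight_iff:
  assumes "x \<in> A"
  shows "cyc x \<in> highest_weight_space n L \<longleftrightarrow> (\<forall>\<gamma>\<in>idxY n. opK \<gamma> (proj x) = scal (top_weight \<gamma>) * proj x)"
proof -
  have "cls n (gK \<gamma>) \<odot>\<^bsub>Mp n L\<^esub> cyc x = uscal n (top_weight \<gamma>) \<odot>\<^bsub>Mp n L\<^esub> cyc x
      \<longleftrightarrow> opK \<gamma> (proj x) = scal (top_weight \<gamma>) * proj x" if "\<gamma> \<in> idxY n" for \<gamma>
    using that assms op_proj[of "gK \<gamma>" x]
    by (simp add: cyc_act uscal_act A_closed cyc_proj proj_scal)
  then show ?thesis
    using assms by (auto simp: highest_weight_space_def carrier_Mp)
qed

lemma highest_weight_space_eq: "highest_weight_space n L = (\<lambda>c. cyc (scal c)) ` UNIV"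
proof (intro equalityI subsetI)
  fix m assume m: "m \<in> highest_weight_space n L"
  then obtain x where x: "m = cyc x" "x \<in> A"
    by (auto simp: highest_weight_space_def carrier_Mp)
  have K: "opK \<gamma> (proj x) = scal (top_weight \<gamma>) * proj x" if "\<gamma> \<in> idxY n" for \<gamma>
    using m x highest_weight_iff that by blast
  have "\<exists>c. proj x = scal c * vac"
    by (rule Q.highest_weight_unique[OF proj_weights[OF x(2)] qq_powi_ne_1])
      (use K in \<open>auto simp: idxY_def top_weight_def\<close>)
  then obtain c where "proj x = proj (scal c)"
    using proj_scal[of _ 1] by (auto simp: vac_def)
  then show "m \<in> (\<lambda>c. cyc (scal c)) ` UNIV"
    using x by (auto simp: cyc_proj A_closed)
next
  fix m assume "m \<in> (\<lambda>c. cyc (scal c)) ` UNIV"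
  then obtain c where m: "m = cyc (scal c)" by blast
  have "proj (scal c) = scal c * vac"
    using proj_scal[of c 1] by (simp add: vac_def)
  then have "opK \<gamma> (proj (scal c)) = scal (top_weight \<gamma>) * proj (scal c)" if "\<gamma> \<in> idxY n" for \<gamma>
    using that by (simp add: op_scal opK_vac mult.assoc[symmetric] scal_mult[symmetric] mult.commute)
  then show "m \<in> highest_weight_space n L"
    unfolding m by (subst highest_weight_iff) (auto intro: A_closed)
qed

lemma opT_word_op:
  assumes "is_braid_word n b" "x \<in> A"
  shows "opT b * x \<in> A \<and> proj (opT b * x) = Q.word_op b (proj x)"
  using assms
proof (induction b)
  case Nil
  then show ?case by (simp add: opT_def)
next
  case (Cons s b)
  obtain i c where s: "s = (i, c)" by force
  have i: "int i \<in> idxI n"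
    using Cons.prems s by (auto simp: idxI_def)
  define y where "y = opT b * x"
  have y: "y \<in> A" "proj y = Q.word_op b (proj x)"
    using Cons s by (auto simp: y_def)
  have op2: "op a (op b' (proj y)) = proj (a * (b' * y))" if "a \<in> A" "b' \<in> A" for a b'
    using that y(1) by (simp add: op_proj A_closed)
  have "opT (s # b) * x = (if c then scal (1 / qq) * y - gF (int i) * (gE (int i) * y)
      else scal qq * y - gE (int i) * (gF (int i) * y))"
    by (simp add: opT_def s y_def left_diff_distrib mult.assoc)
  then show ?case
    using i y by (auto simp: s Q.letter_op_def Q.S_def Q.S_inv_def op2 proj_diff proj_scal A_closed simp flip: y(2))
qed

lemma opC_cup_op:
  assumes "k < n" "x \<in> A"
  shows "opC (Suc k) * x \<in> A \<and> proj (opC (Suc k) * x) = Q.cup_op k (proj x)"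
  using assms(1)
proof (induction k)
  case 0
  then show ?case using assms by (simp add: opC_def op_proj A_closed idxI_def)
next
  case (Suc k)
  define y where "y = opC (Suc k) * x"
  have i: "int k + 1 \<in> idxI n" "- int k - 1 \<in> idxI n"
    using Suc.prems by (auto simp: idxI_def)
  have y: "y \<in> A" "proj y = Q.cup_op k (proj x)"
    using Suc by (auto simp: y_def)
  have idx: "int (Suc k) = int k + 1" "- int (Suc k) = - int k - 1"
    by simp_all
  have "opC (Suc (Suc k)) = gF (int (Suc k)) * gF (- int (Suc k)) * opC (Suc k)"
    by (simp add: opC_def mult.assoc upt_Suc_append[of "Suc 0" "Suc k"] del: upt_Suc of_nat_Suc)
  then have "opC (Suc (Suc k)) * x = gF (int k + 1) * (gF (- int k - 1) * y)"
    unfolding idx by (simp add: y_def mult.assoc)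
  then show ?case
    using i y by (simp add: op_proj A_closed flip: y(2))
qed

lemma opD_cap_op:
  assumes "k < n" "x \<in> A"
  shows "opD (Suc k) * x \<in> A \<and> proj (opD (Suc k) * x) = Q.cap_op k (proj x)"
  using assms
proof (induction k arbitrary: x)
  case 0
  then show ?case by (simp add: opD_def op_proj A_closed idxI_def)
next
  case (Suc k)
  have i: "int k + 1 \<in> idxI n" "- int k - 1 \<in> idxI n"
    using Suc.prems by (auto simp: idxI_def)
  have idx: "int (Suc k) = int k + 1" "- int (Suc k) = - int k - 1"
    by simp_all
  have "opD (Suc (Suc k)) = opD (Suc k) * (gE (int (Suc k)) * gE (- int (Suc k)))"
    by (simp add: opD_def mult.assoc upt_Suc_append[of "Suc 0" "Suc k"] del: upt_Suc of_nat_Suc)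
  then have "opD (Suc (Suc k)) * x = opD (Suc k) * (gE (int k + 1) * (gE (- int k - 1) * x))"
    unfolding idx by (simp add: mult.assoc)
  then show ?case
    using i Suc by (simp add: op_proj A_closed)
qed

lemma cups_eq:
  assumes "k \<le> n"
  shows "(\<Prod>j\<leftarrow>[Suc k..<Suc n]. opC j) \<in> A \<and> proj (\<Prod>j\<leftarrow>[Suc k..<Suc n]. opC j) = Q.cups k"
  using assms
proof (induction k rule: inc_induct)
  case base
  then show ?case by (simp add: Q.cups_def vac_def[symmetric] A_closed)
next
  case (step k)
  have "(\<Prod>j\<leftarrow>[Suc k..<Suc n]. opC j) = opC (Suc k) * (\<Prod>j\<leftarrow>[Suc (Suc k)..<Suc n]. opC j)"
    using step.hyps by (subst upt_conv_Cons) auto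
  then show ?case
    using step opC_cup_op[of k "\<Prod>j\<leftarrow>[Suc (Suc k)..<Suc n]. opC j"] by (simp add: Q.cups_Suc del: upt_Suc)
qed

lemma caps_eq:
  assumes "k \<le> n" "x \<in> A"
  shows "(\<Prod>j\<leftarrow>rev [Suc k..<Suc n]. opD j) * x \<in> A \<and> proj ((\<Prod>j\<leftarrow>rev [Suc k..<Suc n]. opD j) * x) = Q.caps k (proj x)"
  using assms
proof (induction k arbitrary: x rule: inc_induct)
  case base
  then show ?case by (simp add: Q.caps_def)
next
  case (step k)
  have "(\<Prod>j\<leftarrow>rev [Suc k..<Suc n]. opD j) * x = (\<Prod>j\<leftarrow>rev [Suc (Suc k)..<Suc n]. opD j) * (opD (Suc k) * x)"
    using step.hyps by (subst upt_conv_Cons) (auto simp: mult.assoc)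
  then show ?case
    using step opD_cap_op[of k x] by (simp add: Q.caps_Suc del: upt_Suc)
qed

lemma opP_closure_op:
  assumes "is_braid_word n b"
  shows "opP n b \<in> A \<and> proj (opP n b) = Q.closure_op 0 b"
proof -
  note C = cups_eq[OF le0]
  note T = opT_word_op[OF assms, of "\<Prod>j\<leftarrow>[Suc 0..<Suc n]. opC j"]
  note D = caps_eq[of 0 "opT b * (\<Prod>j\<leftarrow>[Suc 0..<Suc n]. opC j)"]
  show ?thesis
    using C T D by (simp add: opP_def Q.closure_op_def mult.assoc del: upt_Suc)
qed

definition scalar_End :: "qfield \<Rightarrow> (uq \<times> 'l \<Rightarrow>\<^sub>0 int) set \<Rightarrow> (uq \<times> 'l \<Rightarrow>\<^sub>0 int) set" where
  "scalar_End c = (\<lambda>m\<in>carrier (Mp n L). uscal n c \<odot>\<^bsub>Mp n L\<^esub> m)"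

lemma scalar_End_cyc: "x \<in> A \<Longrightarrow> scalar_End c (cyc x) = cyc (scal c * x)"
  by (simp add: scalar_End_def carrier_Mp uscal_act)

lemma scalar_End: "scalar_End c \<in> module_End (Uq n) (Mp n L)"
proof -
  have comm: "scal c * (a * x) = a * (scal c * x)" for a x
    by (metis mult.assoc scal_central)
  have "scalar_End c \<in> carrier (Mp n L) \<rightarrow>\<^sub>E carrier (Mp n L)"
    by (auto simp: scalar_End_def carrier_Mp uscal_act A_closed)
  moreover have "scalar_End c (x \<oplus>\<^bsub>Mp n L\<^esub> y) = scalar_End c x \<oplus>\<^bsub>Mp n L\<^esub> scalar_End c y"
    if "x \<in> carrier (Mp n L)" "y \<in> carrier (Mp n L)" for x y
    using that by (auto simp: carrier_Mp cyc_add scalar_End_cyc A_closed ring_distribs)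
  moreover have "scalar_End c (a \<odot>\<^bsub>Mp n L\<^esub> x) = a \<odot>\<^bsub>Mp n L\<^esub> scalar_End c x"
    if "a \<in> carrier (Uq n)" "x \<in> carrier (Mp n L)" for a x
    using that by (auto simp: carrier_Mp carrier_Uq cyc_act scalar_End_cyc A_closed comm)
  ultimately show ?thesis
    by (auto simp: module_End_def)
qed

lemma module_End_eqI:
  assumes "\<phi> \<in> module_End (Uq n) (Mp n L)" "\<psi> \<in> module_End (Uq n) (Mp n L)" "\<phi> (cyc 1) = \<psi> (cyc 1)"
  shows "\<phi> = \<psi>"
proof (rule extensionalityI[of _ "carrier (Mp n L)"])
  show "\<phi> \<in> extensional (carrier (Mp n L))" "\<psi> \<in> extensional (carrier (Mp n L))"
    using assms by (auto simp: module_End_def PiE_def)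
  fix m assume "m \<in> carrier (Mp n L)"
  then obtain x where x: "x \<in> A" "m = cyc x" by (auto simp: carrier_Mp)
  have m: "m = cls n x \<odot>\<^bsub>Mp n L\<^esub> cyc 1"
    using x by (simp add: cyc_act A_closed)
  have "cyc 1 \<in> carrier (Mp n L)" "cls n x \<in> carrier (Uq n)"
    using x A_closed by (auto simp: carrier_Mp carrier_Uq)
  then show "\<phi> m = \<psi> m"
    unfolding m using assms by (auto simp: module_End_def)
qed

lemma scale_End_scalar_End: "scale_End n (Mp n L) c (scalar_End d) = scalar_End (c * d)"
  unfolding scale_End_def
proof (rule extensionalityI[of _ "carrier (Mp n L)"])
  fix m assume m: "m \<in> carrier (Mp n L)"
  then obtain x where x: "x \<in> A" "m = cyc x" by (auto simp: carrier_Mp)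
  have "scal d * x \<in> A" by (intro A_closed x)
  then show "(\<lambda>m\<in>carrier (Mp n L). uscal n c \<odot>\<^bsub>Mp n L\<^esub> scalar_End d m) m = scalar_End (c * d) m"
    using m x(1) unfolding x(2)
    by (simp only: restrict_apply' scalar_End_cyc uscal_act scal_mult mult.assoc)
qed (simp_all only: scalar_End_def restrict_extensional)

lemma scale_End_id: "scale_End n (Mp n L) c (id_End (Mp n L)) = scalar_End c"
  unfolding scale_End_def scalar_End_def id_End_def by (rule restrict_ext) simp

end

theorem theoremA:
  fixes n :: nat and b :: braid_word
    and L :: "(uq, 'l) module" and v :: 'l
    and H :: "diagram \<Rightarrow> qfield"
  assumes "n \<ge> 1"
    and "is_braid_word n b"
    and "is_L_beta n L v"
    and "is_HOMFLY H"
  shows "(\<forall>m \<in> highest_weight_space n L. act_P n L b m \<in> highest_weight_space n L)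
    \<and> (\<exists>!\<phi>. extends_hw n L (act_P n L b) \<phi>)
    \<and> scale_End n (Mp n L) (lam powi writhe (closure_diagram n b)) (End_P n L b)
        \<in> module_End (Uq n) (Mp n L)
    \<and> scale_End n (Mp n L) (lam powi writhe (closure_diagram n b)) (End_P n L b)
        = scale_End n (Mp n L) (H (closure_diagram n b)) (id_End (Mp n L))"
proof -
  interpret verma n L v
    by unfold_locales (fact assms(3))
  interpret homfly H
    by unfold_locales (fact assms(4))
  have "fst ` set b \<subseteq> {Suc 0..<n}"
    using assms(2) by (force simp: is_braid_word_def)
  from closure_op_framed[OF Q.qgl_module_axioms homfly_axioms _ this] assms(1)
  have "Q.closure_op 0 b = scal (framed n b) * vac"
    by simp
  define p where "p = framed n b"
  have P: "opP n b \<in> A" "proj (opP n b) = proj (scal p)"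
    using opP_closure_op[OF assms(2)] \<open>Q.closure_op 0 b = _\<close> proj_scal[of p 1] by (auto simp: p_def vac_def)
  have act: "act_P n L b (cyc (scal c)) = cyc (scal (p * c))" for c
  proof -
    have "opP n b - scal p \<in> null"
      using P A_closed(2) proj_eq_iff by blast
    from null_mult[OF A_closed(2)[of c] this] have "scal c * opP n b - scal c * scal p \<in> null"
      by (simp add: right_diff_distrib)
    then have "cyc (scal c * opP n b) = cyc (scal c * scal p)"
      using P by (simp add: cyc_eq A_closed)
    then show ?thesis
      using P by (simp add: act_P_def cyc_act A_closed scal_central[of "opP n b"] scal_mult scal_central[of "scal c"])
  qed
  have 1: "\<forall>m \<in> highest_weight_space n L. act_P n L b m \<in> highest_weight_space n L"
    by (auto simp: highest_weight_space_eq act)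
  have ext: "extends_hw n L (act_P n L b) (scalar_End p)"
    by (auto simp: extends_hw_def scalar_End highest_weight_space_eq act scalar_End_cyc A_closed scal_mult)
  have uniq: "\<phi> = scalar_End p" if "extends_hw n L (act_P n L b) \<phi>" for \<phi>
  proof (rule module_End_eqI)
    have "cyc 1 \<in> highest_weight_space n L"
      unfolding highest_weight_space_eq by (auto simp: scal_one intro!: image_eqI[of _ _ 1])
    then show "\<phi> (cyc 1) = scalar_End p (cyc 1)"
      using that ext by (auto simp: extends_hw_def)
  qed (use that ext in \<open>auto simp: extends_hw_def\<close>)
  have 2: "\<exists>!\<phi>. extends_hw n L (act_P n L b) \<phi>"
    using ext uniq by blast
  have "End_P n L b = scalar_End p"
    unfolding End_P_def using ext uniq by (rule the_equality)
  moreover have "lam powi writhe (closure_diagram n b) * p = H (closure_diagram n b)"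
  proof -
    have "lam powi e * lam powi (- e) = 1" for e
      using lam_nz by (simp flip: power_int_add)
    then show ?thesis
      unfolding p_def framed_def writhe_closure_diagram[OF assms(2)]
      by (simp only: mult.assoc[symmetric] mult_1)
  qed
  ultimately show ?thesis
    using 1 2 scalar_End by (simp add: scale_End_scalar_End scale_End_id)
qed

end
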